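(* Let $\Gamma\subset\mathbb R^2$ be a connected Lipschitz triangulable curve containing the origin. Then there exists a sequence $\{\Gamma_i\}_{i\in\mathbb N}$ of universal curves such that $$\lim_{i\to\infty}\mathcal H^1(\Gamma_i)=\mathcal H^1(\Gamma)\quad\text{and}\quad\lim_{i\to\infty}d_{\mathcal H}(\Gamma_i,\Gamma)=0,$$ and each $\Gamma_i\setminus S_{\Gamma_i}$ is a closed $C^\infty$ submanifold of $\mathbb R^2\setminus S_{\Gamma_i}$.
   Context: $\mathcal H^1$ is the Hausdorff $1$-measure on $\mathbb R^2$, and $d_{\mathcal H}$ is the Hausdorff metric on the set of compact subsets of $\mathbb R^2$. A compact set $\Gamma\subset\mathbb R^2$ is a Lipschitz triangulable curve if there exist a finite subset $S\subset\Gamma$ and Lipschitz and locally bi-Lipschitz arcs $h_1,\dots,h_k:(0,1)\to\mathbb R^2$ such that $\Gamma\setminus S$ is the disjoint union of the sets $h_i((0,1))$, $1\le i\le k$. A point $x\in\Gamma$ has order $k$ if for all sufficiently small open disks $D_x$ centered at $x$, $\Gamma\setminus\{x\}$ has $k$ connected components in $D_x\setminus\{x\}$. $S_\Gamma\subset\Gamma$ denotes the (finite) set of points of order $\ne2$. Fix $T>0$. For real bounded Lebesgue measurable functions $a_1,a_2$ on $[0,T]$ consider the Abel equation $\frac{dv}{dt}=a_1v^2+a_2v^3$ on $[0,T]$ (solutions are absolutely continuous functions satisfying the equation almost everywhere), and the Lipschitz path $\tilde A:[0,T]\to\mathbb R^2$, $\tilde A(t)=\bigl(\int_0^t a_1(s)\,ds,\int_0^t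 a_2(s)\,ds\bigr)$, with image $\Gamma_{\tilde A}$. The equation has a center on $[0,T]$ if for all sufficiently small initial values $v_0$ the solution with $v(0)=v_0$ satisfies $v(T)=v_0$. The center is universal if all iterated integrals $I_{i_1,\dots,i_k}(a)=\int\cdots\int_{0\le s_1\le\cdots\le s_k\le T}a_{i_k}(s_k)\cdots a_{i_1}(s_1)\,ds_k\cdots ds_1$ ($k\ge1$, $i_1,\dots,i_k\in\{1,2\}$) vanish. A connected Lipschitz triangulable curve $\Gamma\subset\mathbb R^2$ containing the origin is universal if, whenever an Abel equation $\frac{dv}{dt}=a_1v^2+a_2v^3$ on $[0,T]$ with real bounded Lebesgue measurable coefficients $a_1,a_2$ and with $\Gamma_{\tilde A}\subset\Gamma$ has a center on $[0,T]$, this center is universal. *)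

theory Defs
  imports "HOL-Analysis.Analysis"
begin

text \<open>The library's \<open>diameter\<close> is meaningless on unbounded sets, so the covering sets are
  required to be bounded. The measure is normalised so that a unit segment has measure \<open>1\<close>.\<close>

definition hausdorff_pre1 :: "real \<Rightarrow> 'a::metric_space set \<Rightarrow> ennreal" where
  "hausdorff_pre1 \<delta> A =
     (INF C \<in> {C :: nat \<Rightarrow> 'a set. A \<subseteq> (\<Union>n. C n) \<and> (\<forall>n. bounded (C n) \<and> diameter (C n) \<le> \<delta>)}.
        \<Sum>n. ennreal (diameter (C n)))"

definition hausdorff1 :: "'a::metric_space set \<Rightarrow> ennreal" where
  "hausdorff1 A = (SUP \<delta>\<in>{0<..}. hausdorff_pre1 \<delta> A)"

text \<open>Only used for nonempty compact sets, where both suprema are attained.\<close>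

definition hausdorff_dist :: "'a::metric_space set \<Rightarrow> 'a set \<Rightarrow> real" where
  "hausdorff_dist A B = max (SUP x\<in>A. infdist x B) (SUP y\<in>B. infdist y A)"

definition bi_lipschitz_on :: "('a::metric_space \<Rightarrow> 'b::metric_space) \<Rightarrow> 'a set \<Rightarrow> bool" where
  "bi_lipschitz_on h U \<longleftrightarrow>
     (\<exists>L>0. \<forall>s\<in>U. \<forall>t\<in>U. dist s t / L \<le> dist (h s) (h t) \<and> dist (h s) (h t) \<le> L * dist s t)"

definition lipschitz_arc :: "(real \<Rightarrow> real^2) \<Rightarrow> bool" where
  "lipschitz_arc h \<longleftrightarrow>
     inj_on h {0<..<1} \<and>
     (\<exists>L. L-lipschitz_on {0<..<1} h) \<and>
     (\<forall>t\<in>{0<..<1}. \<exists>\<epsilon>>0. bi_lipschitz_on h ({0<..<1} \<inter> ball t \<epsilon>))"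

definition lipschitz_triangulable :: "(real^2) set \<Rightarrow> bool" where
  "lipschitz_triangulable \<Gamma> \<longleftrightarrow>
     compact \<Gamma> \<and>
     (\<exists>S k. \<exists>h :: nat \<Rightarrow> real \<Rightarrow> real^2.
        finite S \<and> S \<subseteq> \<Gamma> \<and>
        (\<forall>i<k. lipschitz_arc (h i)) \<and>
        disjoint_family_on (\<lambda>i. h i ` {0<..<1}) {..<k} \<and>
        \<Gamma> - S = (\<Union>i<k. h i ` {0<..<1}))"

definition has_order :: "(real^2) set \<Rightarrow> real^2 \<Rightarrow> nat \<Rightarrow> bool" where
  "has_order \<Gamma> x k \<longleftrightarrow>
     x \<in> \<Gamma> \<and>
     (\<exists>r0>0. \<forall>r. 0 < r \<and> r < r0 \<longrightarrow>
        finite (components (\<Gamma> \<inter> (ball x r - {x}))) \<and>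
        card (components (\<Gamma> \<inter> (ball x r - {x}))) = k)"

text \<open>A point at which the number of components does not stabilise has no order and hence
  does not belong to the following set.\<close>

definition singular_points :: "(real^2) set \<Rightarrow> (real^2) set" where
  "singular_points \<Gamma> = {x. \<exists>k. has_order \<Gamma> x k \<and> k \<noteq> 2}"

definition smooth_curve_on :: "real set \<Rightarrow> (real \<Rightarrow> real^2) \<Rightarrow> (real \<Rightarrow> real^2) \<Rightarrow> bool" where
  \<comment> \<open>on the open set \<open>J\<close> the map \<open>\<phi>\<close> has derivatives of all orders, the first being \<open>\<phi>'\<close>\<close>
  "smooth_curve_on J \<phi> \<phi>' \<longleftrightarrow>
     (\<exists>D :: nat \<Rightarrow> real \<Rightarrow> real^2. D 0 = \<phi> \<and> D 1 = \<phi>' \<and>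
        (\<forall>n. \<forall>t\<in>J. (D n has_vector_derivative D (Suc n) t) (at t)))"

text \<open>Embedded submanifolds, described by local regular parametrisations that are homeomorphisms
  onto relatively open pieces.\<close>

definition smooth_1submanifold :: "(real^2) set \<Rightarrow> bool" where
  "smooth_1submanifold M \<longleftrightarrow>
     (\<forall>p\<in>M. \<exists>W J \<phi> \<phi>' \<psi>.
        open W \<and> p \<in> W \<and> open J \<and>
        smooth_curve_on J \<phi> \<phi>' \<and> (\<forall>t\<in>J. \<phi>' t \<noteq> 0) \<and>
        homeomorphism J (M \<inter> W) \<phi> \<psi>)"

definition closed_smooth_1submanifold_of :: "(real^2) set \<Rightarrow> (real^2) set \<Rightarrow> bool" where
  "closed_smooth_1submanifold_of U M \<longleftrightarrow>
     open U \<and> closedin (top_of_set U) M \<and> smooth_1submanifold M"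

text \<open>A coefficient pair is a function \<open>a\<close> on the two-element type \<open>2\<close>, whose elements are
  \<open>1\<close> and \<open>2\<close> (with \<open>2 = 0\<close>); this is also the index type of \<open>real^2\<close>.\<close>

definition abel_coefficients :: "real \<Rightarrow> (2 \<Rightarrow> real \<Rightarrow> real) \<Rightarrow> bool" where
  "abel_coefficients T a \<longleftrightarrow>
     (\<forall>i. a i \<in> borel_measurable (lebesgue_on {0..T}) \<and> bounded (a i ` {0..T}))"

definition absolutely_continuous_on :: "real set \<Rightarrow> (real \<Rightarrow> real) \<Rightarrow> bool" where
  "absolutely_continuous_on S f \<longleftrightarrow>
     (\<forall>\<epsilon>>0. \<exists>\<delta>>0. \<forall>\<D>. \<D> division_of \<Union>\<D> \<and> \<Union>\<D> \<subseteq> S \<and> (\<Sum>K\<in>\<D>. Sup K - Inf K) < \<delta>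
        \<longrightarrow> (\<Sum>K\<in>\<D>. \<bar>f (Sup K) - f (Inf K)\<bar>) < \<epsilon>)"

definition abel_solution :: "real \<Rightarrow> (2 \<Rightarrow> real \<Rightarrow> real) \<Rightarrow> (real \<Rightarrow> real) \<Rightarrow> bool" where
  "abel_solution T a v \<longleftrightarrow>
     absolutely_continuous_on {0..T} v \<and>
     (AE t in lebesgue_on {0..T}.
        (v has_real_derivative a 1 t * v t ^ 2 + a 2 t * v t ^ 3) (at t within {0..T}))"

definition abel_center :: "real \<Rightarrow> (2 \<Rightarrow> real \<Rightarrow> real) \<Rightarrow> bool" where
  "abel_center T a \<longleftrightarrow>
     (\<exists>\<epsilon>>0. \<forall>v0. \<bar>v0\<bar> < \<epsilon> \<longrightarrow>
        (\<exists>v. abel_solution T a v \<and> v 0 = v0) \<and>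
        (\<forall>v. abel_solution T a v \<and> v 0 = v0 \<longrightarrow> v T = v0))"

definition abel_path :: "(2 \<Rightarrow> real \<Rightarrow> real) \<Rightarrow> real \<Rightarrow> real^2" where
  "abel_path a t = (\<chi> i. LINT s:{0..t}|lebesgue. a i s)"

definition ordered_simplex :: "real \<Rightarrow> nat \<Rightarrow> (nat \<Rightarrow> real) set" where
  "ordered_simplex T k = {s \<in> {..<k} \<rightarrow>\<^sub>E {0..T}. mono_on {..<k} s}"

text \<open>The word \<open>w\<close> lists the indices \<open>i\<^sub>1, \<dots>, i\<^sub>k\<close>; positions are counted from \<open>0\<close>.\<close>

definition iterated_integral :: "real \<Rightarrow> (2 \<Rightarrow> real \<Rightarrow> real) \<Rightarrow> 2 list \<Rightarrow> real" where
  "iterated_integral T a w =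
     (LINT s:ordered_simplex T (length w)|Pi\<^sub>M {..<length w} (\<lambda>_. lebesgue_on {0..T}).
        \<Prod>j<length w. a (w ! j) (s j))"

definition universal_center :: "real \<Rightarrow> (2 \<Rightarrow> real \<Rightarrow> real) \<Rightarrow> bool" where
  "universal_center T a \<longleftrightarrow> abel_center T a \<and> (\<forall>w. w \<noteq> [] \<longrightarrow> iterated_integral T a w = 0)"

definition universal_curve :: "real \<Rightarrow> (real^2) set \<Rightarrow> bool" where
  "universal_curve T \<Gamma> \<longleftrightarrow>
     connected \<Gamma> \<and> lipschitz_triangulable \<Gamma> \<and> 0 \<in> \<Gamma> \<and>
     (\<forall>a. abel_coefficients T a \<and> abel_path a ` {0..T} \<subseteq> \<Gamma> \<and> abel_center T a
        \<longrightarrow> universal_center T a)"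

end

theory Submission
  imports Defs
begin

text \<open>The curves \<open>\<Gamma>\<^sub>i\<close> are finite straight-line trees. A tree is universal: a center forces the path
  to be closed, and on a tree every one-form \<open>f dx\<^sub>j\<close> has a primitive, so integrating out the last
  variable of an iterated integral over a closed path leaves an iterated integral of one order less
  of the same kind. To approximate \<open>\<Gamma>\<close>, chords of its arcs together with finitely many short
  links are attached one at a time, each only up to the point where it first meets the tree built
  so far; this gives a tree near \<open>\<Gamma>\<close> whose length exceeds \<open>\<H>\<^sup>1(\<Gamma>)\<close> by at most an arbitrarily
  small amount. Short hairs attached to the tree then make up for missing length, and
  one further tiny hair at each vertex of degree two makes every corner a point of order three,
  so that the nonsingular part of the tree consists of open segments.\<close>

section \<open>Hausdorff measure of dimension one\<close>

text \<open>Only an upper estimate of the tree's length is extracted from \<open>\<Gamma>\<close>.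
  Disjoint subarcs have measure at least the lengths of their chords, so all chords together are no
  longer than \<open>\<Gamma>\<close>. The extra links join a fixed number \<open>k\<close> of arcs,
  so there are at most \<open>k^2 + k\<close> of them whatever the mesh \<open>1 / m\<close>, and
  each has length O(1/m): refining the mesh makes their total negligible. From below there is no
  comparable control, because links are attached only in part and the ends of the arcs carry no
  chords; this is why length has to be added by hand. Adding it is harmless because universality
  depends only on being a tree through the origin, not on its shape. The reason is that an integral
  of \<open>a i\<close> against a function of the path, taken from time \<open>t\<close> to
  \<open>T\<close>, depends on \<open>t\<close> only through the position at time \<open>t\<close>.
  Thus the class of weights that are functions on the tree is preserved when a variable is
  integrated out, and induction on the order becomes possible.\<close>

lemma hausdorff_pre1_le:
  assumes "A \<subseteq> (\<Union>n. C n)" "\<And>n. bounded (C n)" "\<And>n. diameter (C n) \<le> \<delta>"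
  shows "hausdorff_pre1 \<delta> A \<le> (\<Sum>n. ennreal (diameter (C n)))"
  unfolding hausdorff_pre1_def using assms by (intro INF_lower) auto

lemma hausdorff_pre1_ge:
  assumes "\<And>C. \<lbrakk>A \<subseteq> (\<Union>n. C n); \<And>n. bounded (C n); \<And>n. diameter (C n) \<le> \<delta>\<rbrakk>
      \<Longrightarrow> x \<le> (\<Sum>n. ennreal (diameter (C n)))"
  shows "x \<le> hausdorff_pre1 \<delta> A"
  unfolding hausdorff_pre1_def using assms by (intro INF_greatest) auto

lemma hausdorff_pre1_mono: "A \<subseteq> B \<Longrightarrow> hausdorff_pre1 \<delta> A \<le> hausdorff_pre1 \<delta> B"
  by (rule hausdorff_pre1_ge, rule hausdorff_pre1_le) auto

lemma hausdorff_pre1_antimono: "\<delta> \<le> \<delta>' \<Longrightarrow> hausdorff_pre1 \<delta>' A \<le> hausdorff_pre1 \<delta> A"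
  by (rule hausdorff_pre1_ge, rule hausdorff_pre1_le) (auto intro: order_trans)

lemma hausdorff_pre1_le_hausdorff1: "\<delta> > 0 \<Longrightarrow> hausdorff_pre1 \<delta> A \<le> hausdorff1 A"
  unfolding hausdorff1_def by (intro SUP_upper) auto

lemma hausdorff1_le: "(\<And>\<delta>. \<delta> > 0 \<Longrightarrow> hausdorff_pre1 \<delta> A \<le> x) \<Longrightarrow> hausdorff1 A \<le> x"
  unfolding hausdorff1_def by (intro SUP_least) auto

lemma hausdorff1_mono: "A \<subseteq> B \<Longrightarrow> hausdorff1 A \<le> hausdorff1 B"
  by (meson hausdorff1_le hausdorff_pre1_le_hausdorff1 hausdorff_pre1_mono order_trans)

text \<open>Two countable covers are merged by alternating their members; this gives the total
  diameter of the merged cover.\<close>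

lemma suminf_interleave:
  fixes f :: "nat \<Rightarrow> ennreal"
  shows "(\<Sum>n. f n) = (\<Sum>n. f (2*n)) + (\<Sum>n. f (2*n+1))"
proof -
  have eq: "(\<Sum>n<2*N. f n) = (\<Sum>n<N. f (2*n)) + (\<Sum>n<N. f (2*n+1))" for N
    by (induction N) (auto simp: algebra_simps)
  have "(\<lambda>N. \<Sum>n<2*N. f n) \<longlonglongrightarrow> (\<Sum>n. f n)"
    using LIMSEQ_subseq_LIMSEQ[OF summable_LIMSEQ[OF summableI, of f], of "\<lambda>N. 2*N"]
    by (auto simp: strict_mono_def o_def)
  moreover have "(\<lambda>N. \<Sum>n<2*N. f n) \<longlonglongrightarrow> (\<Sum>n. f (2*n)) + (\<Sum>n. f (2*n+1))"
    unfolding eq by (intro tendsto_add summable_LIMSEQ summableI)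
  ultimately show ?thesis
    using LIMSEQ_unique by blast
qed

text \<open>Near-optimal covers of the two sets are alternated, each wasting at most half of the
  error. An infinite right-hand side leaves nothing to prove, so both optima may be taken
  finite.\<close>

lemma hausdorff_pre1_Un: "hausdorff_pre1 \<delta> (A \<union> B) \<le> hausdorff_pre1 \<delta> A + hausdorff_pre1 \<delta> B"
proof -
  define CC where "CC X = {C :: nat \<Rightarrow> 'a set. X \<subseteq> (\<Union>n. C n) \<and> (\<forall>n. bounded (C n) \<and> diameter (C n) \<le> \<delta>)}" for X
  define S where "S C = (\<Sum>n. ennreal (diameter (C n)))" for C :: "nat \<Rightarrow> 'a set"
  have pre: "hausdorff_pre1 \<delta> X = (INF C\<in>CC X. S C)" for X
    unfolding hausdorff_pre1_def CC_def S_def ..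
  have le: "hausdorff_pre1 \<delta> (A \<union> B) \<le> S C + S D" if C: "C \<in> CC A" and D: "D \<in> CC B" for C D
  proof -
    define F where "F n = (if even n then C (n div 2) else D (n div 2))" for n
    have F: "F (2*n) = C n" "F (2*n+1) = D n" for n
      by (auto simp: F_def)
    have "C n \<subseteq> (\<Union>n. F n)" "D n \<subseteq> (\<Union>n. F n)" for n
      using F by blast+
    then have "A \<union> B \<subseteq> (\<Union>n. F n)"
      using C D by (auto simp: CC_def) blast+
    moreover have "bounded (F n)" "diameter (F n) \<le> \<delta>" for n
      using C D by (auto simp: CC_def F_def)
    ultimately have "hausdorff_pre1 \<delta> (A \<union> B) \<le> (\<Sum>n. ennreal (diameter (F n)))"
      by (intro hausdorff_pre1_le)
    also have "\<dots> = S C + S D"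
      using suminf_interleave[of "\<lambda>n. ennreal (diameter (F n))"] by (simp only: F S_def)
    finally show ?thesis .
  qed
  show ?thesis
  proof (rule ennreal_le_epsilon)
    fix e :: real
    assume fin: "hausdorff_pre1 \<delta> A + hausdorff_pre1 \<delta> B < top" and "e > 0"
    then have e2: "0 < e/2" and A: "hausdorff_pre1 \<delta> A \<noteq> \<infinity>" and B: "hausdorff_pre1 \<delta> B \<noteq> \<infinity>"
      by auto
    obtain C where C: "C \<in> CC A" "S C < hausdorff_pre1 \<delta> A + ennreal (e/2)"
      using INF_approx_ennreal[OF e2 pre A] by blast
    obtain D where D: "D \<in> CC B" "S D < hausdorff_pre1 \<delta> B + ennreal (e/2)"
      using INF_approx_ennreal[OF e2 pre B] by blast
    have "hausdorff_pre1 \<delta> (A \<union> B) \<le> S C + S D"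
      using C D by (intro le)
    also have "\<dots> \<le> (hausdorff_pre1 \<delta> A + ennreal (e/2)) + (hausdorff_pre1 \<delta> B + ennreal (e/2))"
      using C D by (intro add_mono) auto
    also have "\<dots> = hausdorff_pre1 \<delta> A + hausdorff_pre1 \<delta> B + (ennreal (e/2) + ennreal (e/2))"
      by (simp add: ac_simps)
    also have "ennreal (e/2) + ennreal (e/2) = ennreal e"
      using \<open>e > 0\<close> by (simp flip: ennreal_plus)
    finally show "hausdorff_pre1 \<delta> (A \<union> B) \<le> hausdorff_pre1 \<delta> A + hausdorff_pre1 \<delta> B + ennreal e" .
  qed
qed

lemma hausdorff1_Un: "hausdorff1 (A \<union> B) \<le> hausdorff1 A + hausdorff1 B"
  by (rule hausdorff1_le)
    (meson add_mono hausdorff_pre1_Un hausdorff_pre1_le_hausdorff1 order_trans)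

text \<open>Cutting the parameter interval into \<open>N\<close> equal cells gives images of
  diameter at most \<open>L / N\<close>, and these bounds add up to \<open>L\<close> for every
  \<open>N\<close>.\<close>

lemma hausdorff1_lipschitz_image:
  fixes h :: "real \<Rightarrow> 'a::metric_space"
  assumes L: "L-lipschitz_on {0<..<1} h"
  shows "hausdorff1 (h ` {0<..<1}) \<le> ennreal L"
proof (rule hausdorff1_le)
  fix \<delta> :: real assume "\<delta> > 0"
  have L0: "L \<ge> 0"
    using L lipschitz_on_nonneg by blast
  obtain N :: nat where N: "N > 0" "L / N \<le> \<delta>"
  proof -
    obtain N :: nat where "N > L / \<delta>"
      using reals_Archimedean2 by blast
    then have "L / (Suc N) \<le> \<delta>"
      using \<open>\<delta> > 0\<close> by (simp add: field_simps)
    then show ?thesis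
      using that[of "Suc N"] by auto
  qed
  define I where "I n = {real n / N .. (real n + 1) / N} \<inter> {0<..<1}" for n
  \<comment> \<open>A cover is an infinite sequence, so it is padded with empty sets, whose diameter
    is 0.\<close>
  define C where "C n = (if n < N then h ` I n else {})" for n
  have dist: "dist (h x) (h y) \<le> L / N" if "x \<in> I n" "y \<in> I n" for x y n
  proof -
    have "dist x y \<le> (real n + 1) / N - real n / N"
      using that unfolding I_def dist_real_def by (auto simp: abs_le_iff)
    then have "dist x y \<le> 1 / N"
      by (simp add: diff_divide_distrib[symmetric])
    then have "L * dist x y \<le> L * (1 / N)"
      using L0 by (rule mult_left_mono)
    moreover have "dist (h x) (h y) \<le> L * dist x y"
      using that L by (auto simp: I_def lipschitz_on_def)
    ultimately show ?thesis
      by simp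
  qed
  have LN: "0 \<le> L / N"
    using L0 by simp
  have diam: "diameter (C n) \<le> L / N" for n
    unfolding C_def diameter_def using dist LN by (auto intro!: cSUP_least)
  have bdd: "bounded (C n)" for n
    unfolding C_def bounded_two_points using dist by auto
  have "h ` {0<..<1} \<subseteq> (\<Union>n. C n)"
  proof clarify
    fix t :: real assume t: "t \<in> {0<..<1}"
    define n where "n = nat \<lfloor>t * N\<rfloor>"
    have n: "real n \<le> t * N" "t * N < real n + 1"
      using t by (auto simp: n_def)
    have "t * N < 1 * real N"
      using t N by (intro mult_strict_right_mono) auto
    with n have "real n < N"
      by linarith
    then have "h t \<in> C n"
      using n t N by (auto simp: C_def I_def field_simps)
    then show "h t \<in> (\<Union>n. C n)"
      by blast
  qed
  then have "hausdorff_pre1 \<delta> (h ` {0<..<1}) \<le> (\<Sum>n. ennreal (diameter (C n)))"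
    using bdd order_trans[OF diam N(2)] by (intro hausdorff_pre1_le) auto
  also have "\<dots> = (\<Sum>n<N. ennreal (diameter (C n)))"
    by (rule suminf_finite) (auto simp: C_def)
  also have "\<dots> \<le> (\<Sum>n<N. ennreal (L / N))"
    using diam by (intro sum_mono ennreal_leI)
  also have "\<dots> = ennreal (\<Sum>n<N. L / N)"
    using LN by (intro sum_ennreal) auto
  also have "\<dots> = ennreal L"
    using N by simp
  finally show "hausdorff_pre1 \<delta> (h ` {0<..<1}) \<le> ennreal L" .
qed

lemma hausdorff1_singleton [simp]: "hausdorff1 {x} = 0"
  using hausdorff1_lipschitz_image[of 0 "\<lambda>_. x"] by (simp add: lipschitz_on_def image_constant_conv)

lemma hausdorff1_empty [simp]: "hausdorff1 {} = 0"
  using hausdorff1_mono[of "{}" "{undefined}"] by simp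

lemma hausdorff1_Union_le:
  "finite I \<Longrightarrow> hausdorff1 (\<Union>i\<in>I. A i) \<le> (\<Sum>i\<in>I. hausdorff1 (A i))"
proof (induction I rule: finite_induct)
  case (insert i I)
  have "hausdorff1 (\<Union>i\<in>insert i I. A i) \<le> hausdorff1 (A i) + hausdorff1 (\<Union>i\<in>I. A i)"
    using hausdorff1_Un by simp
  also have "\<dots> \<le> hausdorff1 (A i) + (\<Sum>i\<in>I. hausdorff1 (A i))"
    using insert by (intro add_left_mono)
  finally show ?case
    using insert by simp
qed simp

lemma hausdorff1_finite: "finite S \<Longrightarrow> hausdorff1 S = 0"
  using hausdorff1_Union_le[of S "\<lambda>x. {x}"] by simp

text \<open>A set of diameter less than \<open>d\<close> cannot meet both \<open>A\<close> and
  \<open>B\<close>, so a sufficiently fine cover splits into a cover of each.\<close>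

lemma hausdorff1_separated:
  assumes "d > 0" and d: "\<And>x y. x \<in> A \<Longrightarrow> y \<in> B \<Longrightarrow> d \<le> dist x y"
  shows "hausdorff1 A + hausdorff1 B \<le> hausdorff1 (A \<union> B)"
proof -
  have small: "hausdorff_pre1 \<delta> A + hausdorff_pre1 \<delta> B \<le> hausdorff_pre1 \<delta> (A \<union> B)" if "\<delta> < d" for \<delta>
  proof (rule hausdorff_pre1_ge)
    fix C :: "nat \<Rightarrow> 'a set"
    assume C: "A \<union> B \<subseteq> (\<Union>n. C n)" "\<And>n. bounded (C n)" "\<And>n. diameter (C n) \<le> \<delta>"
    have split: "ennreal (diameter (C n \<inter> A)) + ennreal (diameter (C n \<inter> B)) \<le> ennreal (diameter (C n))" for n
    proof -
      have "C n \<inter> A = {} \<or> C n \<inter> B = {}"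
        using diameter_bounded_bound[OF C(2)[of n]] C(3)[of n] d \<open>\<delta> < d\<close> by fastforce
      moreover have "diameter (C n \<inter> X) \<le> diameter (C n)" for X
        using C by (intro diameter_subset) auto
      ultimately show ?thesis
        by (elim disjE) (simp_all add: ennreal_leI)
    qed
    have X: "hausdorff_pre1 \<delta> X \<le> (\<Sum>n. ennreal (diameter (C n \<inter> X)))" if "X \<subseteq> A \<union> B" for X
    proof (rule hausdorff_pre1_le)
      show "X \<subseteq> (\<Union>n. C n \<inter> X)"
        using that C by blast
      show "bounded (C n \<inter> X)" for n
        using C by (meson bounded_Int)
      show "diameter (C n \<inter> X) \<le> \<delta>" for n
        using C by (meson diameter_subset inf_le1 order_trans)
    qed
    have "hausdorff_pre1 \<delta> A + hausdorff_pre1 \<delta> B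
        \<le> (\<Sum>n. ennreal (diameter (C n \<inter> A))) + (\<Sum>n. ennreal (diameter (C n \<inter> B)))"
      by (intro add_mono X) auto
    also have "\<dots> = (\<Sum>n. ennreal (diameter (C n \<inter> A)) + ennreal (diameter (C n \<inter> B)))"
      by (rule suminf_add) auto
    also have "\<dots> \<le> (\<Sum>n. ennreal (diameter (C n)))"
      by (intro suminf_le split) auto
    finally show "hausdorff_pre1 \<delta> A + hausdorff_pre1 \<delta> B \<le> (\<Sum>n. ennreal (diameter (C n)))" .
  qed
  have "hausdorff1 A + hausdorff1 B
      = (SUP \<delta>\<in>{0<..}. hausdorff_pre1 \<delta> A + hausdorff_pre1 \<delta> B)"
    unfolding hausdorff1_def
  proof (rule SUP_add_directed_ennreal[symmetric])
    fix i j :: real assume "i \<in> {0<..}" "j \<in> {0<..}"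
    then show "\<exists>k\<in>{0<..}. hausdorff_pre1 i A + hausdorff_pre1 j B \<le> hausdorff_pre1 k A + hausdorff_pre1 k B"
      by (intro bexI[of _ "min i j"] add_mono hausdorff_pre1_antimono) auto
  qed
  also have "\<dots> \<le> hausdorff1 (A \<union> B)"
  proof (rule SUP_least)
    fix \<delta> :: real assume "\<delta> \<in> {0<..}"
    \<comment> \<open>Premeasures grow as the scale shrinks, so it is enough to compare them at
      scales below \<open>d\<close>.\<close>
    then have m: "0 < min \<delta> (d/2)" "min \<delta> (d/2) < d"
      using \<open>d > 0\<close> by auto
    have "hausdorff_pre1 \<delta> A + hausdorff_pre1 \<delta> B
        \<le> hausdorff_pre1 (min \<delta> (d/2)) A + hausdorff_pre1 (min \<delta> (d/2)) B"
      by (intro add_mono hausdorff_pre1_antimono) auto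
    also have "\<dots> \<le> hausdorff1 (A \<union> B)"
      using small[OF m(2)] hausdorff_pre1_le_hausdorff1[OF m(1)] by (rule order_trans)
    finally show "hausdorff_pre1 \<delta> A + hausdorff_pre1 \<delta> B \<le> hausdorff1 (A \<union> B)" .
  qed
  finally show ?thesis .
qed

text \<open>Disjoint compact sets have positive distance. Both lower bounds for lengths, that of a
  skeleton and that of a curve by its chords, rest on this form of additivity.\<close>

lemma hausdorff1_disjoint_compact_Union:
  fixes K :: "'i \<Rightarrow> 'a::heine_borel set"
  assumes "finite I" "\<And>i. i \<in> I \<Longrightarrow> compact (K i)" "disjoint_family_on K I"
  shows "(\<Sum>i\<in>I. hausdorff1 (K i)) \<le> hausdorff1 (\<Union>i\<in>I. K i)"
  using assms
proof (induction I rule: finite_induct)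
  case (insert i I)
  have U: "compact (\<Union>i\<in>I. K i)"
    using insert by (intro compact_UN) auto
  have "K i \<inter> (\<Union>i\<in>I. K i) = {}"
    using insert.prems(2) insert.hyps by (auto simp: disjoint_family_on_def)
  then obtain d where "d > 0" "\<And>x y. x \<in> K i \<Longrightarrow> y \<in> (\<Union>i\<in>I. K i) \<Longrightarrow> d \<le> dist x y"
    using separate_compact_closed[of "K i" "\<Union>i\<in>I. K i"] compact_imp_closed[OF U] insert.prems(1)
    by (metis (no_types, lifting) insertI1)
  then have "hausdorff1 (K i) + hausdorff1 (\<Union>i\<in>I. K i) \<le> hausdorff1 (K i \<union> (\<Union>i\<in>I. K i))"
    by (rule hausdorff1_separated)
  moreover have "(\<Sum>i\<in>I. hausdorff1 (K i)) \<le> hausdorff1 (\<Union>i\<in>I. K i)"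
    using insert by (auto simp: disjoint_family_on_def)
  ultimately show ?case
    using insert.hyps by (simp, meson add_left_mono order_trans)
qed simp

text \<open>The distance from \<open>x\<close> is 1-Lipschitz, and on a connected set its values
  fill the whole interval up to \<open>dist x y\<close>. Each covering set is sent into an interval
  no longer than its diameter, so the bound reduces to countable subadditivity of Lebesgue measure
  on the line.\<close>

lemma hausdorff1_connected_ge:
  assumes "connected A" "x \<in> A" "y \<in> A"
  shows "ennreal (dist x y) \<le> hausdorff1 A"
proof -
  have "ennreal (dist x y) \<le> hausdorff_pre1 1 A"
  proof (rule hausdorff_pre1_ge)
    fix C :: "nat \<Rightarrow> 'a set"
    assume C: "A \<subseteq> (\<Union>n. C n)" "\<And>n. bounded (C n)"
    define a where "a n = (INF z\<in>C n. dist x z)" for n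
    \<comment> \<open>Empty covering sets are set apart because the infimum \<open>a n\<close> is
      meaningless for them.\<close>
    define I where "I n = (if C n = {} then {} else {a n .. a n + diameter (C n)})" for n
    have CI: "dist x z \<in> I n" if "z \<in> C n" for z n
    proof -
      have lower: "a n \<le> dist x z"
        unfolding a_def using that by (intro cINF_lower) (auto intro: bdd_belowI[of _ 0])
      have "dist x z - diameter (C n) \<le> a n"
        unfolding a_def
      proof (rule cINF_greatest)
        show "C n \<noteq> {}"
          using that by auto
        fix w assume "w \<in> C n"
        then have "dist w z \<le> diameter (C n)"
          using that C by (intro diameter_bounded_bound)
        then show "dist x z - diameter (C n) \<le> dist x w"
          using dist_triangle[of x z w] by linarith
      qed
      then show ?thesis
        using lower that by (auto simp: I_def)
    qed
    have "connected (dist x ` A)"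
      using assms by (intro connected_continuous_image continuous_intros) auto
    moreover have "0 \<in> dist x ` A" "dist x y \<in> dist x ` A"
      using assms by (auto simp: image_iff intro: bexI[of _ x])
    ultimately have "{0..dist x y} \<subseteq> dist x ` A"
      by (simp add: connected_contains_Icc)
    moreover have "dist x ` A \<subseteq> (\<Union>n. I n)"
    proof clarify
      fix z assume "z \<in> A"
      then obtain n where "z \<in> C n"
        using C(1) by blast
      then show "dist x z \<in> (\<Union>n. I n)"
        using CI by blast
    qed
    ultimately have cov: "{0..dist x y} \<subseteq> (\<Union>n. I n)"
      by (rule order_trans)
    have "ennreal (dist x y) = emeasure lborel {0..dist x y}"
      by simp
    also have "\<dots> \<le> emeasure lborel (\<Union>n. I n)"
      using cov by (intro emeasure_mono) (auto simp: I_def)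
    also have "\<dots> \<le> (\<Sum>n. emeasure lborel (I n))"
      by (intro emeasure_subadditive_countably) (auto simp: I_def)
    also have "\<dots> \<le> (\<Sum>n. ennreal (diameter (C n)))"
      using diameter_ge_0[OF C(2)] by (intro suminf_le) (auto simp: I_def)
    finally show "ennreal (dist x y) \<le> (\<Sum>n. ennreal (diameter (C n)))" .
  qed
  then show ?thesis
    using hausdorff_pre1_le_hausdorff1[of 1 A] by (simp add: order_trans)
qed

section \<open>Straight-line trees\<close>

text \<open>Edges are taken open so that the vertices and edges of a straight graph partition its
  point set. The orientation of a pair does not affect the skeleton.\<close>

definition skeleton :: "'a::euclidean_space set \<Rightarrow> ('a \<times> 'a) set \<Rightarrow> 'a set" where
  "skeleton V E = V \<union> (\<Union>e\<in>E. open_segment (fst e) (snd e))"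

definition total_length :: "('a::euclidean_space \<times> 'a) set \<Rightarrow> real" where
  "total_length E = (\<Sum>e\<in>E. dist (fst e) (snd e))"

text \<open>A plane straight-line graph: two different closed edges can only meet in endpoints of
  both.\<close>

definition straight_graph :: "'a::euclidean_space set \<Rightarrow> ('a \<times> 'a) set \<Rightarrow> bool" where
  "straight_graph V E \<longleftrightarrow> finite V \<and> finite E \<and>
     (\<forall>e\<in>E. fst e \<in> V \<and> snd e \<in> V \<and> fst e \<noteq> snd e \<and> open_segment (fst e) (snd e) \<inter> V = {}) \<and>
     disjoint_family_on (\<lambda>e. open_segment (fst e) (snd e)) E"

text \<open>Trees are generated rather than described by the absence of cycles, so that
  connectedness and exactness follow by induction on the construction. The root is \<open>0\<close>
  because the curve has to contain the origin, where every path starts.\<close>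

inductive straight_tree :: "'a::euclidean_space set \<Rightarrow> ('a \<times> 'a) set \<Rightarrow> bool" where
  root: "straight_tree {0} {}"
| split: "\<lbrakk>straight_tree V E; (a, b) \<in> E; p \<in> open_segment a b\<rbrakk>
    \<Longrightarrow> straight_tree (insert p V) (insert (a, p) (insert (p, b) (E - {(a, b)})))"
| attach: "\<lbrakk>straight_tree V E; p \<in> V; q \<noteq> p; closed_segment p q \<inter> skeleton V E = {p}\<rbrakk>
    \<Longrightarrow> straight_tree (insert q V) (insert (p, q) E)"

lemma open_segment_split:
  fixes a :: "'a::euclidean_space"
  assumes "p \<in> open_segment a b"
  shows "open_segment a b = insert p (open_segment a p \<union> open_segment p b)"
    and "open_segment a p \<inter> open_segment p b = {}"
    and "p \<notin> open_segment a p" "p \<notin> open_segment p b" "a \<noteq> p" "p \<noteq> b"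
    and "dist a p + dist p b = dist a b"
proof -
  show "open_segment a b = insert p (open_segment a p \<union> open_segment p b)"
    using Un_open_segment[OF assms] by auto
  show *: "p \<notin> open_segment a p" "p \<notin> open_segment p b"
    by (auto simp: open_segment_def)
  have p: "p \<in> closed_segment a b"
    using assms by (rule open_closed_segment)
  have "closed_segment a p \<inter> closed_segment p b = {p}"
    using Int_closed_segment[of p a b] p by auto
  then show "open_segment a p \<inter> open_segment p b = {}"
    using * by (auto simp: closed_segment_eq_open)
  show "a \<noteq> p" "p \<noteq> b"
    using assms by (auto simp: open_segment_def)
  show "dist a p + dist p b = dist a b"
    using p unfolding between_mem_segment[symmetric] between by simp
qed

lemma skeleton_split:
  assumes "(a, b) \<in> E" "p \<in> open_segment a b"
  shows "skeleton (insert p V) (insert (a, p) (insert (p, b) (E - {(a, b)}))) = skeleton V E"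
proof -
  have "(\<Union>e\<in>E. f e) = f (a, b) \<union> (\<Union>e\<in>E - {(a, b)}. f e)" for f :: "'a \<times> 'a \<Rightarrow> 'a set"
    by (metis UN_insert insert_Diff assms(1))
  from this[of "\<lambda>e. open_segment (fst e) (snd e)"]
  have "skeleton V E = V \<union> open_segment a b \<union> (\<Union>e\<in>E - {(a, b)}. open_segment (fst e) (snd e))"
    by (simp add: skeleton_def Un_assoc)
  then show ?thesis
    unfolding open_segment_split(1)[OF assms(2)] by (auto simp: skeleton_def)
qed

lemma skeleton_attach:
  assumes "p \<in> V"
  shows "skeleton (insert q V) (insert (p, q) E) = skeleton V E \<union> closed_segment p q"
  using assms by (auto simp: skeleton_def closed_segment_eq_open)

lemma straight_graphD:
  assumes "straight_graph V E"
  shows "finite V" "finite E"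
    and "e \<in> E \<Longrightarrow> fst e \<in> V" "e \<in> E \<Longrightarrow> snd e \<in> V" "e \<in> E \<Longrightarrow> fst e \<noteq> snd e"
    and "e \<in> E \<Longrightarrow> x \<in> open_segment (fst e) (snd e) \<Longrightarrow> x \<notin> V"
    and "e \<in> E \<Longrightarrow> e' \<in> E \<Longrightarrow> x \<in> open_segment (fst e) (snd e) \<Longrightarrow>
      x \<in> open_segment (fst e') (snd e') \<Longrightarrow> e = e'"
proof -
  show "finite V" "finite E" "e \<in> E \<Longrightarrow> fst e \<in> V" "e \<in> E \<Longrightarrow> snd e \<in> V" "e \<in> E \<Longrightarrow> fst e \<noteq> snd e"
    using assms by (auto simp: straight_graph_def)
  show "e \<in> E \<Longrightarrow> x \<in> open_segment (fst e) (snd e) \<Longrightarrow> x \<notin> V"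
    using assms unfolding straight_graph_def by (meson disjoint_iff)
  show "e \<in> E \<Longrightarrow> e' \<in> E \<Longrightarrow> x \<in> open_segment (fst e) (snd e) \<Longrightarrow>
      x \<in> open_segment (fst e') (snd e') \<Longrightarrow> e = e'"
    using assms unfolding straight_graph_def disjoint_family_on_def by (meson disjoint_iff)
qed

lemma straight_graphI:
  assumes "finite V" "finite E"
    and "\<And>a b. (a, b) \<in> E \<Longrightarrow> a \<in> V \<and> b \<in> V \<and> a \<noteq> b"
    and "\<And>a b x. (a, b) \<in> E \<Longrightarrow> x \<in> open_segment a b \<Longrightarrow> x \<notin> V"
    and "\<And>a b c d x. (a, b) \<in> E \<Longrightarrow> (c, d) \<in> E \<Longrightarrow> x \<in> open_segment a b \<Longrightarrow>
      x \<in> open_segment c d \<Longrightarrow> (a, b) = (c, d)"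
  shows "straight_graph V E"
  unfolding straight_graph_def disjoint_family_on_def
proof (intro conjI ballI impI)
  show "open_segment (fst e) (snd e) \<inter> V = {}" if "e \<in> E" for e
    using assms(4)[of "fst e" "snd e"] that by auto
  show "open_segment (fst e) (snd e) \<inter> open_segment (fst e') (snd e') = {}"
    if "e \<in> E" "e' \<in> E" "e \<noteq> e'" for e e'
    using assms(5)[of "fst e" "snd e" "fst e'" "snd e'"] that by (auto simp: prod_eq_iff)
  show "finite V" "finite E"
    by (fact assms)+
  show "fst e \<in> V" "snd e \<in> V" "fst e \<noteq> snd e" if "e \<in> E" for e
    using assms(3)[of "fst e" "snd e"] that by auto
qed

lemma straight_graph_split:
  assumes G: "straight_graph V E" and ab: "(a, b) \<in> E" and p: "p \<in> open_segment a b"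
  shows "straight_graph (insert p V) (insert (a, p) (insert (p, b) (E - {(a, b)})))"
proof (rule straight_graphI)
  note D = straight_graphD[OF G]
  note S = open_segment_split[OF p]
  have old: "x \<in> open_segment a b \<Longrightarrow> (c, d) \<in> E - {(a, b)} \<Longrightarrow> x \<notin> open_segment c d" for c d x
    using D(7)[OF ab, of "(c, d)" x] by auto
  show "finite (insert p V)" "finite (insert (a, p) (insert (p, b) (E - {(a, b)})))"
    using D(1,2) by auto
  show "c \<in> insert p V \<and> d \<in> insert p V \<and> c \<noteq> d"
    if "(c, d) \<in> insert (a, p) (insert (p, b) (E - {(a, b)}))" for c d
    using that D(3,4,5)[OF ab] D(3,4,5)[of "(c, d)"] S(5,6) by auto
  show "x \<notin> insert p V"
    if cd: "(c, d) \<in> insert (a, p) (insert (p, b) (E - {(a, b)}))" and x: "x \<in> open_segment c d" for c d x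
  proof (cases "(c, d) \<in> E - {(a, b)}")
    case True
    then show ?thesis
      using x D(6)[of "(c, d)" x] old[OF p True] by auto
  next
    case False
    then have "x \<in> open_segment a b" "x \<noteq> p"
      using cd x S by auto
    then show ?thesis
      using D(6)[OF ab, of x] by auto
  qed
  show "(c, d) = (c', d')"
    if "(c, d) \<in> insert (a, p) (insert (p, b) (E - {(a, b)}))"
      "(c', d') \<in> insert (a, p) (insert (p, b) (E - {(a, b)}))"
      "x \<in> open_segment c d" "x \<in> open_segment c' d'" for c d c' d' x
  proof (cases "(c, d) \<in> E - {(a, b)}"; cases "(c', d') \<in> E - {(a, b)}")
    assume "(c, d) \<in> E - {(a, b)}" "(c', d') \<in> E - {(a, b)}"
    then show ?thesis
      using D(7)[of "(c, d)" "(c', d')" x] that by auto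
  next
    assume 1: "(c, d) \<in> E - {(a, b)}" "(c', d') \<notin> E - {(a, b)}"
    then have "x \<in> open_segment a b"
      using that S(1) by auto
    from old[OF this 1(1)] show ?thesis
      using that by simp
  next
    assume 1: "(c, d) \<notin> E - {(a, b)}" "(c', d') \<in> E - {(a, b)}"
    then have "x \<in> open_segment a b"
      using that S(1) by auto
    from old[OF this 1(2)] show ?thesis
      using that by simp
  next
    assume "(c, d) \<notin> E - {(a, b)}" "(c', d') \<notin> E - {(a, b)}"
    then show ?thesis
      using that S(2) by auto
  qed
qed

lemma straight_graph_attach:
  assumes G: "straight_graph V E" and p: "p \<in> V" "q \<noteq> p"
    and pq: "closed_segment p q \<inter> skeleton V E = {p}"
  shows "straight_graph (insert q V) (insert (p, q) E)"
proof (rule straight_graphI)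
  note D = straight_graphD[OF G]
  have new: "x \<notin> skeleton V E" if "x \<in> open_segment p q" for x
    using that pq by (auto simp: open_segment_def)
  have q: "q \<notin> skeleton V E"
    using pq p by auto
  have qseg: "q \<notin> open_segment c d" if "(c, d) \<in> E" for c d
    using q that by (auto simp: skeleton_def)
  show "finite (insert q V)" "finite (insert (p, q) E)"
    using D(1,2) by auto
  show "c \<in> insert q V \<and> d \<in> insert q V \<and> c \<noteq> d" if "(c, d) \<in> insert (p, q) E" for c d
    using that D(3,4,5)[of "(c, d)"] p by auto
  show "x \<notin> insert q V" if "(c, d) \<in> insert (p, q) E" "x \<in> open_segment c d" for c d x
    using that D(6)[of "(c, d)" x] new[of x] qseg[of c d] by (auto simp: skeleton_def open_segment_def)
  show "(c, d) = (c', d')"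
    if "(c, d) \<in> insert (p, q) E" "(c', d') \<in> insert (p, q) E"
      "x \<in> open_segment c d" "x \<in> open_segment c' d'" for c d c' d' x
  proof -
    have "x \<in> skeleton V E" if "(c, d) \<in> E \<or> (c', d') \<in> E"
      using that \<open>x \<in> open_segment c d\<close> \<open>x \<in> open_segment c' d'\<close> by (force simp: skeleton_def)
    then show ?thesis
      using that new[of x] D(7)[of "(c, d)" "(c', d')" x] by auto
  qed
qed

lemma straight_tree_graph: "straight_tree V E \<Longrightarrow> straight_graph V E"
proof (induction rule: straight_tree.induct)
  case root
  show ?case
    by (auto simp: straight_graph_def disjoint_family_on_def)
qed (auto intro: straight_graph_split straight_graph_attach)

lemma straight_tree_root: "straight_tree V E \<Longrightarrow> 0 \<in> V"
  by (induction rule: straight_tree.induct) auto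

lemma straight_tree_connected: "straight_tree V E \<Longrightarrow> connected (skeleton V E)"
proof (induction rule: straight_tree.induct)
  case root
  show ?case
    by (simp add: skeleton_def)
next
  case (split V E a b p)
  then show ?case
    by (simp only: skeleton_split)
next
  case (attach V E p q)
  have "p \<in> skeleton V E \<inter> closed_segment p q"
    using attach by (auto simp: skeleton_def)
  then show ?case
    unfolding skeleton_attach[OF attach.hyps(2)] using attach.IH by (intro connected_Un) auto
qed

lemma skeleton_closed_segments:
  assumes "straight_graph V E"
  shows "skeleton V E = V \<union> (\<Union>e\<in>E. closed_segment (fst e) (snd e))"
  using straight_graphD(3,4)[OF assms] by (auto simp: skeleton_def closed_segment_eq_open)

lemma compact_skeleton:
  assumes "straight_graph V E"
  shows "compact (skeleton V E)"
  unfolding skeleton_closed_segments[OF assms] using straight_graphD(1,2)[OF assms]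
  by (intro compact_Un compact_UN finite_imp_compact compact_segment)

lemma total_length_split:
  assumes G: "straight_graph V E" and ab: "(a, b) \<in> E" and p: "p \<in> open_segment a b"
  shows "total_length (insert (a, p) (insert (p, b) (E - {(a, b)}))) = total_length E"
proof -
  note D = straight_graphD[OF G]
  note S = open_segment_split[OF p]
  have pV: "p \<notin> V"
    using D(6)[OF ab] p by auto
  have "(a, p) \<notin> insert (p, b) (E - {(a, b)})" "(p, b) \<notin> E - {(a, b)}"
    using pV S(5,6) D(3)[of "(p, b)"] D(4)[of "(a, p)"] by auto
  then show ?thesis
    using D(2) ab S(7) sum.remove[OF D(2) ab, of "\<lambda>e. dist (fst e) (snd e)"]
    by (simp add: total_length_def)
qed

lemma total_length_attach:
  assumes G: "straight_graph V E" and "q \<notin> V"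
  shows "total_length (insert (p, q) E) = total_length E + dist p q"
proof -
  have "(p, q) \<notin> E"
    using straight_graphD(4)[OF G, of "(p, q)"] assms by auto
  then show ?thesis
    using straight_graphD(2)[OF G] by (simp add: total_length_def)
qed

section \<open>Growing a tree along prescribed links\<close>

text \<open>Segments are attached only at vertices, so an inner point of an edge is first promoted
  to a vertex by \<open>split\<close>.\<close>

lemma straight_tree_vertex:
  assumes "straight_tree V E" "p \<in> skeleton V E"
  obtains V' E' where "straight_tree V' E'" "p \<in> V'" "skeleton V' E' = skeleton V E"
    "total_length E' = total_length E"
proof (cases "p \<in> V")
  case True
  then show ?thesis
    using that[of V E] assms by auto
next
  case False
  then obtain a b where ab: "(a, b) \<in> E" "p \<in> open_segment a b"
    using assms by (force simp: skeleton_def)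
  show ?thesis
    using that[OF straight_tree.split[OF assms(1) ab]] skeleton_split[OF ab]
      total_length_split[OF straight_tree_graph[OF assms(1)] ab] by auto
qed

lemma straight_tree_reach:
  assumes T: "straight_tree V E" and p: "p \<in> skeleton V E"
  obtains V' E' where "straight_tree V' E'" "q \<in> skeleton V' E'" "skeleton V E \<subseteq> skeleton V' E'"
    "skeleton V' E' \<subseteq> skeleton V E \<union> closed_segment p q"
    "total_length E' \<le> total_length E + dist p q"
proof (cases "q \<in> skeleton V E")
  case True
  then show ?thesis
    using that[OF T] by auto
next
  case False
  let ?I = "closed_segment p q \<inter> skeleton V E"
  have "compact ?I" "?I \<noteq> {}"
    using p compact_skeleton[OF straight_tree_graph[OF T]] by (auto intro: compact_Int)
  \<comment> \<open>The cut is made at the point nearest to the far end \<open>q\<close>. The piece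
    from \<open>r\<close> to \<open>q\<close> then meets the old skeleton only in \<open>r\<close>,
    whereas the segment starting at \<open>p\<close> may cross it many times.\<close>
  then obtain r where r: "r \<in> ?I" and near: "\<And>x. x \<in> ?I \<Longrightarrow> dist q r \<le> dist q x"
    using distance_attains_inf[of ?I q] compact_imp_closed by metis
  have "q \<noteq> r"
    using False r by auto
  obtain V' E' where 1: "straight_tree V' E'" "r \<in> V'" "skeleton V' E' = skeleton V E"
    "total_length E' = total_length E"
    using straight_tree_vertex[OF T, of r] r by blast
  have sub: "closed_segment r q \<subseteq> closed_segment p q"
    using r by (auto simp: subset_closed_segment)
  have "x = r" if "x \<in> closed_segment r q" "x \<in> skeleton V E" for x
  proof -
    have "dist q r \<le> dist q x"
      using that sub by (intro near) auto
    moreover have "dist r x + dist x q = dist r q"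
      using that(1) unfolding between_mem_segment[symmetric] between by simp
    ultimately have "dist r x \<le> 0"
      using dist_commute[of x q] dist_commute[of r q] by linarith
    then show ?thesis
      by simp
  qed
  then have 2: "closed_segment r q \<inter> skeleton V' E' = {r}"
    using 1 r by auto
  have "q \<notin> V'"
    using False 1(3) by (auto simp: skeleton_def)
  have len: "dist r q \<le> dist p q"
    using dist_in_closed_segment[of r p q] r by auto
  show ?thesis
  proof (rule that[OF straight_tree.attach[OF 1(1,2) \<open>q \<noteq> r\<close> 2]])
    show "total_length (insert (r, q) E') \<le> total_length E + dist p q"
      using len total_length_attach[OF straight_tree_graph[OF 1(1)] \<open>q \<notin> V'\<close>] 1(4) by simp
  qed (use sub 1(3) in \<open>auto simp: skeleton_attach[OF 1(2)]\<close>)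
qed

text \<open>Links are processed greedily as long as one of them has exactly one endpoint on the tree.\<close>

lemma straight_tree_grow:
  assumes "finite F" "straight_tree V E"
  obtains V' E' where "straight_tree V' E'" "skeleton V E \<subseteq> skeleton V' E'"
    "skeleton V' E' \<subseteq> skeleton V E \<union> (\<Union>(a, b)\<in>F. closed_segment a b)"
    "total_length E' \<le> total_length E + (\<Sum>(a, b)\<in>F. dist a b)"
    "\<And>a b. (a, b) \<in> F \<Longrightarrow> a \<in> skeleton V' E' \<longleftrightarrow> b \<in> skeleton V' E'"
proof -
  have "\<exists>V' E'. straight_tree V' E' \<and> skeleton V E \<subseteq> skeleton V' E' \<and>
    skeleton V' E' \<subseteq> skeleton V E \<union> (\<Union>(a, b)\<in>F. closed_segment a b) \<and>
    total_length E' \<le> total_length E + (\<Sum>(a, b)\<in>F. dist a b) \<and>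
    (\<forall>(a, b)\<in>F. a \<in> skeleton V' E' \<longleftrightarrow> b \<in> skeleton V' E')"
    using assms
  proof (induction F arbitrary: V E rule: finite_psubset_induct)
    case (psubset F)
    show ?case
    proof (cases "\<forall>(a, b)\<in>F. a \<in> skeleton V E \<longleftrightarrow> b \<in> skeleton V E")
      case True
      have "0 \<le> (\<Sum>(a, b)\<in>F. dist a b)"
        by (auto intro: sum_nonneg)
      then show ?thesis
        using True psubset.prems by (intro exI[of _ V] exI[of _ E]) auto
    next
      case False
      then obtain a b where ab: "(a, b) \<in> F" "(a \<in> skeleton V E) \<noteq> (b \<in> skeleton V E)"
        by auto
      obtain V1 E1 where 1: "straight_tree V1 E1" "a \<in> skeleton V1 E1" "b \<in> skeleton V1 E1"
        "skeleton V E \<subseteq> skeleton V1 E1" "skeleton V1 E1 \<subseteq> skeleton V E \<union> closed_segment a b"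
        "total_length E1 \<le> total_length E + dist a b"
      proof (cases "a \<in> skeleton V E")
        case True
        from psubset.prems this show ?thesis
          by (rule straight_tree_reach[of _ _ _ b]) (rule that, use True in auto)
      next
        case False
        then have "b \<in> skeleton V E"
          using ab by blast
        with psubset.prems show ?thesis
          by (rule straight_tree_reach[of _ _ _ a])
            (rule that, use \<open>b \<in> skeleton V E\<close> in \<open>auto simp: closed_segment_commute[of b a] dist_commute[of b a]\<close>)
      qed
      \<comment> \<open>Both ends of this link now lie on the tree and stay there as it grows, so
        the link may be dropped from \<open>F\<close>.\<close>
      have F': "F - {(a, b)} \<subset> F"
        using ab(1) by blast
      obtain V' E' where 2: "straight_tree V' E'" "skeleton V1 E1 \<subseteq> skeleton V' E'"
        "skeleton V' E' \<subseteq> skeleton V1 E1 \<union> (\<Union>(a, b)\<in>F - {(a, b)}. closed_segment a b)"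
        "total_length E' \<le> total_length E1 + (\<Sum>(a, b)\<in>F - {(a, b)}. dist a b)"
        "\<forall>(a, b)\<in>F - {(a, b)}. a \<in> skeleton V' E' \<longleftrightarrow> b \<in> skeleton V' E'"
        using psubset.IH[OF F' 1(1)] by (elim exE conjE) (rule that)
      have "(\<Sum>(a, b)\<in>F. dist a b) = dist a b + (\<Sum>(a, b)\<in>F - {(a, b)}. dist a b)"
        using sum.remove[OF psubset.hyps(1) ab(1), of "\<lambda>(a, b). dist a b"] by simp
      then have len: "total_length E' \<le> total_length E + (\<Sum>(a, b)\<in>F. dist a b)"
        using 1(6) 2(4) by linarith
      have "closed_segment a b \<subseteq> (\<Union>(a, b)\<in>F. closed_segment a b)"
        using ab(1) by blast
      then have sub: "skeleton V' E' \<subseteq> skeleton V E \<union> (\<Union>(a, b)\<in>F. closed_segment a b)"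
        using 1(5) 2(3) by blast
      have iff: "\<forall>(a, b)\<in>F. a \<in> skeleton V' E' \<longleftrightarrow> b \<in> skeleton V' E'"
        using 2(2,5) 1(2,3) by (auto simp: subset_eq)
      show ?thesis
        using 2(1) len sub iff 1(4) 2(2) by (intro exI[of _ V'] exI[of _ E']) auto
    qed
  qed
  then show ?thesis
    using that by (auto split: prod.splits)
qed

section \<open>Local structure of a skeleton: orders and smoothness\<close>

definition incident :: "('a \<times> 'a) set \<Rightarrow> 'a \<Rightarrow> ('a \<times> 'a) set" where
  "incident E v = {e \<in> E. v = fst e \<or> v = snd e}"

text \<open>Finitely many closed rays from \<open>x\<close> meet only in \<open>x\<close>, which is
  missing here. Each punctured ray is therefore relatively closed in the union, and a connected
  subset cannot meet two of them.\<close>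

lemma components_rays:
  fixes x :: "'a::real_normed_vector"
  assumes U: "finite U" "\<And>u. u \<in> U \<Longrightarrow> norm u = 1" and r: "r > 0"
  defines "R \<equiv> \<lambda>u. (\<lambda>s. x + s *\<^sub>R u) ` {0<..<r}"
  shows "components (\<Union>u\<in>U. R u) = R ` U" "inj_on R U"
proof -
  \<comment> \<open>For a unit vector \<open>u\<close> this is the closed ray from \<open>x\<close>
    in direction \<open>u\<close>; written as an equation it is visibly closed.\<close>
  define C where "C u = {y. y - x = norm (y - x) *\<^sub>R u}" for u
  have closed: "closed (C u)" for u
    unfolding C_def by (intro closed_Collect_eq continuous_intros)
  have conn: "connected (R u)" for u
    unfolding R_def by (intro connected_continuous_image continuous_intros) auto
  have ne: "R u \<noteq> {}" for u
    using r by (auto simp: R_def)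
  have RC: "u = u'" if "y \<in> R u" "y \<in> C u'" "u \<in> U" for y u u'
    using that U(2)[of u] by (auto simp: R_def C_def)
  have RsC: "R u \<subseteq> C u" if "u \<in> U" for u
    using U(2)[OF that] by (auto simp: R_def C_def)
  show "inj_on R U"
    using ne RC RsC unfolding inj_on_def by (metis all_not_in_conv subsetD)
  have comp: "c = R u" if c: "c \<in> components (\<Union>u\<in>U. R u)" and y: "y \<in> c" "y \<in> R u" "u \<in> U" for c y u
  proof
    show "R u \<subseteq> c"
      using c conn y by (intro components_maximal[OF c conn]) auto
    have cX: "c \<subseteq> (\<Union>u\<in>U. R u)"
      using c by (rule in_components_subset)
    let ?D = "\<Union>u'\<in>U - {u}. C u'"
    have "closed ?D"
      using U(1) closed by (intro closed_UN) auto
    have "c \<subseteq> C u \<union> ?D"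
      using cX RsC by blast
    moreover have "C u \<inter> ?D \<inter> c = {}"
    proof -
      have False if z: "z \<in> C u" "z \<in> C u'" "u' \<noteq> u" "z \<in> c" for z u'
      proof -
        obtain w where "w \<in> U" "z \<in> R w"
          using cX z(4) by blast
        then show False
          using RC[of z w u] RC[of z w u'] z by simp
      qed
      then show ?thesis
        by blast
    qed
    ultimately have "C u \<inter> c = {} \<or> ?D \<inter> c = {}"
      using connected_closedD[OF in_components_connected[OF c] _ _ closed \<open>closed ?D\<close>] by simp
    moreover have "y \<in> C u \<inter> c"
      using y RsC[OF y(3)] by blast
    ultimately have "?D \<inter> c = {}"
      by (metis empty_iff)
    then show "c \<subseteq> R u"
      using cX RsC by blast
  qed
  show "components (\<Union>u\<in>U. R u) = R ` U"
  proof
    show "components (\<Union>u\<in>U. R u) \<subseteq> R ` U"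
    proof
      fix c assume c: "c \<in> components (\<Union>u\<in>U. R u)"
      then obtain y where "y \<in> c"
        using in_components_nonempty by blast
      moreover obtain u where "u \<in> U" "y \<in> R u"
        using in_components_subset[OF c] \<open>y \<in> c\<close> by blast
      ultimately show "c \<in> R ` U"
        using comp[OF c] by blast
    qed
    show "R ` U \<subseteq> components (\<Union>u\<in>U. R u)"
    proof clarify
      fix u assume u: "u \<in> U"
      then obtain y where y: "y \<in> R u"
        using ne by blast
      then have "y \<in> (\<Union>u\<in>U. R u)"
        using u by blast
      then obtain c where "c \<in> components (\<Union>u\<in>U. R u)" "y \<in> c"
        using Union_components by (metis UnionE)
      then show "R u \<in> components (\<Union>u\<in>U. R u)"
        using comp y u by metis
    qed
  qed
qed

text \<open>A cone looks alike at every smaller radius, so the number of components is the number of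
  directions for all of them.\<close>

lemma has_order_cone:
  fixes x :: "real^2"
  assumes r: "r > 0" and U: "finite U" "\<And>u. u \<in> U \<Longrightarrow> norm u = 1"
    and P: "P \<inter> ball x r = insert x (\<Union>u\<in>U. (\<lambda>s. x + s *\<^sub>R u) ` {0<..<r})"
  shows "has_order P x (card U)"
  unfolding has_order_def
proof (intro conjI exI[of _ r] allI impI)
  show "x \<in> P" "r > 0"
    using P r by auto
  fix q assume q: "0 < q \<and> q < r"
  let ?R = "\<lambda>u. (\<lambda>s. x + s *\<^sub>R u) ` {0<..<q}"
  have "P \<inter> (ball x q - {x}) = (P \<inter> ball x r) \<inter> (ball x q - {x})"
    using q by auto
  also have "\<dots> = (\<Union>u\<in>U. ?R u)"
    unfolding P using q U(2) by (auto simp: dist_norm image_iff) fastforce+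
  finally have eq: "P \<inter> (ball x q - {x}) = (\<Union>u\<in>U. ?R u)" .
  show "finite (components (P \<inter> (ball x q - {x})))" "card (components (P \<inter> (ball x q - {x}))) = card U"
    unfolding eq using components_rays[OF U, of q x] q U(1) by (auto simp: card_image)
qed

lemma has_order_unique:
  assumes "has_order P x k" "has_order P x l"
  shows "k = l"
proof -
  obtain r s where "r > 0" "s > 0"
    and "\<And>q. 0 < q \<Longrightarrow> q < r \<Longrightarrow> card (components (P \<inter> (ball x q - {x}))) = k"
    and "\<And>q. 0 < q \<Longrightarrow> q < s \<Longrightarrow> card (components (P \<inter> (ball x q - {x}))) = l"
    using assms unfolding has_order_def by metis
  from this(3)[of "min r s / 2"] this(4)[of "min r s / 2"] this(1,2) show ?thesis
    by auto
qed

lemma open_segment_affine_image: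
  fixes a b :: "'a::real_normed_vector"
  assumes "a \<noteq> b"
  shows "open_segment a b = (\<lambda>t. a + t *\<^sub>R (b - a)) ` {0<..<1}"
  using assms by (simp add: open_segment_image_interval algebra_simps)

lemma open_segment_ray:
  fixes v w :: "'a::real_inner"
  assumes "v \<noteq> w"
  shows "open_segment v w = (\<lambda>s. v + s *\<^sub>R sgn (w - v)) ` {0<..<dist v w}"
proof -
  have d: "dist v w > 0" "norm (w - v) = dist v w"
    using assms by (auto simp: dist_norm norm_minus_commute)
  have "open_segment v w = (\<lambda>t. v + t *\<^sub>R (w - v)) ` {0<..<1}"
    using assms by (rule open_segment_affine_image)
  also have "{0<..<1::real} = (\<lambda>s. s / dist v w) ` {0<..<dist v w}"
  proof -
    have "t \<in> (\<lambda>s. s / dist v w) ` {0<..<dist v w}" if "0 < t" "t < 1" for t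
      using d that by (intro image_eqI[of _ _ "t * dist v w"]) auto
    then show ?thesis
      using d by auto
  qed
  also have "(\<lambda>t. v + t *\<^sub>R (w - v)) ` (\<lambda>s. s / dist v w) ` {0<..<dist v w}
      = (\<lambda>s. v + s *\<^sub>R sgn (w - v)) ` {0<..<dist v w}"
    using d by (simp add: image_image sgn_div_norm divide_inverse)
  finally show ?thesis .
qed

lemma closed_away_ball:
  assumes "closed C" "x \<notin> C"
  obtains r where "r > 0" "ball x r \<inter> C = {}"
proof -
  obtain r where "r > 0" "ball x r \<subseteq> - C"
    using assms open_Compl[OF assms(1)] unfolding open_contains_ball by auto
  then show ?thesis
    using that by blast
qed

text \<open>In a ball around \<open>v\<close> that avoids everything not reaching \<open>v\<close>,
  only the initial pieces of the incident edges remain, one radius for each.\<close>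

lemma vertex_cone:
  assumes G: "straight_graph V E" and v: "v \<in> V"
  obtains r U where "r > 0" "finite U" "\<And>u. u \<in> U \<Longrightarrow> norm u = 1" "card U = card (incident E v)"
    "skeleton V E \<inter> ball v r = insert v (\<Union>u\<in>U. (\<lambda>s. v + s *\<^sub>R u) ` {0<..<r})"
proof -
  note D = straight_graphD[OF G]
  define w where "w e = (if fst e = v then snd e else fst e)" for e
  define dir where "dir e = sgn (w e - v)" for e
  \<comment> \<open>\<open>C\<close> contains the far ends of the incident edges as well; hence a
    radius avoiding it is at most the length of each of these edges.\<close>
  define C where "C = (V - {v}) \<union> (\<Union>e\<in>E - incident E v. closed_segment (fst e) (snd e))"
  have "closed C"
    unfolding C_def using D(1,2) by (intro closed_Un closed_UN) (auto intro: finite_imp_closed)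
  moreover have "v \<notin> C"
    using D(6)[of _ v] v by (auto simp: C_def incident_def closed_segment_eq_open)
  ultimately obtain r where r: "r > 0" "ball v r \<inter> C = {}"
    by (rule closed_away_ball)
  have w: "w e \<in> V" "w e \<noteq> v" "open_segment (fst e) (snd e) = open_segment v (w e)" if "e \<in> incident E v" for e
    using that D(3,4,5)[of e] by (auto simp: w_def incident_def open_segment_commute)
  have norm: "norm (dir e) = 1" if "e \<in> incident E v" for e
    using w(2)[OF that] by (simp add: dir_def norm_sgn)
  have rw: "r \<le> dist v (w e)" if "e \<in> incident E v" for e
  proof -
    have "w e \<in> C"
      using w[OF that] by (auto simp: C_def)
    then show ?thesis
      using r(2) by (meson disjoint_iff mem_ball not_less)
  qed
  have seg: "open_segment v (w e) \<inter> ball v r = (\<lambda>s. v + s *\<^sub>R dir e) ` {0<..<r}" if "e \<in> incident E v" for e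
    unfolding open_segment_ray[OF w(2)[OF that, symmetric]] dir_def[symmetric]
    using rw[OF that] norm[OF that] by (auto simp: dist_norm)
  have skel: "skeleton V E = insert v (\<Union>e\<in>incident E v. open_segment v (w e)) \<union> C"
  proof -
    have "skeleton V E = V \<union> (\<Union>e\<in>incident E v. open_segment (fst e) (snd e)) \<union>
        (\<Union>e\<in>E - incident E v. closed_segment (fst e) (snd e))"
      using D(3,4) by (auto simp: skeleton_def closed_segment_eq_open incident_def)
    also have "(\<Union>e\<in>incident E v. open_segment (fst e) (snd e)) = (\<Union>e\<in>incident E v. open_segment v (w e))"
      using w(3) by (intro SUP_cong) auto
    finally show ?thesis
      using v by (auto simp: C_def)
  qed
  \<comment> \<open>Two edges leaving \<open>v\<close> in the same direction would share the point
    at distance \<open>r/2\<close>, but open edges are disjoint.\<close>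
  have inj: "inj_on dir (incident E v)"
  proof
    fix e e' assume e: "e \<in> incident E v" "e' \<in> incident E v" "dir e = dir e'"
    have "v + (r/2) *\<^sub>R dir d \<in> open_segment (fst d) (snd d)" if d: "d \<in> incident E v" for d
    proof -
      have "v + (r/2) *\<^sub>R dir d \<in> (\<lambda>s. v + s *\<^sub>R dir d) ` {0<..<r}"
        using r(1) by auto
      then show ?thesis
        unfolding w(3)[OF d] seg[OF d, symmetric] by blast
    qed
    from this[OF e(1)] this[OF e(2)]
    show "e = e'"
      using D(7)[of e e'] e by (auto simp: incident_def)
  qed
  show ?thesis
  proof (rule that[of r "dir ` incident E v"])
    show "finite (dir ` incident E v)"
      using D(2) by (auto simp: incident_def)
    show "card (dir ` incident E v) = card (incident E v)"
      using inj by (rule card_image)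
    have "skeleton V E \<inter> ball v r = insert v (\<Union>e\<in>incident E v. open_segment v (w e) \<inter> ball v r)"
      unfolding skel using r by auto
    also have "\<dots> = insert v (\<Union>e\<in>incident E v. (\<lambda>s. v + s *\<^sub>R dir e) ` {0<..<r})"
      using seg by simp
    finally show "skeleton V E \<inter> ball v r = insert v (\<Union>u\<in>dir ` incident E v. (\<lambda>s. v + s *\<^sub>R u) ` {0<..<r})"
      by simp
  qed (use r norm in auto)
qed

text \<open>The ball is chosen to avoid all vertices, the ends of the edge included, and all other
  edges; what remains of the skeleton is a diameter of the ball.\<close>

lemma edge_line:
  assumes G: "straight_graph V E" and ab: "(a, b) \<in> E" and x: "x \<in> open_segment a b"
  obtains r u where "r > 0" "norm u = 1" "skeleton V E \<inter> ball x r = (\<lambda>s. x + s *\<^sub>R u) ` {-r<..<r}"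
    "ball x r \<inter> V = {}"
proof -
  note D = straight_graphD[OF G]
  define C where "C = V \<union> (\<Union>e\<in>E - {(a, b)}. closed_segment (fst e) (snd e))"
  have "closed C"
    unfolding C_def using D(1,2) by (intro closed_Un closed_UN) (auto intro: finite_imp_closed)
  moreover have "x \<notin> C"
  proof
    assume "x \<in> C"
    moreover have "x \<notin> V"
      using D(6)[OF ab] x by auto
    ultimately obtain e where "e \<in> E" "e \<noteq> (a, b)" "x \<in> open_segment (fst e) (snd e)"
      using D(3,4) by (auto simp: C_def closed_segment_eq_open)
    then show False
      using D(7)[OF ab, of e x] x by auto
  qed
  ultimately obtain r where r: "r > 0" "ball x r \<inter> C = {}"
    by (rule closed_away_ball)
  have ne: "a \<noteq> b"
    using D(5)[OF ab] by simp
  define u where "u = sgn (b - a)"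
  have u: "norm u = 1"
    using ne by (simp add: u_def norm_sgn)
  obtain t where t: "0 < t" "t < dist a b" "x = a + t *\<^sub>R u"
    using x unfolding open_segment_ray[OF ne] u_def by auto
  have b: "b = a + dist a b *\<^sub>R u"
    using ne by (simp add: u_def sgn_div_norm dist_norm norm_minus_commute)
  have "a \<in> C" "b \<in> C"
    using D(3,4)[OF ab] by (auto simp: C_def)
  then have "r \<le> dist x a" "r \<le> dist x b"
    using r(2) by (meson disjoint_iff mem_ball not_less)+
  moreover have "dist x a = t"
    using t u by (simp add: dist_norm)
  moreover have "dist x b = dist a b - t"
  proof -
    have "x - b = (t - dist a b) *\<^sub>R u"
      using t(3) b by (metis add_diff_cancel_left scaleR_left_diff_distrib)
    then show ?thesis
      using t u by (simp add: dist_norm)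
  qed
  ultimately have rt: "r \<le> t" "r \<le> dist a b - t"
    by auto
  have "(\<Union>e\<in>E. f e) = f (a, b) \<union> (\<Union>e\<in>E - {(a, b)}. f e)" for f :: "'a \<times> 'a \<Rightarrow> 'a set"
    by (metis UN_insert insert_Diff ab)
  then have "skeleton V E = V \<union> closed_segment a b \<union> C"
    unfolding skeleton_closed_segments[OF G] C_def by (simp add: Un_ac)
  then have "skeleton V E = open_segment a b \<union> C"
    using D(3,4)[OF ab] by (auto simp: C_def closed_segment_eq_open)
  then have "skeleton V E \<inter> ball x r = open_segment a b \<inter> ball x r"
    using r(2) by auto
  also have "\<dots> = (\<lambda>s. x + s *\<^sub>R u) ` {-r<..<r}"
  proof
    show "open_segment a b \<inter> ball x r \<subseteq> (\<lambda>s. x + s *\<^sub>R u) ` {-r<..<r}"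
    proof
      fix y assume y: "y \<in> open_segment a b \<inter> ball x r"
      then obtain s where s: "y = a + s *\<^sub>R u"
        unfolding open_segment_ray[OF ne] u_def by auto
      then have "y = x + (s - t) *\<^sub>R u"
        using t(3) by (simp add: algebra_simps)
      moreover have "\<bar>s - t\<bar> < r"
        using y u unfolding \<open>y = x + (s - t) *\<^sub>R u\<close> by (simp add: dist_norm)
      ultimately show "y \<in> (\<lambda>s. x + s *\<^sub>R u) ` {-r<..<r}"
        by (auto simp: abs_less_iff)
    qed
    show "(\<lambda>s. x + s *\<^sub>R u) ` {-r<..<r} \<subseteq> open_segment a b \<inter> ball x r"
    proof clarify
      fix s assume s: "s \<in> {-r<..<r}"
      have "x + s *\<^sub>R u = a + (t + s) *\<^sub>R u"
        using t(3) by (simp add: algebra_simps)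
      moreover have "t + s \<in> {0<..<dist a b}"
        using s rt by auto
      ultimately have "x + s *\<^sub>R u \<in> open_segment a b"
        unfolding open_segment_ray[OF ne] u_def by blast
      then show "x + s *\<^sub>R u \<in> open_segment a b \<inter> ball x r"
        using s u by (auto simp: dist_norm abs_less_iff)
    qed
  qed
  finally have "skeleton V E \<inter> ball x r = (\<lambda>s. x + s *\<^sub>R u) ` {-r<..<r}" .
  moreover have "ball x r \<inter> V = {}"
    using r by (auto simp: C_def)
  ultimately show ?thesis
    using that r u by blast
qed

text \<open>At a vertex the order is the degree; an inner point of an edge has order 2, since
  exactly two opposite directions leave it. Degree two is thus the only degree at which a vertex
  would escape the singular set.\<close>

lemma singular_points_skeleton:
  fixes V :: "(real^2) set"
  assumes G: "straight_graph V E" and deg: "\<And>v. v \<in> V \<Longrightarrow> card (incident E v) \<noteq> 2"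
  shows "singular_points (skeleton V E) = V"
proof
  show "V \<subseteq> singular_points (skeleton V E)"
  proof
    fix v assume v: "v \<in> V"
    obtain r U where U: "r > 0" "finite U" "\<And>u. u \<in> U \<Longrightarrow> norm u = 1" "card U = card (incident E v)"
      "skeleton V E \<inter> ball v r = insert v (\<Union>u\<in>U. (\<lambda>s. v + s *\<^sub>R u) ` {0<..<r})"
      by (rule vertex_cone[OF G v], rule that) auto
    have "has_order (skeleton V E) v (card U)"
      by (rule has_order_cone[OF U(1,2,3,5)])
    then show "v \<in> singular_points (skeleton V E)"
      using deg[OF v] U(4) by (auto simp: singular_points_def)
  qed
  show "singular_points (skeleton V E) \<subseteq> V"
  proof (rule ccontr)
    assume "\<not> singular_points (skeleton V E) \<subseteq> V"
    then obtain x k where x: "has_order (skeleton V E) x k" "k \<noteq> 2" "x \<notin> V"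
      by (auto simp: singular_points_def)
    then obtain a b where ab: "(a, b) \<in> E" "x \<in> open_segment a b"
      by (force simp: has_order_def skeleton_def)
    obtain r u where r: "r > 0" "norm u = 1" "skeleton V E \<inter> ball x r = (\<lambda>s. x + s *\<^sub>R u) ` {-r<..<r}"
      by (rule edge_line[OF G ab])
    have "u \<noteq> - u"
    proof
      assume "u = - u"
      then have "u = 0"
        by (simp add: vec_eq_iff)
      then show False
        using r(2) by simp
    qed
    have "(\<lambda>s. x + s *\<^sub>R u) ` {-r<..<r} = insert x (\<Union>u\<in>{u, -u}. (\<lambda>s. x + s *\<^sub>R u) ` {0<..<r})"
    proof -
      have "{-r<..<r} = insert 0 ({0<..<r} \<union> uminus ` {0<..<r})"
        using r(1) by auto
      then have "(\<lambda>s. x + s *\<^sub>R u) ` {-r<..<r}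
          = (\<lambda>s. x + s *\<^sub>R u) ` insert 0 ({0<..<r} \<union> uminus ` {0<..<r})"
        by (rule arg_cong)
      also have "\<dots> = insert x ((\<lambda>s. x + s *\<^sub>R u) ` {0<..<r} \<union> (\<lambda>s. x + s *\<^sub>R u) ` uminus ` {0<..<r})"
        unfolding image_insert image_Un by simp
      also have "(\<lambda>s. x + s *\<^sub>R u) ` uminus ` {0<..<r} = (\<lambda>s. x + s *\<^sub>R (-u)) ` {0<..<r}"
        unfolding image_image by simp
      finally show ?thesis
        by simp
    qed
    then have "has_order (skeleton V E) x (card {u, -u})"
      using r by (intro has_order_cone[of r]) auto
    then show False
      using has_order_unique[OF x(1)] x(2) \<open>u \<noteq> - u\<close> by simp
  qed
qed

text \<open>Off the vertices the skeleton is locally a straight line, so affine charts work,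
  inverted by orthogonal projection to the direction \<open>u\<close>. Relative closedness comes
  from compactness of the skeleton.\<close>

lemma smooth_submanifold_skeleton:
  fixes V :: "(real^2) set"
  assumes G: "straight_graph V E"
  shows "closed_smooth_1submanifold_of (UNIV - V) (skeleton V E - V)"
  unfolding closed_smooth_1submanifold_of_def
proof (intro conjI)
  have "closed V"
    using straight_graphD(1)[OF G] by (rule finite_imp_closed)
  then show "open (UNIV - V)"
    unfolding Compl_eq_Diff_UNIV[symmetric] by (rule open_Compl)
  show "closedin (top_of_set (UNIV - V)) (skeleton V E - V)"
    using compact_imp_closed[OF compact_skeleton[OF G]] by (auto simp: closedin_closed)
  show "smooth_1submanifold (skeleton V E - V)"
    unfolding smooth_1submanifold_def
  proof
    fix p assume p: "p \<in> skeleton V E - V"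
    then obtain a b where ab: "(a, b) \<in> E" "p \<in> open_segment a b"
      by (force simp: skeleton_def)
    obtain r u where r: "r > 0" "norm u = 1" "skeleton V E \<inter> ball p r = (\<lambda>s. p + s *\<^sub>R u) ` {-r<..<r}"
      "ball p r \<inter> V = {}"
      by (rule edge_line[OF G ab])
    have eq: "(skeleton V E - V) \<inter> ball p r = (\<lambda>s. p + s *\<^sub>R u) ` {-r<..<r}"
      using r(3,4) by auto
    have uu: "u \<bullet> u = 1"
      using r(2) by (simp add: norm_eq_1)
    have "smooth_curve_on {-r<..<r} (\<lambda>s. p + s *\<^sub>R u) (\<lambda>_. u)"
      unfolding smooth_curve_on_def
    proof (intro exI[of _ "\<lambda>n. if n = 0 then (\<lambda>s. p + s *\<^sub>R u) else if n = 1 then (\<lambda>_. u) else (\<lambda>_. 0)"]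
        conjI allI ballI)
      fix n :: nat and t :: real
      show "((if n = 0 then (\<lambda>s. p + s *\<^sub>R u) else if n = 1 then (\<lambda>_. u) else (\<lambda>_. 0)) has_vector_derivative
         (if Suc n = 0 then (\<lambda>s. p + s *\<^sub>R u) else if Suc n = 1 then (\<lambda>_. u) else (\<lambda>_. 0)) t) (at t)"
        by (auto intro!: derivative_eq_intros simp: has_vector_derivative_def)
    qed auto
    moreover have "homeomorphism {-r<..<r} ((skeleton V E - V) \<inter> ball p r) (\<lambda>s. p + s *\<^sub>R u) (\<lambda>y. (y - p) \<bullet> u)"
      unfolding eq by (rule homeomorphismI) (auto intro!: continuous_intros simp: uu)
    moreover have "u \<noteq> 0"
      using r(2) by auto
    ultimately show "\<exists>W J \<phi> \<phi>' \<psi>. open W \<and> p \<in> W \<and> open J \<and> smooth_curve_on J \<phi> \<phi>' \<and> (\<forall>t\<in>J. \<phi>' t \<noteq> 0) \<and>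
        homeomorphism J ((skeleton V E - V) \<inter> W) \<phi> \<psi>"
      using r(1) by (intro exI[of _ "ball p r"] exI[of _ "{-r<..<r}"] exI[of _ "\<lambda>s. p + s *\<^sub>R u"]
        exI[of _ "\<lambda>_. u"] exI[of _ "\<lambda>y. (y - p) \<bullet> u"]) auto
  qed
qed

section \<open>Skeletons as triangulable curves, and their length\<close>

lemma dist_affine_path:
  fixes a b :: "'a::real_normed_vector"
  shows "dist (a + s *\<^sub>R (b - a)) (a + t *\<^sub>R (b - a)) = dist a b * dist s t"
proof -
  have "(a + s *\<^sub>R (b - a)) - (a + t *\<^sub>R (b - a)) = (s - t) *\<^sub>R (b - a)"
    by (simp add: scaleR_left_diff_distrib)
  then show ?thesis
    by (simp add: dist_norm norm_minus_commute)
qed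

lemma lipschitz_arc_segment:
  assumes "a \<noteq> b"
  shows "lipschitz_arc (\<lambda>t. a + t *\<^sub>R (b - a))"
  unfolding lipschitz_arc_def
proof (intro conjI ballI)
  define d where "d = dist a b"
  have d: "d > 0"
    using assms by (simp add: d_def)
  show "inj_on (\<lambda>t. a + t *\<^sub>R (b - a)) {0<..<1}"
    using assms by (auto intro!: inj_onI)
  show "\<exists>L. L-lipschitz_on {0<..<1} (\<lambda>t. a + t *\<^sub>R (b - a))"
    using d by (intro exI[of _ d] lipschitz_onI, unfold dist_affine_path) (auto simp: d_def)
  fix t :: real
  \<comment> \<open>One constant has to serve both bounds. The segment scales distances by exactly
    \<open>d\<close>, so \<open>?L\<close> must dominate \<open>d\<close> and
    \<open>1 / d\<close>.\<close>
  let ?L = "max d (1 / d)"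
  have "bi_lipschitz_on (\<lambda>t. a + t *\<^sub>R (b - a)) S" for S
    unfolding bi_lipschitz_on_def dist_affine_path d_def[symmetric]
  proof (intro exI[of _ ?L] conjI ballI)
    show "?L > 0"
      using d by auto
    fix s t :: real
    have "1 / ?L \<le> 1 / (1 / d)"
      using d by (intro divide_left_mono) auto
    then have "dist s t * (1 / ?L) \<le> dist s t * d"
      by (intro mult_left_mono) auto
    then show "dist s t / ?L \<le> d * dist s t"
      by (simp add: mult.commute)
    show "d * dist s t \<le> ?L * dist s t"
      by (intro mult_right_mono) auto
  qed
  then show "\<exists>\<epsilon>>0. bi_lipschitz_on (\<lambda>t. a + t *\<^sub>R (b - a)) ({0<..<1} \<inter> ball t \<epsilon>)"
    by (intro exI[of _ 1]) auto
qed

lemma lipschitz_triangulable_skeleton: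
  fixes V :: "(real^2) set"
  assumes G: "straight_graph V E"
  shows "lipschitz_triangulable (skeleton V E)"
proof -
  note D = straight_graphD[OF G]
  obtain f where f: "bij_betw f {..<card E} E"
    using ex_bij_betw_nat_finite[OF D(2)] by (auto simp: atLeast0LessThan)
  define h where "h i t = fst (f i) + t *\<^sub>R (snd (f i) - fst (f i))" for i and t :: real
  have fE: "f i \<in> E" if "i < card E" for i
    using f that by (auto simp: bij_betw_def)
  have h: "h i ` {0<..<1} = open_segment (fst (f i)) (snd (f i))" if "i < card E" for i
    unfolding h_def using open_segment_affine_image D(5)[OF fE[OF that]] by metis
  have arc: "lipschitz_arc (h i)" if "i < card E" for i
    unfolding h_def using D(5)[OF fE[OF that]] by (intro lipschitz_arc_segment)
  have disj: "disjoint_family_on (\<lambda>i. h i ` {0<..<1}) {..<card E}"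
    unfolding disjoint_family_on_def
  proof (intro ballI impI)
    fix i j assume ij: "i \<in> {..<card E}" "j \<in> {..<card E}" "i \<noteq> j"
    then have "f i \<noteq> f j"
      using f by (auto simp: bij_betw_def inj_on_def)
    then show "h i ` {0<..<1} \<inter> h j ` {0<..<1} = {}"
      using ij h[of i] h[of j] D(7)[OF fE fE, of i j] by auto
  qed
  have "skeleton V E - V = (\<Union>e\<in>E. open_segment (fst e) (snd e))"
    using D(6) by (auto simp: skeleton_def)
  also have "\<dots> = (\<Union>i<card E. open_segment (fst (f i)) (snd (f i)))"
    by (subst bij_betw_imp_surj_on[OF f, symmetric]) simp
  also have "\<dots> = (\<Union>i<card E. h i ` {0<..<1})"
    using h by (intro SUP_cong) auto
  finally show ?thesis
    unfolding lipschitz_triangulable_def using compact_skeleton[OF G] D(1) arc disj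
    by (intro conjI exI[of _ V] exI[of _ "card E"] exI[of _ h]) (auto simp: skeleton_def)
qed

lemma hausdorff1_open_segment_le:
  fixes a b :: "'a::real_normed_vector"
  shows "hausdorff1 (open_segment a b) \<le> ennreal (dist a b)"
proof (cases "a = b")
  case False
  have "(dist a b)-lipschitz_on {0<..<1} (\<lambda>t. a + t *\<^sub>R (b - a))"
    by (intro lipschitz_onI, unfold dist_affine_path) auto
  from hausdorff1_lipschitz_image[OF this] show ?thesis
    by (simp add: open_segment_affine_image[OF False])
qed simp

text \<open>Subadditivity gives one inequality. For the other, each edge has measure at least the
  distance of its ends, and disjointness lets these bounds be added.\<close>

lemma hausdorff1_skeleton:
  assumes G: "straight_graph V E"
  shows "hausdorff1 (skeleton V E) = ennreal (total_length E)"
proof (rule antisym)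
  note D = straight_graphD[OF G]
  have "hausdorff1 (skeleton V E) \<le> hausdorff1 V + hausdorff1 (\<Union>e\<in>E. open_segment (fst e) (snd e))"
    unfolding skeleton_def by (rule hausdorff1_Un)
  also have "\<dots> \<le> (\<Sum>e\<in>E. hausdorff1 (open_segment (fst e) (snd e)))"
    using hausdorff1_finite[OF D(1)] hausdorff1_Union_le[OF D(2)] by simp
  also have "\<dots> \<le> (\<Sum>e\<in>E. ennreal (dist (fst e) (snd e)))"
    by (intro sum_mono hausdorff1_open_segment_le)
  also have "\<dots> = ennreal (total_length E)"
    unfolding total_length_def by (intro sum_ennreal) auto
  finally show "hausdorff1 (skeleton V E) \<le> ennreal (total_length E)" .
  \<comment> \<open>Additivity is available for compact sets, so every edge is shortened by the
    fraction \<open>c\<close> at both ends; then \<open>c\<close> tends to 0.\<close>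
  have shrink: "ennreal ((1 - 2*c) * total_length E) \<le> hausdorff1 (skeleton V E)" if c: "0 < c" "c < 1/2" for c
  proof -
    define K where "K e = (\<lambda>t. fst e + t *\<^sub>R (snd e - fst e)) ` {c..1-c}" for e :: "'a \<times> 'a"
    have Ksub: "K e \<subseteq> open_segment (fst e) (snd e)" if "e \<in> E" for e
      unfolding K_def open_segment_affine_image[OF D(5)[OF that]] using c by (intro image_mono) auto
    have "ennreal ((1 - 2*c) * total_length E) = (\<Sum>e\<in>E. ennreal ((1 - 2*c) * dist (fst e) (snd e)))"
      unfolding total_length_def sum_distrib_left using c by (subst sum_ennreal) auto
    also have "\<dots> \<le> (\<Sum>e\<in>E. hausdorff1 (K e))"
    proof (rule sum_mono)
      fix e assume "e \<in> E"
      have "ennreal (dist (fst e + c *\<^sub>R (snd e - fst e)) (fst e + (1-c) *\<^sub>R (snd e - fst e))) \<le> hausdorff1 (K e)"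
      proof (rule hausdorff1_connected_ge)
        show "connected (K e)"
          unfolding K_def by (intro connected_continuous_image continuous_intros) auto
      qed (use c in \<open>auto simp: K_def\<close>)
      then show "ennreal ((1 - 2*c) * dist (fst e) (snd e)) \<le> hausdorff1 (K e)"
        unfolding dist_affine_path using c by (simp add: dist_real_def mult.commute)
    qed
    also have "\<dots> \<le> hausdorff1 (\<Union>e\<in>E. K e)"
    proof (rule hausdorff1_disjoint_compact_Union[OF D(2)])
      show "compact (K e)" for e
        unfolding K_def by (intro compact_continuous_image continuous_intros) auto
      show "disjoint_family_on K E"
        using Ksub D(7) unfolding disjoint_family_on_def by blast
    qed
    also have "\<dots> \<le> hausdorff1 (skeleton V E)"
      using Ksub by (intro hausdorff1_mono) (auto simp: skeleton_def)
    finally show ?thesis .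
  qed
  have "((\<lambda>c. ennreal ((1 - 2*c) * total_length E)) \<longlongrightarrow> ennreal ((1 - 2*0) * total_length E)) (at_right 0)"
    by (intro tendsto_ennrealI tendsto_intros)
  moreover have "\<forall>\<^sub>F c in at_right 0. ennreal ((1 - 2*c) * total_length E) \<le> hausdorff1 (skeleton V E)"
    using shrink eventually_at_right_less[of "0::real"] eventually_at_right_field[of _ "0::real"]
    by (auto intro: exI[of _ "1/2"])
  ultimately have "ennreal ((1 - 2*0) * total_length E) \<le> hausdorff1 (skeleton V E)"
    by (intro tendsto_upperbound[where F = "at_right (0::real)"]) auto
  then show "ennreal (total_length E) \<le> hausdorff1 (skeleton V E)"
    by simp
qed

section \<open>Centers and closed paths\<close>

lemma absolutely_continuous_onD:
  assumes "absolutely_continuous_on S f" "\<epsilon> > 0"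
  shows "\<exists>\<delta>>0. \<forall>\<D>. \<D> division_of \<Union>\<D> \<and> \<Union>\<D> \<subseteq> S \<and> (\<Sum>K\<in>\<D>. Sup K - Inf K) < \<delta>
    \<longrightarrow> (\<Sum>K\<in>\<D>. \<bar>f (Sup K) - f (Inf K)\<bar>) < \<epsilon>"
  using assms unfolding absolutely_continuous_on_def by (elim allE[of _ \<epsilon>] impE) assumption+

lemma absolutely_continuous_on_subset:
  assumes "absolutely_continuous_on S f" "S' \<subseteq> S"
  shows "absolutely_continuous_on S' f"
  unfolding absolutely_continuous_on_def
proof (intro allI impI)
  fix \<epsilon> :: real assume "\<epsilon> > 0"
  from absolutely_continuous_onD[OF assms(1) this] obtain \<delta>
    where \<delta>: "\<delta> > 0" "\<forall>\<D>. \<D> division_of \<Union>\<D> \<and> \<Union>\<D> \<subseteq> S \<and> (\<Sum>K\<in>\<D>. Sup K - Inf K) < \<delta>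
      \<longrightarrow> (\<Sum>K\<in>\<D>. \<bar>f (Sup K) - f (Inf K)\<bar>) < \<epsilon>"
    by (elim exE conjE)
  show "\<exists>\<delta>>0. \<forall>\<D>. \<D> division_of \<Union>\<D> \<and> \<Union>\<D> \<subseteq> S' \<and> (\<Sum>K\<in>\<D>. Sup K - Inf K) < \<delta>
      \<longrightarrow> (\<Sum>K\<in>\<D>. \<bar>f (Sup K) - f (Inf K)\<bar>) < \<epsilon>"
  proof (intro exI[of _ \<delta>] conjI allI impI \<open>\<delta> > 0\<close>)
    fix \<D> assume "\<D> division_of \<Union>\<D> \<and> \<Union>\<D> \<subseteq> S' \<and> (\<Sum>K\<in>\<D>. Sup K - Inf K) < \<delta>"
    then show "(\<Sum>K\<in>\<D>. \<bar>f (Sup K) - f (Inf K)\<bar>) < \<epsilon>"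
      using assms(2) by (intro \<delta>(2)[rule_format]) (elim conjE, intro conjI, assumption, rule subset_trans)
  qed
qed

text \<open>The interval only has to contain \<open>t\<close>, not to end there: in a tagged
  division the tag may lie anywhere in its interval.\<close>

lemma has_real_derivative_straddle:
  fixes f :: "real \<Rightarrow> real"
  assumes "(f has_real_derivative D) (at t within S)" "e > 0"
  obtains d where "d > 0" "\<And>u v. \<lbrakk>u \<in> S; v \<in> S; u \<le> t; t \<le> v; t - u < d; v - t < d\<rbrakk>
    \<Longrightarrow> \<bar>D * (v - u) - (f v - f u)\<bar> \<le> e * (v - u)"
proof -
  obtain d where d: "d > 0" "\<And>s. s \<in> S \<Longrightarrow> \<bar>s - t\<bar> < d \<Longrightarrow> \<bar>f s - f t - D * (s - t)\<bar> \<le> e * \<bar>s - t\<bar>"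
    using assms unfolding has_field_derivative_def has_derivative_within_alt by auto
  show ?thesis
  proof (rule that[OF d(1)])
    fix u v assume uv: "u \<in> S" "v \<in> S" "u \<le> t" "t \<le> v" "t - u < d" "v - t < d"
    have "\<bar>f u - f t - D * (u - t)\<bar> \<le> e * (t - u)" "\<bar>f v - f t - D * (v - t)\<bar> \<le> e * (v - t)"
      using d(2)[of u] d(2)[of v] uv by auto
    then show "\<bar>D * (v - u) - (f v - f u)\<bar> \<le> e * (v - u)"
      by (simp add: abs_le_iff algebra_simps)
  qed
qed

text \<open>A gauge argument. At tags outside \<open>N\<close> the straddle estimate controls each
  interval. At tags in \<open>N\<close> the gauge is an open set \<open>U\<close> of measure less
  than \<open>\<delta>\<close>, so these intervals have small total length and absolute continuity
  bounds the increments of \<open>f\<close> over them.\<close>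

lemma absolutely_continuous_fundamental_theorem:
  fixes f g :: "real \<Rightarrow> real"
  assumes ac: "absolutely_continuous_on {a..b} f" and "a \<le> b" and N: "negligible N"
    and deriv: "\<And>t. t \<in> {a..b} - N \<Longrightarrow> (f has_real_derivative g t) (at t within {a..b})"
  shows "(g has_integral (f b - f a)) {a..b}"
proof -
  \<comment> \<open>With the value 0 on \<open>N\<close>, an interval tagged there contributes
    nothing but its increment of \<open>f\<close>.\<close>
  define g0 where "g0 t = (if t \<in> N then 0 else g t)" for t
  have "(g0 has_integral (f b - f a)) {a..b}"
    unfolding has_integral_real
  proof (intro allI impI)
    fix e :: real assume "e > 0"
    from absolutely_continuous_onD[OF ac half_gt_zero[OF \<open>e > 0\<close>]] obtain \<delta>
      where \<delta>: "\<delta> > 0" "\<forall>\<D>. \<D> division_of \<Union>\<D> \<and> \<Union>\<D> \<subseteq> {a..b} \<and> (\<Sum>K\<in>\<D>. Sup K - Inf K) < \<delta>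
        \<longrightarrow> (\<Sum>K\<in>\<D>. \<bar>f (Sup K) - f (Inf K)\<bar>) < e/2"
      by (elim exE conjE)
    obtain U where U: "open U" "N \<subseteq> U" "U \<in> lmeasurable" "measure lebesgue U < \<delta>"
    proof -
      have null: "N \<in> null_sets lebesgue"
        using N by (simp add: negligible_iff_null_sets)
      then have "N \<in> sets lebesgue"
        by blast
      from sets_lebesgue_outer_open[OF this \<delta>(1)] obtain U
        where U: "open U" "N \<subseteq> U" "U - N \<in> lmeasurable" "emeasure lebesgue (U - N) < ennreal \<delta>" .
      have "U - N \<union> N \<in> lmeasurable"
        using U(3) fmeasurableI_null_sets[OF null] by (rule fmeasurable.Un)
      moreover have "U - N \<union> N = U"
        using U(2) by blast
      moreover have "measure lebesgue (U - N) = measure lebesgue U"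
        using U(1) null by (intro measure_Diff_null_set) auto
      moreover have "measure lebesgue (U - N) < \<delta>"
        using U(3,4) by (simp add: emeasure_eq_measure2 ennreal_less_iff)
      ultimately show ?thesis
        using that U(1,2) by simp
    qed
    \<comment> \<open>The added 1 keeps the denominator positive when \<open>a = b\<close> and makes
      the later bound strict.\<close>
    define e' where "e' = e / (2 * (b - a + 1))"
    have e': "e' > 0" "e' * (b - a) < e/2"
      using \<open>e > 0\<close> \<open>a \<le> b\<close> by (auto simp: e'_def field_simps)
    have "\<exists>d>0. \<forall>u v. t \<in> {a..b} - N \<and> u \<in> {a..b} \<and> v \<in> {a..b} \<and> u \<le> t \<and> t \<le> v \<and> t - u < d \<and> v - t < d
        \<longrightarrow> \<bar>g t * (v - u) - (f v - f u)\<bar> \<le> e' * (v - u)" for t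
    proof (cases "t \<in> {a..b} - N")
      case True
      show ?thesis
        by (rule has_real_derivative_straddle[OF deriv[OF True] e'(1)]) blast
    qed (auto intro: exI[of _ 1])
    then obtain d where d: "\<And>t. d t > 0" "\<And>t u v. \<lbrakk>t \<in> {a..b} - N; u \<in> {a..b}; v \<in> {a..b}; u \<le> t; t \<le> v; t - u < d t; v - t < d t\<rbrakk>
        \<Longrightarrow> \<bar>g t * (v - u) - (f v - f u)\<bar> \<le> e' * (v - u)"
      by metis
    define \<gamma> where "\<gamma> t = (if t \<in> N then U else ball t (d t))" for t
    have "gauge \<gamma>"
      unfolding gauge_def \<gamma>_def using U d(1) by auto
    moreover have "norm ((\<Sum>(x, K)\<in>p. measure lborel K *\<^sub>R g0 x) - (f b - f a)) < e"
      if p: "p tagged_division_of {a..b}" and fine: "\<gamma> fine p" for p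
    proof -
      have fin: "finite p"
        using p by auto
      define p1 where "p1 = {xK \<in> p. fst xK \<in> N}"
      define p2 where "p2 = {xK \<in> p. fst xK \<notin> N}"
      have p12: "p = p1 \<union> p2" "p1 \<inter> p2 = {}" "finite p1" "finite p2"
        using fin by (auto simp: p1_def p2_def)
      have K: "\<exists>u v. K = {u..v} \<and> u \<le> x \<and> x \<le> v \<and> a \<le> u \<and> v \<le> b" if xK: "(x, K) \<in> p" for x K
      proof -
        obtain u v where uv: "K = {u..v}"
          using tagged_division_ofD(4)[OF p xK] by auto
        then show ?thesis
          using tagged_division_ofD(2,3)[OF p xK] by (intro exI[of _ u] exI[of _ v]) auto
      qed
      define h where "h x K = measure lborel K *\<^sub>R g0 x - (f (Sup K) - f (Inf K))" for x K
      have "(\<Sum>(x, K)\<in>p. measure lborel K *\<^sub>R g0 x) - (f b - f a) = (\<Sum>(x, K)\<in>p. h x K)"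
        unfolding additive_tagged_division_1[OF \<open>a \<le> b\<close> p, symmetric] h_def
        by (simp add: sum_subtractf split_def)
      also have "\<dots> = (\<Sum>(x, K)\<in>p1. h x K) + (\<Sum>(x, K)\<in>p2. h x K)"
        unfolding p12(1) using p12 by (intro sum.union_disjoint) auto
      finally have eq: "(\<Sum>(x, K)\<in>p. measure lborel K *\<^sub>R g0 x) - (f b - f a) = (\<Sum>(x, K)\<in>p1. h x K) + (\<Sum>(x, K)\<in>p2. h x K)" .
      have "\<bar>\<Sum>(x, K)\<in>p2. h x K\<bar> \<le> (\<Sum>(x, K)\<in>p2. \<bar>h x K\<bar>)"
        by (simp add: split_def)
      also have "\<dots> \<le> (\<Sum>(x, K)\<in>p2. e' * measure lborel K)"
      proof (rule sum_mono, clarify)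
        fix x K assume xK: "(x, K) \<in> p2"
        then have "(x, K) \<in> p" "x \<notin> N"
          by (auto simp: p2_def)
        then obtain u v where uv: "K = {u..v}" "u \<le> x" "x \<le> v" "a \<le> u" "v \<le> b"
          using K by blast
        have "K \<subseteq> ball x (d x)"
          using fineD[OF fine \<open>(x, K) \<in> p\<close>] \<open>x \<notin> N\<close> by (simp add: \<gamma>_def)
        then have "u \<in> ball x (d x)" "v \<in> ball x (d x)"
          using uv subsetD[of K "ball x (d x)" u] subsetD[of K "ball x (d x)" v]
          by (simp_all del: mem_ball)
        then have "\<bar>g x * (v - u) - (f v - f u)\<bar> \<le> e' * (v - u)"
          using uv \<open>x \<notin> N\<close> by (intro d(2)) (auto simp: dist_real_def)
        then show "\<bar>h x K\<bar> \<le> e' * measure lborel K"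
          using uv \<open>x \<notin> N\<close> by (simp add: h_def g0_def mult.commute)
      qed
      also have "\<dots> \<le> (\<Sum>(x, K)\<in>p. e' * measure lborel K)"
        using fin e'(1) p12(1) by (intro sum_mono2) auto
      also have "\<dots> = e' * (\<Sum>(x, K)\<in>p. measure lborel K)"
        by (simp add: sum_distrib_left split_def)
      also have "(\<Sum>(x, K)\<in>p. measure lborel K) = b - a"
        using additive_content_tagged_division[of p a b] p \<open>a \<le> b\<close> by simp
      finally have 2: "\<bar>\<Sum>(x, K)\<in>p2. h x K\<bar> < e/2"
        using e'(2) by linarith
      have p1: "p1 tagged_partial_division_of {a..b}"
        using p tagged_partial_division_subset[of p "{a..b}" p1] p12(1)
        by (auto simp: tagged_division_of_def)
      let ?D = "snd ` p1"
      have D: "?D division_of \<Union>?D"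
        by (rule partial_division_of_tagged_division[OF p1])
      have interval: "\<exists>u v. K = {u..v} \<and> u \<le> v \<and> a \<le> u \<and> v \<le> b \<and> {u..v} \<subseteq> U" if KD: "K \<in> ?D" for K
      proof -
        obtain x where x: "(x, K) \<in> p" "x \<in> N"
          using KD by (auto simp: p1_def)
        then have "K \<subseteq> U"
          using fineD[OF fine x(1)] by (simp add: \<gamma>_def)
        moreover obtain u v where "K = {u..v}" "u \<le> x" "x \<le> v" "a \<le> u" "v \<le> b"
          using K[OF x(1)] by blast
        ultimately show ?thesis
          by (intro exI[of _ u] exI[of _ v]) auto
      qed
      have DS: "\<Union>?D \<subseteq> {a..b}" "\<Union>?D \<subseteq> U"
        using interval by fastforce+
      \<comment> \<open>The intervals do not overlap and lie in \<open>U\<close>, so their total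
        length is the measure of their union.\<close>
      have "(\<Sum>K\<in>?D. Sup K - Inf K) = (\<Sum>K\<in>?D. measure lebesgue K)"
      proof (rule sum.cong)
        fix K assume "K \<in> ?D"
        then obtain u v where "K = {u..v}" "u \<le> v"
          using interval by blast
        then show "Sup K - Inf K = measure lebesgue K"
          by simp
      qed auto
      also have "\<dots> = measure lebesgue (\<Union>?D)"
        by (rule content_division[OF D])
      also have "\<dots> \<le> measure lebesgue U"
        using DS U(3) lmeasurable_division[OF D] by (intro measure_mono_fmeasurable) auto
      finally have "(\<Sum>K\<in>?D. Sup K - Inf K) < \<delta>"
        using U(4) by simp
      then have "(\<Sum>K\<in>?D. \<bar>f (Sup K) - f (Inf K)\<bar>) < e/2"
        using D DS by (intro \<delta>(2)[rule_format] conjI)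
      moreover have "(\<Sum>(x, K)\<in>p1. \<bar>f (Sup K) - f (Inf K)\<bar>) = (\<Sum>K\<in>?D. \<bar>f (Sup K) - f (Inf K)\<bar>)"
      proof -
        \<comment> \<open>Passing from tagged pairs to intervals merges only pairs over the same
          interval, which is then degenerate and contributes 0. \<open>Sup\<close> and
          \<open>Inf\<close> of the empty set are arbitrary, hence the default value.\<close>
        define D where "D K = (if K = {} then 0 else \<bar>f (Sup K) - f (Inf K)\<bar>)" for K
        have "(\<Sum>(x, K)\<in>p1. \<bar>f (Sup K) - f (Inf K)\<bar>) = (\<Sum>(x, K)\<in>p1. D K)"
          by (intro sum.cong) (auto simp: D_def dest: tagged_partial_division_ofD(2)[OF p1])
        also have "\<dots> = (\<Sum>K\<in>?D. D K)"
        proof (rule sum.over_tagged_division_lemma[OF tagged_partial_division_of_Union_self[OF p1]])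
          show "D (cbox u v) = 0" if "box u v = {}" for u v
            using that by (cases u v rule: linorder_cases) (auto simp: D_def)
        qed
        also have "\<dots> = (\<Sum>K\<in>?D. \<bar>f (Sup K) - f (Inf K)\<bar>)"
          using division_ofD(3)[OF D] by (intro sum.cong) (auto simp: D_def)
        finally show ?thesis .
      qed
      moreover have "\<bar>\<Sum>(x, K)\<in>p1. h x K\<bar> \<le> (\<Sum>(x, K)\<in>p1. \<bar>h x K\<bar>)"
        by (simp add: split_def)
      moreover have "(\<Sum>(x, K)\<in>p1. \<bar>h x K\<bar>) = (\<Sum>(x, K)\<in>p1. \<bar>f (Sup K) - f (Inf K)\<bar>)"
        by (rule sum.cong) (auto simp: p1_def h_def g0_def)
      ultimately have 1: "\<bar>\<Sum>(x, K)\<in>p1. h x K\<bar> < e/2"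
        by linarith
      show ?thesis
        unfolding eq using 1 2 by (auto simp: abs_if split: if_splits)
    qed
    ultimately show "\<exists>\<gamma>. gauge \<gamma> \<and> (\<forall>\<D>. \<D> tagged_division_of {a..b} \<and> \<gamma> fine \<D> \<longrightarrow>
        norm ((\<Sum>(x, k)\<in>\<D>. measure lborel k *\<^sub>R g0 x) - (f b - f a)) < e)"
      by (intro exI[of _ \<gamma>] conjI allI impI) (assumption, elim conjE)
  qed
  then show ?thesis
    by (rule has_integral_spike[OF N, rotated]) (auto simp: g0_def)
qed

text \<open>Where the absolute value is at least \<open>c\<close>, inversion is Lipschitz with
  constant \<open>1 / c^2\<close>.\<close>

lemma absolutely_continuous_on_inverse:
  fixes v :: "real \<Rightarrow> real"
  assumes ac: "absolutely_continuous_on S v" and c: "c > 0" "\<And>t. t \<in> S \<Longrightarrow> c \<le> \<bar>v t\<bar>"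
  shows "absolutely_continuous_on S (\<lambda>t. inverse (v t))"
  unfolding absolutely_continuous_on_def
proof (intro allI impI)
  fix \<epsilon> :: real assume "\<epsilon> > 0"
  then have "\<epsilon> * c\<^sup>2 > 0"
    using c by simp
  from absolutely_continuous_onD[OF ac this] obtain \<delta>
    where \<delta>: "\<delta> > 0" "\<forall>\<D>. \<D> division_of \<Union>\<D> \<and> \<Union>\<D> \<subseteq> S \<and> (\<Sum>K\<in>\<D>. Sup K - Inf K) < \<delta>
      \<longrightarrow> (\<Sum>K\<in>\<D>. \<bar>v (Sup K) - v (Inf K)\<bar>) < \<epsilon> * c\<^sup>2"
    by (elim exE conjE)
  have inv: "\<bar>inverse x - inverse y\<bar> \<le> \<bar>x - y\<bar> / c\<^sup>2" if "c \<le> \<bar>x\<bar>" "c \<le> \<bar>y\<bar>" for x y :: real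
  proof -
    have nz: "x \<noteq> 0" "y \<noteq> 0"
      using that c(1) by auto
    have "c\<^sup>2 \<le> \<bar>x\<bar> * \<bar>y\<bar>"
      unfolding power2_eq_square using that c(1) by (intro mult_mono) auto
    then have "\<bar>x - y\<bar> / (\<bar>x\<bar> * \<bar>y\<bar>) \<le> \<bar>x - y\<bar> / c\<^sup>2"
      using c(1) nz by (intro divide_left_mono) auto
    moreover have "inverse x - inverse y = (y - x) / (x * y)"
      using nz by (simp add: field_simps)
    ultimately show ?thesis
      by (simp add: abs_mult abs_minus_commute)
  qed
  show "\<exists>\<delta>>0. \<forall>\<D>. \<D> division_of \<Union>\<D> \<and> \<Union>\<D> \<subseteq> S \<and> (\<Sum>K\<in>\<D>. Sup K - Inf K) < \<delta>
        \<longrightarrow> (\<Sum>K\<in>\<D>. \<bar>inverse (v (Sup K)) - inverse (v (Inf K))\<bar>) < \<epsilon>"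
  proof (intro exI[of _ \<delta>] conjI allI impI \<open>\<delta> > 0\<close>)
    fix \<D> assume \<D>: "\<D> division_of \<Union>\<D> \<and> \<Union>\<D> \<subseteq> S \<and> (\<Sum>K\<in>\<D>. Sup K - Inf K) < \<delta>"
    have "(\<Sum>K\<in>\<D>. \<bar>inverse (v (Sup K)) - inverse (v (Inf K))\<bar>) \<le> (\<Sum>K\<in>\<D>. \<bar>v (Sup K) - v (Inf K)\<bar> / c\<^sup>2)"
    proof (intro sum_mono inv c(2))
      fix K assume K: "K \<in> \<D>"
      obtain a b where "K = cbox a b" "K \<noteq> {}"
        using division_ofD(3,4)[OF conjunct1[OF \<D>] K] by auto
      moreover have "K \<subseteq> S"
        using \<D> K by blast
      ultimately show "Sup K \<in> S" "Inf K \<in> S"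
        by (auto simp: subset_iff)
    qed
    also have "\<dots> < \<epsilon> * c\<^sup>2 / c\<^sup>2"
      using \<delta>(2)[rule_format, OF \<D>] c(1) unfolding sum_divide_distrib[symmetric] by (intro divide_strict_right_mono) auto
    finally show "(\<Sum>K\<in>\<D>. \<bar>inverse (v (Sup K)) - inverse (v (Inf K))\<bar>) < \<epsilon>"
      using c(1) by simp
  qed
qed


section \<open>Solutions of the Abel equation with small initial value\<close>

lemma abel_coefficients_bound:
  assumes "abel_coefficients T a"
  obtains B where "B \<ge> 1" "\<And>i t. t \<in> {0..T} \<Longrightarrow> \<bar>a i t\<bar> \<le> B"
proof -
  have "\<exists>C. \<forall>t\<in>{0..T}. \<bar>a i t\<bar> \<le> C" for i
    using assms unfolding abel_coefficients_def bounded_real by blast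
  then obtain C where C: "\<And>i t. t \<in> {0..T} \<Longrightarrow> \<bar>a i t\<bar> \<le> C i"
    by metis
  show ?thesis
  proof (rule that[of "max 1 (max (C 1) (C 2))"])
    fix i :: 2 and t assume "t \<in> {0..T}"
    then show "\<bar>a i t\<bar> \<le> max 1 (max (C 1) (C 2))"
      using C[of t i] exhaust_2[of i] by auto
  qed simp
qed

lemma abel_coefficients_integrable:
  assumes a: "abel_coefficients T a" and g: "continuous_on {0..T} g"
  shows "(\<lambda>t. a i t * g t) absolutely_integrable_on {0..T}"
proof -
  obtain B where B: "B \<ge> 1" "\<And>i t. t \<in> {0..T} \<Longrightarrow> \<bar>a i t\<bar> \<le> B"
    using abel_coefficients_bound[OF a] by metis
  have "bounded (g ` {0..T})"
    using g by (intro compact_imp_bounded compact_continuous_image) auto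
  then obtain C where C: "\<And>t. t \<in> {0..T} \<Longrightarrow> \<bar>g t\<bar> \<le> C"
    unfolding bounded_real by blast
  show ?thesis
  proof (rule measurable_bounded_by_integrable_imp_absolutely_integrable)
    show "(\<lambda>t. a i t * g t) \<in> borel_measurable (lebesgue_on {0..T})"
    proof (rule borel_measurable_times)
      show "a i \<in> borel_measurable (lebesgue_on {0..T})"
        using a by (simp add: abel_coefficients_def)
      show "g \<in> borel_measurable (lebesgue_on {0..T})"
        using g by (rule continuous_imp_measurable_on_sets_lebesgue) simp
    qed
    show "norm (a i t * g t) \<le> B * C" if "t \<in> {0..T}" for t
      using B(1) B(2)[OF that, of i] C[OF that] by (simp add: abs_mult mult_mono)
    show "(\<lambda>t. B * C) integrable_on {0..T}"
      by (rule integrable_const_ivl)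
  qed simp
qed

lemma abel_path_integral:
  assumes a: "abel_coefficients T a" and t: "t \<in> {0..T}"
  shows "abel_path a t $ i = integral {0..t} (a i)"
proof -
  have "a i absolutely_integrable_on {0..T}"
    using abel_coefficients_integrable[OF a, of "\<lambda>_. 1" i] by simp
  then have "a i absolutely_integrable_on {0..t}"
    by (rule set_integrable_subset) (use t in auto)
  then show ?thesis
    by (simp add: abel_path_def set_lebesgue_integral_eq_integral)
qed

text \<open>A first-exit argument. While \<open>v\<close> is at most \<open>2 * c\<close> in
  absolute value, the right-hand side is at most \<open>B * ((2*c)^2 + (2*c)^3)\<close>, which is at
  most \<open>12 * B * c^2\<close> because \<open>c \<le> 1\<close>. Over time \<open>T\<close> this
  moves \<open>v\<close> by less than \<open>c / 2\<close>, by the condition with the factor 24, so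
  the level \<open>2 * c\<close> is never reached. Consequently \<open>v\<close> stays away from 0,
  and its inverse is absolutely continuous with derivative \<open>- (a 1 t + a 2 t * v t)\<close>
  almost everywhere.\<close>

lemma abel_solution_estimates:
  assumes a: "abel_coefficients T a" and "T > 0"
    and B: "B \<ge> 1" "\<And>i t. t \<in> {0..T} \<Longrightarrow> \<bar>a i t\<bar> \<le> B"
    and v: "abel_solution T a v" and c: "v 0 = c" "0 < c" "c \<le> 1" "24 * B * T * c < 1"
  shows "continuous_on {0..T} v"
    and "\<And>t. t \<in> {0..T} \<Longrightarrow> \<bar>v t - c\<bar> \<le> 12 * B * T * c\<^sup>2"
    and "((\<lambda>t. - (a 1 t + a 2 t * v t)) has_integral (inverse (v T) - inverse c)) {0..T}"
proof -
  define w where "w t = a 1 t * v t ^ 2 + a 2 t * v t ^ 3" for t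
  have ac: "absolutely_continuous_on {0..T} v"
    using v by (simp add: abel_solution_def)
  have "AE t in lebesgue_on {0..T}. (v has_real_derivative w t) (at t within {0..T})"
    using v by (simp add: abel_solution_def w_def)
  then have "AE t in lebesgue. t \<in> {0..T} \<longrightarrow> (v has_real_derivative w t) (at t within {0..T})"
    by (subst (asm) AE_restrict_space_iff) auto
  then obtain N where N: "N \<in> null_sets lebesgue"
      "{t \<in> space lebesgue. \<not> (t \<in> {0..T} \<longrightarrow> (v has_real_derivative w t) (at t within {0..T}))} \<subseteq> N"
    unfolding eventually_ae_filter by blast
  have negl: "negligible N"
    using N(1) by (simp add: negligible_iff_null_sets)
  have deriv: "(v has_real_derivative w t) (at t within {0..T})" if "t \<in> {0..T} - N" for t
    using N(2) that by auto
  have ftc: "(w has_integral (v t - v 0)) {0..t}" if t: "t \<in> {0..T}" for t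
  proof (rule absolutely_continuous_fundamental_theorem[OF _ _ negl])
    show "absolutely_continuous_on {0..t} v"
      using absolutely_continuous_on_subset[OF ac] t by auto
    show "(v has_real_derivative w s) (at s within {0..t})" if "s \<in> {0..t} - N" for s
      using t that by (intro has_field_derivative_subset[OF deriv]) auto
  qed (use t in auto)
  show cont: "continuous_on {0..T} v"
  proof -
    have "w integrable_on {0..T}"
      using ftc[of T] \<open>T > 0\<close> by auto
    then have "continuous_on {0..T} (\<lambda>t. v 0 + integral {0..t} w)"
      by (intro continuous_intros indefinite_integral_continuous_1)
    then show ?thesis
      by (rule continuous_on_eq) (simp add: integral_unique[OF ftc])
  qed
  have wB: "\<bar>w t\<bar> \<le> 12 * B * c\<^sup>2" if "t \<in> {0..T}" "\<bar>v t\<bar> \<le> 2 * c" for t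
  proof -
    have "\<bar>v t ^ 2\<bar> \<le> (2 * c) ^ 2" "\<bar>v t ^ 3\<bar> \<le> (2 * c) ^ 3"
      unfolding power_abs using that(2) by (intro power_mono; simp)+
    then have "\<bar>a 1 t * v t ^ 2\<bar> \<le> B * (2 * c) ^ 2" "\<bar>a 2 t * v t ^ 3\<bar> \<le> B * (2 * c) ^ 3"
      unfolding abs_mult using B(1) B(2)[OF that(1)] by (intro mult_mono; simp)+
    then have "\<bar>w t\<bar> \<le> B * (2 * c) ^ 2 + B * (2 * c) ^ 3"
      unfolding w_def by linarith
    also have "(2 * c) ^ 3 \<le> 8 * c\<^sup>2"
      using c(2,3) by (simp add: power_mult_distrib power_decreasing)
    then have "B * (2 * c) ^ 2 + B * (2 * c) ^ 3 \<le> B * (2 * c) ^ 2 + B * (8 * c\<^sup>2)"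
      using B(1) by (intro add_left_mono mult_left_mono) auto
    also have "\<dots> = 12 * B * c\<^sup>2"
      by (simp add: power_mult_distrib algebra_simps)
    finally show ?thesis .
  qed
  have small: "12 * B * T * c\<^sup>2 < c / 2"
  proof -
    have "c * (24 * B * T * c) < c * 1"
      using c by (intro mult_strict_left_mono) auto
    then show ?thesis
      by (simp add: power2_eq_square algebra_simps)
  qed
  \<comment> \<open>The time \<open>t\<close> itself is exempt from the assumption, so that the
    estimate applies at the first time \<open>\<tau>\<close> where the level \<open>2 * c\<close>
    would be reached.\<close>
  have close: "\<bar>v t - c\<bar> \<le> 12 * B * T * c\<^sup>2" if t: "t \<in> {0..T}" and s: "\<And>s. s \<in> {0..t} - {t} \<Longrightarrow> \<bar>v s\<bar> \<le> 2 * c" for t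
  proof -
    have "norm (v t - v 0) \<le> 12 * B * c\<^sup>2 * measure lborel {0..t}"
    proof (rule has_integral_bound_real[OF _ _ ftc[OF t]])
      show "norm (w s) \<le> 12 * B * c\<^sup>2" if "s \<in> {0..t} - {t}" for s
        using wB[of s] s[OF that] that t by auto
    qed (use B(1) in auto)
    also have "\<dots> \<le> 12 * B * c\<^sup>2 * T"
      using t B(1) by (intro mult_left_mono) auto
    finally show ?thesis
      using c(1) by (simp add: mult_ac)
  qed
  have below: "\<bar>v t\<bar> < 2 * c" if "t \<in> {0..T}" for t
  proof (rule ccontr)
    let ?Z = "{0..T} \<inter> (\<lambda>t. \<bar>v t\<bar>) -` {2 * c..}"
    assume "\<not> \<bar>v t\<bar> < 2 * c"
    then have "?Z \<noteq> {}"
      using that by auto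
    have "continuous_on {0..T} (\<lambda>t. \<bar>v t\<bar>)"
      using cont by (intro continuous_intros)
    then have "closed ?Z"
      by (intro continuous_closed_preimage) auto
    then have "compact ?Z"
      unfolding compact_eq_bounded_closed
      by (intro conjI bounded_subset[OF bounded_closed_interval[of 0 T]]) auto
    then obtain \<tau> where \<tau>: "\<tau> \<in> ?Z" "\<And>s. s \<in> ?Z \<Longrightarrow> \<tau> \<le> s"
      using compact_attains_inf[OF _ \<open>?Z \<noteq> {}\<close>] by blast
    have "\<bar>v s\<bar> \<le> 2 * c" if "s \<in> {0..\<tau>} - {\<tau>}" for s
      using \<tau>(2)[of s] \<tau>(1) that by fastforce
    then have "\<bar>v \<tau> - c\<bar> \<le> 12 * B * T * c\<^sup>2"
      using \<tau>(1) by (intro close) auto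
    then show False
      using small \<tau>(1) c(2) by auto
  qed
  show est: "\<bar>v t - c\<bar> \<le> 12 * B * T * c\<^sup>2" if "t \<in> {0..T}" for t
    using that below by (intro close) (auto intro: less_imp_le)
  have low: "c / 2 \<le> \<bar>v t\<bar>" if "t \<in> {0..T}" for t
    using est[OF that] small by linarith
  show "((\<lambda>t. - (a 1 t + a 2 t * v t)) has_integral (inverse (v T) - inverse c)) {0..T}"
    unfolding c(1)[symmetric]
  proof (rule absolutely_continuous_fundamental_theorem[OF _ _ negl])
    show "absolutely_continuous_on {0..T} (\<lambda>t. inverse (v t))"
      using low c(2) by (intro absolutely_continuous_on_inverse[OF ac, of "c / 2"]) auto
    fix t assume t: "t \<in> {0..T} - N"
    then have nz: "v t \<noteq> 0"
      using low[of t] c(2) by auto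
    have "((\<lambda>t. inverse (v t)) has_real_derivative - (inverse (v t) * w t * inverse (v t))) (at t within {0..T})"
      using deriv[OF t] nz by (rule DERIV_inverse')
    moreover have "inverse (v t) * w t * inverse (v t) = a 1 t + a 2 t * v t"
      using nz by (simp add: w_def field_simps power2_eq_square power3_eq_cube)
    ultimately show "((\<lambda>t. inverse (v t)) has_real_derivative - (a 1 t + a 2 t * v t)) (at t within {0..T})"
      by simp
  qed (use \<open>T > 0\<close> in auto)
qed

lemma abs_le_linear_imp_zero:
  fixes x :: real
  assumes "\<epsilon> > 0" and le: "\<And>c. 0 < c \<Longrightarrow> c < \<epsilon> \<Longrightarrow> \<bar>x\<bar> \<le> C * c"
  shows "x = 0"
proof -
  have "((\<lambda>c. C * c) \<longlongrightarrow> C * 0) (at_right 0)"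
    by (intro tendsto_intros)
  moreover have "\<forall>\<^sub>F c in at_right 0. \<bar>x\<bar> \<le> C * c"
    using le \<open>\<epsilon> > 0\<close> unfolding eventually_at_right_field by blast
  ultimately have "\<bar>x\<bar> \<le> C * 0"
    by (intro tendsto_lowerbound[where F = "at_right (0::real)"]) auto
  then show ?thesis
    by simp
qed

text \<open>For a solution with \<open>v(T) = v(0) = c\<close>, integrating \<open>(1 / v)' = - a\<^sub>1 - a\<^sub>2 v\<close> gives
  \<open>\<integral> a\<^sub>1 = - \<integral> a\<^sub>2 v\<close>. As \<open>c \<rightarrow> 0\<close> this forces \<open>\<integral> a\<^sub>1 = 0\<close>; then \<open>\<integral> a\<^sub>2 v = 0\<close>, and
  \<open>v = c + O(c\<^sup>2)\<close> forces \<open>\<integral> a\<^sub>2 = 0\<close>.\<close>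

lemma abel_center_path_closed:
  assumes a: "abel_coefficients T a" and "T > 0" and center: "abel_center T a"
  shows "abel_path a T = 0"
proof -
  obtain B where B: "B \<ge> 1" "\<And>i t. t \<in> {0..T} \<Longrightarrow> \<bar>a i t\<bar> \<le> B"
    using abel_coefficients_bound[OF a] by metis
  obtain \<epsilon> where \<epsilon>: "\<epsilon> > 0" "\<And>c. \<bar>c\<bar> < \<epsilon> \<Longrightarrow> \<exists>v. abel_solution T a v \<and> v 0 = c \<and> v T = c"
    using center unfolding abel_center_def by metis
  \<comment> \<open>Below \<open>\<eta>\<close> an initial value both returns at time
    \<open>T\<close> and satisfies the smallness condition of the estimates; the further bound 1
    supplies \<open>c \<le> 1\<close>.\<close>
  define \<eta> where "\<eta> = min \<epsilon> (1 / (24 * B * T))"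
  have BT: "0 < 24 * B * T"
    using B(1) \<open>T > 0\<close> by simp
  then have "\<eta> > 0"
    using \<epsilon>(1) by (simp add: \<eta>_def)
  define A where "A i = integral {0..T} (a i)" for i
  have int_a: "a i integrable_on {0..T}" for i
    using abel_coefficients_integrable[OF a, of "\<lambda>_. 1" i] by (simp add: set_lebesgue_integral_eq_integral)
  have main: "\<exists>v. (\<forall>t\<in>{0..T}. \<bar>v t - c\<bar> \<le> 12 * B * T * c\<^sup>2) \<and> (\<lambda>t. a 2 t * v t) integrable_on {0..T} \<and>
      A 1 + integral {0..T} (\<lambda>t. a 2 t * v t) = 0" if c: "0 < c" "c < min \<eta> 1" for c
  proof -
    obtain v where v: "abel_solution T a v" "v 0 = c" "v T = c"
      using \<epsilon>(2)[of c] c by (auto simp: \<eta>_def)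
    have "c < 1 / (24 * B * T)"
      using c by (simp add: \<eta>_def)
    then have small: "24 * B * T * c < 1"
      using BT by (simp add: field_simps)
    have c1: "c \<le> 1"
      using c by simp
    note est = abel_solution_estimates[OF a \<open>T > 0\<close> B v(1,2) c(1) c1 small]
    have int_v: "(\<lambda>t. a 2 t * v t) integrable_on {0..T}"
      using abel_coefficients_integrable[OF a est(1)] by (simp add: set_lebesgue_integral_eq_integral)
    have "integral {0..T} (\<lambda>t. a 1 t + a 2 t * v t) = 0"
      using has_integral_neg[OF est(3)] v(3) by (intro integral_unique) (simp add: add.commute)
    then have "A 1 + integral {0..T} (\<lambda>t. a 2 t * v t) = 0"
      using integral_add[OF int_a int_v] by (simp add: A_def)
    then show ?thesis
      using est(2) int_v by blast
  qed
  have bound: "\<bar>integral {0..T} (\<lambda>t. a 2 t * u t)\<bar> \<le> B * D * T"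
    if "(\<lambda>t. a 2 t * u t) integrable_on {0..T}" "\<And>t. t \<in> {0..T} \<Longrightarrow> \<bar>u t\<bar> \<le> D" "D \<ge> 0" for u D
  proof -
    have "norm (integral {0..T} (\<lambda>t. a 2 t * u t)) \<le> B * D * measure lborel {0..T}"
    proof (rule has_integral_bound_real[OF _ finite.emptyI integrable_integral[OF that(1)]])
      show "norm (a 2 t * u t) \<le> B * D" if "t \<in> {0..T} - {}" for t
        using B(1) B(2)[of t 2] that \<open>\<And>t. t \<in> {0..T} \<Longrightarrow> \<bar>u t\<bar> \<le> D\<close>[of t] by (simp add: abs_mult mult_mono)
    qed (use B(1) that(3) in simp)
    then show ?thesis
      using \<open>T > 0\<close> by simp
  qed
  have A1: "A 1 = 0"
  proof (rule abs_le_linear_imp_zero[of "min \<eta> 1"])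
    show "min \<eta> 1 > 0"
      using \<open>\<eta> > 0\<close> by simp
    fix c assume c: "0 < c" "c < min \<eta> 1"
    obtain v where v: "\<forall>t\<in>{0..T}. \<bar>v t - c\<bar> \<le> 12 * B * T * c\<^sup>2" "(\<lambda>t. a 2 t * v t) integrable_on {0..T}"
      "A 1 + integral {0..T} (\<lambda>t. a 2 t * v t) = 0"
      using main[OF c] by blast
    have "12 * B * T * c\<^sup>2 \<le> 12 * B * T * c"
      using c BT by (intro mult_left_mono) (auto simp: power2_eq_square)
    then have "\<bar>v t\<bar> \<le> c + 12 * B * T * c" if "t \<in> {0..T}" for t
      using v(1) that c(1) by (smt (verit))
    then have "\<bar>integral {0..T} (\<lambda>t. a 2 t * v t)\<bar> \<le> B * (c + 12 * B * T * c) * T"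
      using c BT by (intro bound v(2)) auto
    then show "\<bar>A 1\<bar> \<le> (B * (1 + 12 * B * T) * T) * c"
      using v(3) by (simp add: algebra_simps)
  qed
  have "A 2 = 0"
  proof (rule abs_le_linear_imp_zero[of "min \<eta> 1"])
    show "min \<eta> 1 > 0"
      using \<open>\<eta> > 0\<close> by simp
    fix c assume c: "0 < c" "c < min \<eta> 1"
    obtain v where v: "\<forall>t\<in>{0..T}. \<bar>v t - c\<bar> \<le> 12 * B * T * c\<^sup>2" "(\<lambda>t. a 2 t * v t) integrable_on {0..T}"
      "A 1 + integral {0..T} (\<lambda>t. a 2 t * v t) = 0"
      using main[OF c] by blast
    have int_c: "(\<lambda>t. a 2 t * c) integrable_on {0..T}"
      using int_a[of 2] by (rule integrable_on_mult_left)
    have "integral {0..T} (\<lambda>t. a 2 t * (v t - c)) = integral {0..T} (\<lambda>t. a 2 t * v t) - A 2 * c"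
      unfolding right_diff_distrib integral_diff[OF v(2) int_c] by (simp add: A_def)
    moreover have "\<bar>integral {0..T} (\<lambda>t. a 2 t * (v t - c))\<bar> \<le> B * (12 * B * T * c\<^sup>2) * T"
      using v(1) BT integrable_diff[OF v(2) int_c] by (intro bound) (auto simp: right_diff_distrib)
    ultimately have "\<bar>A 2\<bar> * c \<le> (B * (12 * B * T * c) * T) * c"
      using v(3) A1 c(1) by (simp add: abs_mult power2_eq_square mult_ac)
    then have "\<bar>A 2\<bar> \<le> B * (12 * B * T * c) * T"
      using c(1) by (rule mult_right_le_imp_le)
    then show "\<bar>A 2\<bar> \<le> (B * (12 * B * T) * T) * c"
      by (simp add: mult_ac)
  qed
  with A1 have "A i = 0" for i
    using exhaust_2[of i] by auto
  then show ?thesis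
    using abel_path_integral[OF a, of T] \<open>T > 0\<close> by (simp add: vec_eq_iff A_def)
qed

section \<open>Exactness of one-forms on trees\<close>

text \<open>A derivative within \<open>S\<close> only sees increments towards points of
  \<open>S\<close>. On a segment this allows the derivative of a primitive, computed along the edge,
  to be rewritten as the one-form \<open>f z * (h \<bullet> e)\<close>.\<close>

lemma has_derivative_cong_directions:
  assumes "(f has_derivative D) (at x within S)" "bounded_linear D'"
    and "\<And>y. y \<in> S \<Longrightarrow> D (y - x) = D' (y - x)"
  shows "(f has_derivative D') (at x within S)"
  unfolding has_derivative_within
proof
  have "((\<lambda>y. (1 / norm (y - x)) *\<^sub>R (f y - (f x + D (y - x)))) \<longlongrightarrow> 0) (at x within S)"
    using assms(1) unfolding has_derivative_within by (rule conjunct2)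
  then show "((\<lambda>y. (1 / norm (y - x)) *\<^sub>R (f y - (f x + D' (y - x)))) \<longlongrightarrow> 0) (at x within S)"
    by (rule Lim_transform_within[of _ _ _ _ 1]) (simp_all add: assms(3))
qed (rule assms(2))

lemma has_derivative_within_Un:
  assumes "(f has_derivative D) (at x within S)" "(f has_derivative D) (at x within S')"
  shows "(f has_derivative D) (at x within (S \<union> S'))"
  unfolding has_derivative_within
proof
  show "bounded_linear D"
    using assms(1) by (rule has_derivative_bounded_linear)
  show "((\<lambda>y. (1 / norm (y - x)) *\<^sub>R (f y - (f x + D (y - x)))) \<longlongrightarrow> 0) (at x within S \<union> S')"
    using assms unfolding has_derivative_within by (intro Lim_Un) (rule conjunct2, assumption)+
qed

lemma has_derivative_within_closed_notin:
  assumes "closed S" "x \<notin> S" "bounded_linear D"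
  shows "(f has_derivative D) (at x within S)"
proof -
  have "x \<notin> closure (S - {x})"
    using assms by (metis Diff_empty Diff_insert0 closure_closed)
  then have "at x within S = bot"
    by (simp add: at_within_eq_bot_iff)
  then show ?thesis
    using assms(3) by (simp add: has_derivative_def)
qed

text \<open>A closed piece that misses \<open>x\<close> has no points near \<open>x\<close> and
  imposes no condition there, so only the pieces through \<open>x\<close> have to be checked when
  primitives are glued.\<close>

lemma has_derivative_within_Un_closed:
  assumes "closed S" "closed S'" "bounded_linear D"
    and "x \<in> S \<Longrightarrow> (f has_derivative D) (at x within S)"
    and "x \<in> S' \<Longrightarrow> (f has_derivative D) (at x within S')"
  shows "(f has_derivative D) (at x within (S \<union> S'))"
proof (rule has_derivative_within_Un)
  show "(f has_derivative D) (at x within S)"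
    using assms(4) has_derivative_within_closed_notin[OF assms(1) _ assms(3)] by (cases "x \<in> S") simp_all
  show "(f has_derivative D) (at x within S')"
    using assms(5) has_derivative_within_closed_notin[OF assms(2) _ assms(3)] by (cases "x \<in> S'") simp_all
qed

text \<open>In the affine parameter the form becomes \<open>f (l u) * ((q - p) \<bullet> e)\<close>,
  a continuous function of one variable, which is integrated from \<open>p\<close>.\<close>

lemma segment_one_form_exact:
  fixes p q e :: "'a::euclidean_space"
  assumes "p \<noteq> q" and f: "continuous_on (closed_segment p q) f"
  obtains g where "g p = c"
    "\<And>z. z \<in> closed_segment p q \<Longrightarrow> (g has_derivative (\<lambda>h. f z * (h \<bullet> e))) (at z within closed_segment p q)"
proof -
  define l where "l u = p + u *\<^sub>R (q - p)" for u
  \<comment> \<open>Orthogonal projection to the line, in the parameter of \<open>l\<close>: a left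
    inverse of \<open>l\<close> that is defined and differentiable on the whole space.\<close>
  define s where "s y = ((y - p) \<bullet> (q - p)) / ((q - p) \<bullet> (q - p))" for y
  define \<Psi> where "\<Psi> t = integral {0..t} (\<lambda>u. f (l u))" for t
  define g where "g y = c + ((q - p) \<bullet> e) * \<Psi> (s y)" for y
  have S: "closed_segment p q = l ` {0..1}"
    by (simp add: closed_segment_image_interval l_def algebra_simps)
  have sl: "s (l u) = u" for u
    using assms(1) by (simp add: s_def l_def)
  have "continuous_on {0..1} (\<lambda>u. f (l u))"
    by (rule continuous_on_compose2[OF f]) (auto simp: l_def S intro!: continuous_intros)
  then have \<Psi>: "(\<Psi> has_real_derivative f (l t)) (at t within {0..1})" if "t \<in> {0..1}" for t
    unfolding \<Psi>_def using that by (rule integral_has_real_derivative)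
  have "(g has_derivative (\<lambda>h. f z * (h \<bullet> e))) (at z within closed_segment p q)"
    if z: "z \<in> closed_segment p q" for z
  proof -
    obtain t where t: "t \<in> {0..1}" "z = l t"
      using z S by blast
    have "(s has_derivative (\<lambda>h. (h \<bullet> (q - p)) / ((q - p) \<bullet> (q - p)))) (at z within closed_segment p q)"
      unfolding s_def using assms(1) by (auto intro!: derivative_eq_intros)
    moreover have "(\<Psi> has_derivative (\<lambda>r. f z * r)) (at (s z) within s ` closed_segment p q)"
      using \<Psi>[OF t(1)] unfolding S image_image sl t(2) by (simp add: has_field_derivative_def)
    ultimately have "((\<lambda>y. \<Psi> (s y)) has_derivative (\<lambda>h. f z * ((h \<bullet> (q - p)) / ((q - p) \<bullet> (q - p)))))
        (at z within closed_segment p q)"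
      by (rule has_derivative_in_compose)
    then have "(g has_derivative (\<lambda>h. ((q - p) \<bullet> e) * (f z * ((h \<bullet> (q - p)) / ((q - p) \<bullet> (q - p))))))
        (at z within closed_segment p q)"
      unfolding g_def by (auto intro!: derivative_eq_intros)
    then show ?thesis
    proof (rule has_derivative_cong_directions)
      show "bounded_linear (\<lambda>h. f z * (h \<bullet> e))"
        by (intro bounded_linear_intros)
      fix y assume "y \<in> closed_segment p q"
      then obtain u where "y = l u"
        using S by auto
      then have "y - z = (u - t) *\<^sub>R (q - p)"
        using t(2) by (simp add: l_def scaleR_left_diff_distrib)
      then show "((q - p) \<bullet> e) * (f z * (((y - z) \<bullet> (q - p)) / ((q - p) \<bullet> (q - p)))) = f z * ((y - z) \<bullet> e)"
        using assms(1) by simp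
    qed
  qed
  moreover have "g p = c"
    by (simp add: g_def s_def \<Psi>_def)
  ultimately show ?thesis
    using that by blast
qed

text \<open>A new edge meets the old tree in a single point, so its constant of integration can be
  chosen to match there. Closing a cycle would impose a second matching condition, which a general
  one-form violates.\<close>

lemma tree_one_form_exact:
  fixes e :: "'a::euclidean_space"
  assumes "straight_tree V E" "continuous_on (skeleton V E) f"
  obtains g where
    "\<And>z. z \<in> skeleton V E \<Longrightarrow> (g has_derivative (\<lambda>h. f z * (h \<bullet> e))) (at z within skeleton V E)"
proof -
  have "\<exists>g. \<forall>z\<in>skeleton V E. (g has_derivative (\<lambda>h. f z * (h \<bullet> e))) (at z within skeleton V E)"
    using assms
  proof (induction rule: straight_tree.induct)
    case root
    have "bounded_linear (\<lambda>h. f 0 * (h \<bullet> e))"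
      by (intro bounded_linear_intros)
    then show ?case
      by (simp add: skeleton_def has_derivative_within_singleton_iff)
  next
    case (split V E a b p)
    then show ?case
      by (simp only: skeleton_split)
  next
    case (attach V E p q)
    let ?P = "skeleton V E" and ?S = "closed_segment p q"
    note un = skeleton_attach[OF attach.hyps(2)]
    have f: "continuous_on ?P f" "continuous_on ?S f"
      using attach.prems unfolding un by (auto intro: continuous_on_subset)
    obtain g where g: "\<And>z. z \<in> ?P \<Longrightarrow> (g has_derivative (\<lambda>h. f z * (h \<bullet> e))) (at z within ?P)"
      using attach.IH[OF f(1)] by blast
    obtain k where k: "k p = g p"
      "\<And>z. z \<in> ?S \<Longrightarrow> (k has_derivative (\<lambda>h. f z * (h \<bullet> e))) (at z within ?S)"
      using segment_one_form_exact[OF attach.hyps(3)[symmetric] f(2), of "g p" e] by blast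
    \<comment> \<open>On the new edge \<open>G\<close> equals \<open>k\<close> throughout: the only
      overlap is \<open>p\<close>, where the two primitives agree.\<close>
    define G where "G y = (if y \<in> ?P then g y else k y)" for y
    have Gk: "G y = k y" if "y \<in> ?S" for y
    proof (cases "y \<in> ?P")
      case True
      then have "y = p"
        using that attach.hyps(4) by blast
      then show ?thesis
        using k(1) by (simp add: G_def)
    qed (simp add: G_def)
    have "(G has_derivative (\<lambda>h. f z * (h \<bullet> e))) (at z within ?P \<union> ?S)" for z
    proof (rule has_derivative_within_Un_closed)
      show "closed ?P"
        using compact_skeleton straight_tree_graph[OF attach.hyps(1)] compact_imp_closed by blast
      show "bounded_linear (\<lambda>h. f z * (h \<bullet> e))"
        by (intro bounded_linear_intros)
      show "(G has_derivative (\<lambda>h. f z * (h \<bullet> e))) (at z within ?P)" if "z \<in> ?P"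
        by (rule has_derivative_transform[OF that _ g[OF that]]) (simp add: G_def)
      show "(G has_derivative (\<lambda>h. f z * (h \<bullet> e))) (at z within ?S)" if "z \<in> ?S"
        by (rule has_derivative_transform[OF that _ k(2)[OF that]]) (simp add: Gk)
    qed simp
    then show ?case
      unfolding un by blast
  qed
  then show ?thesis
    using that by blast
qed

section \<open>Line integrals along Lipschitz paths\<close>

lemma integral_weighted_oscillation:
  fixes a g :: "real \<Rightarrow> real"
  assumes "u \<le> v" and int: "a integrable_on {u..v}" "(\<lambda>s. a s * g s) integrable_on {u..v}"
    and "\<And>s. s \<in> {u..v} \<Longrightarrow> \<bar>a s\<bar> \<le> B" "\<And>s. s \<in> {u..v} \<Longrightarrow> \<bar>g s - c\<bar> \<le> D" "0 \<le> B" "0 \<le> D"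
  shows "\<bar>integral {u..v} (\<lambda>s. a s * g s) - c * integral {u..v} a\<bar> \<le> B * D * (v - u)"
proof -
  have 1: "((\<lambda>s. a s * g s - c * a s) has_integral
      integral {u..v} (\<lambda>s. a s * g s) - c * integral {u..v} a) {u..v}"
    using int by (intro has_integral_diff has_integral_mult_right integrable_integral)
  have "norm (integral {u..v} (\<lambda>s. a s * g s) - c * integral {u..v} a) \<le> B * D * measure lborel {u..v}"
  proof (rule has_integral_bound_real[OF _ finite.emptyI 1])
    fix s assume s: "s \<in> {u..v} - {}"
    have "a s * g s - c * a s = a s * (g s - c)"
      by (simp add: algebra_simps)
    then show "norm (a s * g s - c * a s) \<le> B * D"
      using assms(4-7) s by (simp add: abs_mult mult_mono)
  qed (use assms in simp)
  then show ?thesis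
    using \<open>u \<le> v\<close> by simp
qed

lemma abel_path_lipschitz:
  assumes a: "abel_coefficients T a"
    and B: "0 \<le> B" "\<And>i t. t \<in> {0..T} \<Longrightarrow> \<bar>a i t\<bar> \<le> B"
    and st: "s \<in> {0..T}" "t \<in> {0..T}"
  shows "norm (abel_path a t - abel_path a s) \<le> 2 * B * \<bar>t - s\<bar>"
proof -
  have le: "\<bar>abel_path a t $ i - abel_path a s $ i\<bar> \<le> B * (t - s)"
    if "s \<in> {0..T}" "t \<in> {0..T}" "s \<le> t" for s t i
  proof -
    have "a i integrable_on {0..T}"
      using abel_coefficients_integrable[OF a, of "\<lambda>_. 1" i] by (simp add: set_lebesgue_integral_eq_integral)
    then have int: "a i integrable_on {0..t}" "a i integrable_on {s..t}"
      using that by (auto intro: integrable_on_subinterval)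
    have "integral {0..s} (a i) + integral {s..t} (a i) = integral {0..t} (a i)"
      using that int by (intro Henstock_Kurzweil_Integration.integral_combine) auto
    moreover have "norm (integral {s..t} (a i)) \<le> B * measure lborel {s..t}"
      using B that by (intro has_integral_bound_real[OF _ finite.emptyI integrable_integral[OF int(2)]]) auto
    ultimately show ?thesis
      using that by (simp add: abel_path_integral[OF a])
  qed
  have "\<bar>(abel_path a t - abel_path a s) $ i\<bar> \<le> B * \<bar>t - s\<bar>" for i
    using le[OF st] le[OF st(2,1)] by (cases "s \<le> t") (auto simp: abs_minus_commute)
  \<comment> \<open>The norm is bounded by the sum over the two coordinates, hence the factor
    2.\<close>
  then have "(\<Sum>i\<in>UNIV. \<bar>(abel_path a t - abel_path a s) $ i\<bar>) \<le> (\<Sum>i\<in>(UNIV :: 2 set). B * \<bar>t - s\<bar>)"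
    by (intro sum_mono)
  then show ?thesis
    using norm_le_l1_cart[of "abel_path a t - abel_path a s"] by simp
qed

lemma abel_path_continuous:
  assumes a: "abel_coefficients T a"
  shows "continuous_on {0..T} (abel_path a)"
proof -
  obtain B where B: "B \<ge> 1" "\<And>i t. t \<in> {0..T} \<Longrightarrow> \<bar>a i t\<bar> \<le> B"
    using abel_coefficients_bound[OF a] by metis
  have "(2 * B)-lipschitz_on {0..T} (abel_path a)"
    using abel_path_lipschitz[OF a _ B(2)] B(1) by (intro lipschitz_onI) (auto simp: dist_norm dist_real_def)
  then show ?thesis
    by (rule lipschitz_on_continuous_on)
qed

text \<open>The path is merely Lipschitz, so the chain rule is replaced by the observation that the
  difference of the two sides has derivative zero at every point.\<close>

lemma abel_path_line_integral:
  assumes a: "abel_coefficients T a" and sub: "abel_path a ` {0..T} \<subseteq> P"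
    and f: "continuous_on P f"
    and g: "\<And>z. z \<in> P \<Longrightarrow> (g has_derivative (\<lambda>h. f z * (h \<bullet> axis i 1))) (at z within P)"
    and t: "t \<in> {0..T}"
  shows "integral {t..T} (\<lambda>s. a i s * f (abel_path a s)) = g (abel_path a T) - g (abel_path a t)"
proof -
  let ?x = "abel_path a"
  obtain B where B: "B \<ge> 1" "\<And>i t. t \<in> {0..T} \<Longrightarrow> \<bar>a i t\<bar> \<le> B"
    using abel_coefficients_bound[OF a] by metis
  have lip: "norm (?x t - ?x s) \<le> 2 * B * \<bar>t - s\<bar>" if "s \<in> {0..T}" "t \<in> {0..T}" for s t
    using B by (intro abel_path_lipschitz[OF a]) (use that in auto)
  have fx: "continuous_on {0..T} (\<lambda>s. f (?x s))"
    using f abel_path_continuous[OF a] sub by (rule continuous_on_compose2)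
  define \<psi> where "\<psi> s = a i s * f (?x s)" for s
  have int_a: "a i integrable_on {0..T}"
    using abel_coefficients_integrable[OF a, of "\<lambda>_. 1" i] by (simp add: set_lebesgue_integral_eq_integral)
  have int_\<psi>: "\<psi> integrable_on {0..T}"
    using abel_coefficients_integrable[OF a fx] by (simp add: set_lebesgue_integral_eq_integral \<psi>_def[abs_def])
  define J where "J t = integral {0..t} \<psi>" for t
  have J: "J v - J u = integral {u..v} \<psi>" if "u \<in> {0..T}" "v \<in> {0..T}" "u \<le> v" for u v
    using Henstock_Kurzweil_Integration.integral_combine[of 0 u v \<psi>] that integrable_on_subinterval[OF int_\<psi>, of 0 v]
    by (auto simp: J_def)
  have X: "?x v $ i - ?x u $ i = integral {u..v} (a i)" if "u \<in> {0..T}" "v \<in> {0..T}" "u \<le> v" for u v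
    using Henstock_Kurzweil_Integration.integral_combine[of 0 u v "a i"] that integrable_on_subinterval[OF int_a, of 0 v]
    by (auto simp: abel_path_integral[OF a])
  \<comment> \<open>Increments of \<open>J\<close> are compared with increments of the
    \<open>i\<close>-th coordinate. Those of \<open>g\<close> along the path are compared with the
    same quantity, so it cancels and no derivative of the path at the given time is
    involved.\<close>
  have osc: "\<bar>(J v - J u) - c * (?x v $ i - ?x u $ i)\<bar> \<le> B * D * (v - u)"
    if "u \<in> {0..T}" "v \<in> {0..T}" "u \<le> v" "\<And>s. s \<in> {u..v} \<Longrightarrow> \<bar>f (?x s) - c\<bar> \<le> D" "D \<ge> 0" for u v c D
    unfolding J[OF that(1-3)] X[OF that(1-3)] \<psi>_def[abs_def]
    using that B integrable_on_subinterval[OF int_a, of u v] integrable_on_subinterval[OF int_\<psi>, of u v]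
    by (intro integral_weighted_oscillation) (auto simp: \<psi>_def[abs_def])
  define \<Phi> where "\<Phi> t = g (?x t) - J t" for t
  have "(\<Phi> has_derivative (\<lambda>h. 0)) (at t within {0..T})" if t: "t \<in> {0..T}" for t
    unfolding has_derivative_within_alt
  proof (intro conjI allI impI)
    fix e :: real assume "e > 0"
    define c where "c = f (?x t)"
    \<comment> \<open>The path has speed at most \<open>2 * B\<close>, so an error \<open>e1\<close>
      in the derivative of \<open>g\<close> costs \<open>2 * B * e1 = e / 2\<close>; the oscillation
      of \<open>f\<close> costs \<open>B * e1\<close>, which is at most
      \<open>e / 2\<close>.\<close>
    define e1 where "e1 = e / (4 * B)"
    have e1: "e1 > 0" "2 * B * e1 = e / 2" "B * e1 \<le> e / 2"
      using \<open>e > 0\<close> B(1) by (auto simp: e1_def field_simps)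
    have "?x t \<in> P"
      using sub t by auto
    from g[OF this] obtain d1 where d1: "d1 > 0" "\<And>z. z \<in> P \<Longrightarrow> norm (z - ?x t) < d1 \<Longrightarrow>
        \<bar>g z - g (?x t) - c * ((z - ?x t) $ i)\<bar> \<le> e1 * norm (z - ?x t)"
      unfolding has_derivative_within_alt c_def using e1(1) by (auto simp: inner_axis)
    obtain d2 where d2: "d2 > 0" "\<And>s. s \<in> {0..T} \<Longrightarrow> dist s t < d2 \<Longrightarrow> dist (f (?x s)) (f (?x t)) < e1"
      using fx t e1(1) unfolding continuous_on_iff by blast
    \<comment> \<open>\<open>d2\<close> keeps \<open>f\<close> along the path within
      \<open>e1\<close> of \<open>c\<close>; the other term keeps the path within \<open>d1\<close>
      of its position at time \<open>t\<close>.\<close>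
    define d where "d = min d2 (d1 / (2 * B))"
    have "d > 0"
      using d1(1) d2(1) B(1) by (simp add: d_def)
    moreover have "norm (\<Phi> y - \<Phi> t - 0) \<le> e * norm (y - t)" if y: "y \<in> {0..T}" "norm (y - t) < d" for y
    proof -
      have n: "norm (?x y - ?x t) \<le> 2 * B * \<bar>y - t\<bar>"
        by (rule lip[OF t y(1)])
      also have "2 * B * \<bar>y - t\<bar> < d1"
        using y(2) B(1) by (simp add: d_def field_simps)
      finally have "\<bar>g (?x y) - g (?x t) - c * ((?x y - ?x t) $ i)\<bar> \<le> e1 * norm (?x y - ?x t)"
        using y sub by (intro d1(2)) auto
      also have "\<dots> \<le> e1 * (2 * B * \<bar>y - t\<bar>)"
        using n e1(1) by (intro mult_left_mono) auto
      also have "\<dots> = e / 2 * \<bar>y - t\<bar>"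
        using e1(2) by (simp add: mult_ac)
      finally have 1: "\<bar>g (?x y) - g (?x t) - c * (?x y $ i - ?x t $ i)\<bar> \<le> e / 2 * \<bar>y - t\<bar>"
        by simp
      have near: "\<bar>f (?x s) - c\<bar> \<le> e1" if "s \<in> {0..T}" "\<bar>s - t\<bar> \<le> \<bar>y - t\<bar>" for s
        using d2(2)[OF that(1)] that(2) y(2) by (auto simp: d_def c_def dist_real_def less_imp_le)
      have "\<bar>(J y - J t) - c * (?x y $ i - ?x t $ i)\<bar> \<le> B * e1 * \<bar>y - t\<bar>"
      proof (cases "t \<le> y")
        case True
        then show ?thesis
          using osc[OF t y(1) True, of c e1] near e1(1) t y(1) by auto
      next
        case False
        then have "\<bar>(J t - J y) - c * (?x t $ i - ?x y $ i)\<bar> \<le> B * e1 * (t - y)"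
          using near e1(1) t y(1) by (intro osc) auto
        moreover have "(J y - J t) - c * (?x y $ i - ?x t $ i) = - ((J t - J y) - c * (?x t $ i - ?x y $ i))"
          by (simp add: algebra_simps)
        ultimately show ?thesis
          using False by simp
      qed
      also have "\<dots> \<le> e / 2 * \<bar>y - t\<bar>"
        using e1(3) by (intro mult_right_mono) auto
      finally have 2: "\<bar>(J y - J t) - c * (?x y $ i - ?x t $ i)\<bar> \<le> e / 2 * \<bar>y - t\<bar>" .
      have "\<bar>\<Phi> y - \<Phi> t\<bar> \<le> e / 2 * \<bar>y - t\<bar> + e / 2 * \<bar>y - t\<bar>"
        unfolding \<Phi>_def using 1 2 by linarith
      then show ?thesis
        by simp
    qed
    ultimately show "\<exists>d>0. \<forall>y\<in>{0..T}. norm (y - t) < d \<longrightarrow> norm (\<Phi> y - \<Phi> t - 0) \<le> e * norm (y - t)"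
      by blast
  qed simp
  then obtain c where c: "\<And>t. t \<in> {0..T} \<Longrightarrow> \<Phi> t = c"
    using has_derivative_zero_constant[of "{0..T}" \<Phi>] by (metis convex_real_interval(5))
  have "\<Phi> T = \<Phi> t"
    using c t by simp
  moreover have "J T - J t = integral {t..T} \<psi>"
    using t by (intro J) auto
  ultimately show ?thesis
    by (simp add: \<Phi>_def \<psi>_def[abs_def])
qed

section \<open>Vanishing of iterated integrals\<close>

text \<open>By monotonicity the last coordinate is constrained only by its predecessor. For
  \<open>n = 0\<close> there is none, and the left end 0 of the time interval takes its
  place.\<close>

lemma ordered_simplex_Suc:
  assumes s: "s \<in> {..<n} \<rightarrow>\<^sub>E {0..T}" and y: "y \<in> {0..T}"
  shows "s(n := y) \<in> ordered_simplex T (Suc n) \<longleftrightarrow>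
    s \<in> ordered_simplex T n \<and> (if n = 0 then 0 else s (n - 1)) \<le> y"
proof -
  have P: "s(n := y) \<in> {..<Suc n} \<rightarrow>\<^sub>E {0..T}"
    using s y by (auto simp: PiE_iff extensional_def less_Suc_eq)
  have "mono_on {..<Suc n} (s(n := y)) \<longleftrightarrow> mono_on {..<n} s \<and> (\<forall>j<n. s j \<le> y)"
  proof (intro iffI conjI allI impI)
    assume m: "mono_on {..<Suc n} (s(n := y))"
    show "mono_on {..<n} s"
      unfolding monotone_on_def
    proof (intro ballI impI)
      fix i j assume "i \<in> {..<n}" "j \<in> {..<n}" "i \<le> j"
      then show "s i \<le> s j"
        using monotone_onD[OF m, of i j] by auto
    qed
    show "s j \<le> y" if "j < n" for j
      using monotone_onD[OF m, of j n] that by auto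
  next
    assume m: "mono_on {..<n} s \<and> (\<forall>j<n. s j \<le> y)"
    show "mono_on {..<Suc n} (s(n := y))"
      unfolding monotone_on_def
    proof (intro ballI impI)
      fix i j assume ij: "i \<in> {..<Suc n}" "j \<in> {..<Suc n}" "i \<le> j"
      show "(s(n := y)) i \<le> (s(n := y)) j"
      proof (cases "j = n")
        case True
        then show ?thesis
          using m ij by auto
      next
        case False
        then have "i \<in> {..<n}" "j \<in> {..<n}"
          using ij by auto
        then show ?thesis
          using monotone_onD[OF conjunct1[OF m], of i j] ij(3) by auto
      qed
    qed
  qed
  moreover have "(\<forall>j<n. s j \<le> y) \<longleftrightarrow> (if n = 0 then 0 else s (n - 1)) \<le> y" if "mono_on {..<n} s"
  proof (cases n)
    case (Suc m)
    have "s j \<le> s m" if "j < n" for j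
      using monotone_onD[OF \<open>mono_on {..<n} s\<close>, of j m] that Suc by auto
    moreover have "m < n"
      using Suc by simp
    ultimately have "(\<forall>j<n. s j \<le> y) \<longleftrightarrow> s m \<le> y"
      by (meson order_trans)
    then show ?thesis
      using Suc by simp
  qed (use y in simp)
  ultimately show ?thesis
    using P s unfolding ordered_simplex_def by blast
qed

context
  fixes T :: real and a :: "2 \<Rightarrow> real \<Rightarrow> real"
  assumes a: "abel_coefficients T a" and T: "T > 0"
begin

interpretation lebesgue_on_interval: finite_measure "lebesgue_on {0..T}"
  by (rule finite_measure_lebesgue_on) auto

interpretation product_sigma_finite "\<lambda>_::nat. lebesgue_on {0..T}"
  by (intro product_sigma_finite.intro lebesgue_on_interval.sigma_finite_measure_axioms)

abbreviation time_product :: "nat \<Rightarrow> (nat \<Rightarrow> real) measure" where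
  "time_product n \<equiv> Pi\<^sub>M {..<n} (\<lambda>_. lebesgue_on {0..T})"

lemma space_time_product: "space (time_product n) = {..<n} \<rightarrow>\<^sub>E {0..T}"
  by (simp add: space_PiM)

lemma finite_time_product: "finite_measure (time_product n)"
proof (rule finite_measureI)
  have "emeasure (time_product n) ({..<n} \<rightarrow>\<^sub>E {0..T}) = (\<Prod>i<n. emeasure (lebesgue_on {0..T}) {0..T})"
    by (rule emeasure_PiM) (auto simp: sets_restrict_space_iff)
  also have "\<dots> \<noteq> \<infinity>"
    using lebesgue_on_interval.emeasure_finite by (simp add: power_eq_top_ennreal)
  finally show "emeasure (time_product n) (space (time_product n)) \<noteq> \<infinity>"
    by (simp add: space_time_product)
qed

lemma measurable_coordinate:
  assumes "i < n" "h \<in> borel_measurable (lebesgue_on {0..T})"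
  shows "(\<lambda>s. h (s i)) \<in> borel_measurable (time_product n)"
  by (rule measurable_compose[OF measurable_component_singleton[of i "{..<n}" "\<lambda>_. lebesgue_on {0..T}"] assms(2)]) (use assms(1) in auto)

lemma sets_ordered_simplex: "ordered_simplex T n \<in> sets (time_product n)"
proof -
  have "{s \<in> space (time_product n). \<forall>i\<in>{..<n}. \<forall>j\<in>{..<n}. i \<le> j \<longrightarrow> s i \<le> s j} \<in> sets (time_product n)"
  proof (intro sets.sets_Collect_finite_All)
    fix i j assume ij: "i \<in> {..<n}" "j \<in> {..<n}"
    have id: "(\<lambda>t. t) \<in> borel_measurable (lebesgue_on {0..T})"
      by (intro continuous_imp_measurable_on_sets_lebesgue continuous_intros) auto
    have "{s \<in> space (time_product n). s i \<le> s j} \<in> sets (time_product n)"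
      using measurable_coordinate[OF _ id] ij by (intro borel_measurable_le) auto
    then show "{s \<in> space (time_product n). i \<le> j \<longrightarrow> s i \<le> s j} \<in> sets (time_product n)"
      by (cases "i \<le> j") auto
  qed auto
  moreover have "{s \<in> space (time_product n). \<forall>i\<in>{..<n}. \<forall>j\<in>{..<n}. i \<le> j \<longrightarrow> s i \<le> s j} = ordered_simplex T n"
    by (auto simp: ordered_simplex_def space_time_product monotone_on_def)
  ultimately show ?thesis
    by simp
qed

text \<open>The weight \<open>\<phi>\<close> on the last variable is what the induction on the order
  generalises over; \<open>\<phi> = 1\<close> gives the iterated integral itself.\<close>

definition simplex_integrand :: "nat \<Rightarrow> (nat \<Rightarrow> 2) \<Rightarrow> (real \<Rightarrow> real) \<Rightarrow> (nat \<Rightarrow> real) \<Rightarrow> real" where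
  "simplex_integrand n \<iota> \<phi> s =
     indicator (ordered_simplex T (Suc n)) s * (\<Prod>j<Suc n. a (\<iota> j) (s j)) * \<phi> (s n)"

lemma integrable_simplex_integrand:
  assumes \<phi>: "continuous_on {0..T} \<phi>"
  shows "integrable (time_product (Suc n)) (simplex_integrand n \<iota> \<phi>)"
proof -
  interpret finite_measure "time_product (Suc n)"
    by (rule finite_time_product)
  obtain B where B: "B \<ge> 1" "\<And>i t. t \<in> {0..T} \<Longrightarrow> \<bar>a i t\<bar> \<le> B"
    using abel_coefficients_bound[OF a] by metis
  have "bounded (\<phi> ` {0..T})"
    using \<phi> by (intro compact_imp_bounded compact_continuous_image) auto
  then obtain C where C: "\<And>t. t \<in> {0..T} \<Longrightarrow> \<bar>\<phi> t\<bar> \<le> C"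
    unfolding bounded_real by blast
  show ?thesis
  proof (rule integrable_const_bound)
    show "AE s in time_product (Suc n). norm (simplex_integrand n \<iota> \<phi> s) \<le> B ^ Suc n * C"
    proof (rule AE_I2)
      fix s assume "s \<in> space (time_product (Suc n))"
      then have s: "s j \<in> {0..T}" if "j < Suc n" for j
        using that by (auto simp: space_time_product PiE_iff)
      have "(\<Prod>j<Suc n. \<bar>a (\<iota> j) (s j)\<bar>) \<le> (\<Prod>j<Suc n. B)"
        using B s by (intro prod_mono) auto
      then have "\<bar>\<Prod>j<Suc n. a (\<iota> j) (s j)\<bar> \<le> B ^ Suc n"
        by (simp only: abs_prod prod_constant card_lessThan)
      then have "\<bar>\<Prod>j<Suc n. a (\<iota> j) (s j)\<bar> * \<bar>\<phi> (s n)\<bar> \<le> B ^ Suc n * C"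
        using C[OF s[of n]] B(1) by (intro mult_mono) auto
      moreover have "norm (simplex_integrand n \<iota> \<phi> s) \<le> \<bar>\<Prod>j<Suc n. a (\<iota> j) (s j)\<bar> * \<bar>\<phi> (s n)\<bar>"
        by (auto simp: simplex_integrand_def abs_mult indicator_def simp del: prod.lessThan_Suc)
      ultimately show "norm (simplex_integrand n \<iota> \<phi> s) \<le> B ^ Suc n * C"
        by linarith
    qed
    have "\<phi> \<in> borel_measurable (lebesgue_on {0..T})"
      using \<phi> by (rule continuous_imp_measurable_on_sets_lebesgue) simp
    moreover have "a i \<in> borel_measurable (lebesgue_on {0..T})" for i
      using a by (simp add: abel_coefficients_def)
    ultimately show "simplex_integrand n \<iota> \<phi> \<in> borel_measurable (time_product (Suc n))"
      unfolding simplex_integrand_def[abs_def] using sets_ordered_simplex[of "Suc n"]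
      by (intro borel_measurable_times borel_measurable_prod borel_measurable_indicator measurable_coordinate) auto
  qed
qed

text \<open>Fubini in the last variable: the indicator factors into that of the smaller simplex and
  the condition that the last time lies above its predecessor, so the inner integral runs from the
  predecessor to \<open>T\<close>.\<close>

lemma integral_simplex_integrand:
  assumes \<phi>: "continuous_on {0..T} \<phi>"
  shows "integral\<^sup>L (time_product (Suc n)) (simplex_integrand n \<iota> \<phi>) =
    (\<integral>s. indicator (ordered_simplex T n) s * (\<Prod>j<n. a (\<iota> j) (s j)) *
      integral {(if n = 0 then 0 else s (n - 1))..T} (\<lambda>y. a (\<iota> n) y * \<phi> y) \<partial>time_product n)"
proof -
  let ?lo = "\<lambda>s. if n = 0 then 0 else s (n - 1)"
  have "integral\<^sup>L (time_product (Suc n)) (simplex_integrand n \<iota> \<phi>)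
      = (\<integral>s. (\<integral>y. simplex_integrand n \<iota> \<phi> (s(n := y)) \<partial>lebesgue_on {0..T}) \<partial>time_product n)"
    using product_integral_insert[of "{..<n}" n "simplex_integrand n \<iota> \<phi>"] integrable_simplex_integrand[OF \<phi>]
    by (simp add: lessThan_Suc)
  also have "\<dots> = (\<integral>s. indicator (ordered_simplex T n) s * (\<Prod>j<n. a (\<iota> j) (s j)) *
      integral {?lo s..T} (\<lambda>y. a (\<iota> n) y * \<phi> y) \<partial>time_product n)"
  proof (rule Bochner_Integration.integral_cong[OF refl])
    fix s assume "s \<in> space (time_product n)"
    then have s: "s \<in> {..<n} \<rightarrow>\<^sub>E {0..T}"
      by (simp add: space_time_product)
    let ?c = "indicator (ordered_simplex T n) s * (\<Prod>j<n. a (\<iota> j) (s j))"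
    have lo: "?lo s \<in> {0..T}"
      using s T by (auto simp: PiE_iff)
    have "simplex_integrand n \<iota> \<phi> (s(n := y)) = ?c * (indicator {?lo s..T} y *\<^sub>R (a (\<iota> n) y * \<phi> y))"
      if "y \<in> {0..T}" for y
      using ordered_simplex_Suc[OF s that] that
      by (simp add: simplex_integrand_def indicator_def)
    then have "(\<integral>y. simplex_integrand n \<iota> \<phi> (s(n := y)) \<partial>lebesgue_on {0..T})
        = (\<integral>y. ?c * (indicator {?lo s..T} y *\<^sub>R (a (\<iota> n) y * \<phi> y)) \<partial>lebesgue_on {0..T})"
      by (intro Bochner_Integration.integral_cong) auto
    also have "\<dots> = ?c * (\<integral>y. indicator {?lo s..T} y *\<^sub>R (a (\<iota> n) y * \<phi> y) \<partial>lebesgue_on {0..T})"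
      by (rule integral_mult_right_zero)
    also have "(\<integral>y. indicator {?lo s..T} y *\<^sub>R (a (\<iota> n) y * \<phi> y) \<partial>lebesgue_on {0..T})
        = (\<integral>y. indicator {0..T} y *\<^sub>R (indicator {?lo s..T} y *\<^sub>R (a (\<iota> n) y * \<phi> y)) \<partial>lebesgue)"
      by (rule integral_restrict_space) auto
    also have "\<dots> = (LINT y:{?lo s..T}|lebesgue. a (\<iota> n) y * \<phi> y)"
      unfolding set_lebesgue_integral_def using lo
      by (intro Bochner_Integration.integral_cong) (auto simp: indicator_def)
    also have "\<dots> = integral {?lo s..T} (\<lambda>y. a (\<iota> n) y * \<phi> y)"
    proof (rule set_lebesgue_integral_eq_integral)
      show "(\<lambda>y. a (\<iota> n) y * \<phi> y) absolutely_integrable_on {?lo s..T}"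
        by (rule set_integrable_subset[OF abel_coefficients_integrable[OF a \<phi>]]) (use lo in auto)
    qed
    finally show "(\<integral>y. simplex_integrand n \<iota> \<phi> (s(n := y)) \<partial>lebesgue_on {0..T})
        = ?c * integral {?lo s..T} (\<lambda>y. a (\<iota> n) y * \<phi> y)" .
  qed
  finally show ?thesis .
qed

text \<open>Integrating out the last variable of an ordered simplex against a function \<open>f\<close> of the path gives
  again a function of the preceding point of the path, because one-forms on the tree are exact.\<close>

lemma simplex_integral_on_tree:
  fixes V :: "(real^2) set"
  assumes tree: "straight_tree V E" and sub: "abel_path a ` {0..T} \<subseteq> skeleton V E"
    and closed: "abel_path a T = 0" and f: "continuous_on (skeleton V E) f"
  shows "integral\<^sup>L (time_product (Suc n)) (simplex_integrand n \<iota> (\<lambda>t. f (abel_path a t))) = 0"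
  using f
proof (induction n arbitrary: f)
  case (0 f)
  have "abel_path a 0 = 0"
    using abel_path_integral[OF a, of 0] T by (simp add: vec_eq_iff)
  obtain g where g: "\<And>z. z \<in> skeleton V E \<Longrightarrow>
      (g has_derivative (\<lambda>h. f z * (h \<bullet> axis (\<iota> 0) 1))) (at z within skeleton V E)"
    using tree_one_form_exact[OF tree 0] by blast
  have "continuous_on {0..T} (\<lambda>t. f (abel_path a t))"
    using 0 abel_path_continuous[OF a] sub by (rule continuous_on_compose2)
  \<comment> \<open>The path starts and ends at the origin, so the two values of the primitive
    cancel.\<close>
  moreover have "integral {0..T} (\<lambda>s. a (\<iota> 0) s * f (abel_path a s)) = 0"
    using abel_path_line_integral[OF a sub 0 g, of 0] T closed \<open>abel_path a 0 = 0\<close> by simp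
  ultimately show ?case
    by (subst integral_simplex_integrand) simp_all
next
  case (Suc n f)
  obtain g where g: "\<And>z. z \<in> skeleton V E \<Longrightarrow>
      (g has_derivative (\<lambda>h. f z * (h \<bullet> axis (\<iota> (Suc n)) 1))) (at z within skeleton V E)"
    using tree_one_form_exact[OF tree Suc.prems] by blast
  \<comment> \<open>The next weight: integrating from the preceding time to \<open>T\<close> yields
    the value of \<open>g\<close> at the end of the path, which is the origin, minus its value at
    the preceding position.\<close>
  then have "continuous_on (skeleton V E) (\<lambda>z. g 0 - g z)"
    by (intro continuous_intros has_derivative_continuous_on)
  note IH = Suc.IH[OF this]
  have "continuous_on {0..T} (\<lambda>t. f (abel_path a t))"
    using Suc.prems abel_path_continuous[OF a] sub by (rule continuous_on_compose2)
  then have "integral\<^sup>L (time_product (Suc (Suc n))) (simplex_integrand (Suc n) \<iota> (\<lambda>t. f (abel_path a t)))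
    = (\<integral>s. indicator (ordered_simplex T (Suc n)) s * (\<Prod>j<Suc n. a (\<iota> j) (s j)) *
        integral {s n..T} (\<lambda>y. a (\<iota> (Suc n)) y * f (abel_path a y)) \<partial>time_product (Suc n))"
    by (subst integral_simplex_integrand) simp_all
  also have "\<dots> = (\<integral>s. simplex_integrand n \<iota> (\<lambda>t. g 0 - g (abel_path a t)) s \<partial>time_product (Suc n))"
  proof (rule Bochner_Integration.integral_cong[OF refl])
    fix s assume "s \<in> space (time_product (Suc n))"
    then have "s n \<in> {0..T}"
      by (auto simp: space_time_product PiE_iff)
    from abel_path_line_integral[OF a sub Suc.prems g this] closed
    show "indicator (ordered_simplex T (Suc n)) s * (\<Prod>j<Suc n. a (\<iota> j) (s j)) *
        integral {s n..T} (\<lambda>y. a (\<iota> (Suc n)) y * f (abel_path a y))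
      = simplex_integrand n \<iota> (\<lambda>t. g 0 - g (abel_path a t)) s"
      by (simp add: simplex_integrand_def)
  qed
  also have "\<dots> = 0"
    by (rule IH)
  finally show ?case .
qed

lemma iterated_integral_on_tree:
  fixes V :: "(real^2) set"
  assumes "straight_tree V E" "abel_path a ` {0..T} \<subseteq> skeleton V E" "abel_path a T = 0" "w \<noteq> []"
  shows "iterated_integral T a w = 0"
proof -
  obtain n where n: "length w = Suc n"
    using assms(4) by (cases w) auto
  have "iterated_integral T a w = integral\<^sup>L (time_product (Suc n)) (simplex_integrand n (\<lambda>j. w ! j) (\<lambda>_. 1))"
    unfolding iterated_integral_def set_lebesgue_integral_def n simplex_integrand_def[abs_def] by simp
  also have "\<dots> = 0"
    using simplex_integral_on_tree[OF assms(1-3), of "\<lambda>_. 1" n "\<lambda>j. w ! j"] by simp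
  finally show ?thesis .
qed

end

text \<open>For the vanishing of the iterated integrals, the center serves only to close the path;
  the rest is due to the tree.\<close>

lemma straight_tree_universal:
  fixes V :: "(real^2) set"
  assumes "T > 0" "straight_tree V E" "abel_coefficients T a" "abel_path a ` {0..T} \<subseteq> skeleton V E" "abel_center T a"
  shows "universal_center T a"
  unfolding universal_center_def
  using assms(5) iterated_integral_on_tree[OF assms(3,1,2,4) abel_center_path_closed[OF assms(3,1,5)]] by simp

section \<open>Attaching hairs\<close>

text \<open>The unit circle is connected with more than one point, hence infinite.\<close>

lemma unit_vector_avoiding_finite:
  assumes "finite U"
  obtains u :: "real^2" where "norm u = 1" "u \<notin> U"
proof -
  have "axis 1 1 \<in> sphere (0::real^2) 1" "axis 2 1 \<in> sphere (0::real^2) 1" "axis 1 1 \<noteq> (axis 2 1 :: real^2)"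
    by (auto simp: axis_eq_axis)
  then have "\<not> (sphere (0::real^2) 1 = {} \<or> (\<exists>a. sphere (0::real^2) 1 = {a}))"
    by (metis empty_iff singletonD)
  then have "infinite (sphere (0::real^2) 1)"
    using connected_finite_iff_sing[OF connected_sphere[of "0::real^2" 1]] by simp
  then have "\<not> sphere 0 1 \<subseteq> U"
    using assms finite_subset by blast
  then obtain u :: "real^2" where "u \<in> sphere 0 1" "u \<notin> U"
    by blast
  then show ?thesis
    using that[of u] by simp
qed

lemma closed_segment_ray:
  fixes v :: "'a::real_normed_vector"
  assumes "y \<in> closed_segment v (v + h *\<^sub>R u)" "0 < h" "norm u = 1"
  obtains s where "0 \<le> s" "s \<le> h" "y = v + s *\<^sub>R u" "dist v y = s"
proof -
  obtain t where t: "0 \<le> t" "t \<le> 1" "y = (1 - t) *\<^sub>R v + t *\<^sub>R (v + h *\<^sub>R u)"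
    using assms(1) unfolding closed_segment_def by blast
  then have "y = v + (t * h) *\<^sub>R u"
    by (simp add: algebra_simps)
  then show ?thesis
    using that[of "t * h"] t(1,2) assms(2,3) by (simp add: dist_norm mult_left_le_one_le)
qed

lemma unit_scaleR_eq:
  fixes u w :: "'a::real_normed_vector"
  assumes "s *\<^sub>R u = t *\<^sub>R w" "norm u = 1" "norm w = 1" "0 \<le> s" "0 < t"
  shows "u = w"
proof -
  have "s = t"
    using arg_cong[OF assms(1), of norm] assms(2-5) by simp
  then show ?thesis
    using assms(1,5) by simp
qed

text \<open>\<open>U\<close> collects the blocked directions at \<open>v\<close>; in every other
  direction a segment of length \<open>h\<close> can be attached. Any finite exceptional set is
  allowed, so the condition can be renewed after each hair.\<close>

definition hair_room :: "(real^2) set \<Rightarrow> real^2 \<Rightarrow> real \<Rightarrow> (real^2) set \<Rightarrow> bool" where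
  "hair_room P v h U \<longleftrightarrow> finite U \<and>
     (\<forall>u. norm u = 1 \<longrightarrow> u \<notin> U \<longrightarrow> closed_segment v (v + h *\<^sub>R u) \<inter> P = {v})"

text \<open>The blocked directions are those of the edges at \<open>v\<close>, and within the cone
  around \<open>v\<close> different rays meet only in \<open>v\<close>. One \<open>U\<close> serves
  every length below \<open>r\<close>, so the length can be fixed afterwards.\<close>

lemma ex_hair_room:
  assumes G: "straight_graph V E" and v: "v \<in> V"
  obtains r U where "r > 0" "\<And>h. 0 < h \<Longrightarrow> h < r \<Longrightarrow> hair_room (skeleton V E) v h U"
proof -
  obtain r U where U: "r > 0" "finite U" "\<And>u. u \<in> U \<Longrightarrow> norm u = 1"
    "skeleton V E \<inter> ball v r = insert v (\<Union>u\<in>U. (\<lambda>s. v + s *\<^sub>R u) ` {0<..<r})"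
    by (rule vertex_cone[OF G v], rule that) auto
  have "closed_segment v (v + h *\<^sub>R u) \<inter> skeleton V E = {v}"
    if h: "0 < h" "h < r" and u: "norm u = 1" "u \<notin> U" for h u
  proof -
    have "y = v" if y: "y \<in> closed_segment v (v + h *\<^sub>R u)" "y \<in> skeleton V E" for y
    proof (rule ccontr)
      assume "y \<noteq> v"
      obtain s where s: "0 \<le> s" "s \<le> h" "y = v + s *\<^sub>R u" "dist v y = s"
        using closed_segment_ray[OF y(1) h(1) u(1)] .
      then have "y \<in> skeleton V E \<inter> ball v r"
        using y(2) h(2) by simp
      then obtain w t where w: "w \<in> U" "0 < t" "y = v + t *\<^sub>R w"
        unfolding U(4) using \<open>y \<noteq> v\<close> by auto
      then have "u = w"
        using s(1,3) u(1) U(3) by (intro unit_scaleR_eq[of s u t w]) auto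
      then show False
        using u(2) w(1) by simp
    qed
    moreover have "v \<in> skeleton V E"
      using v by (simp add: skeleton_def)
    ultimately show ?thesis
      by auto
  qed
  then show ?thesis
    using that[of r U] U(1,2) by (simp add: hair_room_def)
qed

lemma closed_segment_subset_cball:
  fixes v :: "'a::real_normed_vector"
  assumes "0 < h" "norm u = 1"
  shows "closed_segment v (v + h *\<^sub>R u) \<subseteq> cball v h"
proof
  fix y assume "y \<in> closed_segment v (v + h *\<^sub>R u)"
  then obtain s where "s \<le> h" "dist v y = s"
    using closed_segment_ray[OF _ assms] by blast
  then show "y \<in> cball v h"
    by simp
qed

text \<open>A hair blocks just one further direction, so the room at \<open>v\<close> persists with
  the same \<open>h\<close> and the step can be repeated.\<close>

lemma straight_tree_hair:
  assumes T: "straight_tree V E" and v: "v \<in> V" and h: "h > 0" and room: "hair_room (skeleton V E) v h U"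
  obtains u where "norm u = 1" "straight_tree (insert (v + h *\<^sub>R u) V) (insert (v, v + h *\<^sub>R u) E)"
    "v + h *\<^sub>R u \<notin> V"
    "skeleton (insert (v + h *\<^sub>R u) V) (insert (v, v + h *\<^sub>R u) E) = skeleton V E \<union> closed_segment v (v + h *\<^sub>R u)"
    "total_length (insert (v, v + h *\<^sub>R u) E) = total_length E + h"
    "hair_room (skeleton V E \<union> closed_segment v (v + h *\<^sub>R u)) v h (insert u U)"
proof -
  obtain u :: "real^2" where u: "norm u = 1" "u \<notin> U"
    using unit_vector_avoiding_finite[of U] room by (auto simp: hair_room_def)
  let ?q = "v + h *\<^sub>R u"
  have "u \<noteq> 0"
    using u(1) by auto
  then have q: "?q \<noteq> v"
    using h by simp
  have seg: "closed_segment v ?q \<inter> skeleton V E = {v}"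
    using room u by (simp add: hair_room_def)
  have "?q \<notin> skeleton V E"
    using seg q by (metis IntI ends_in_segment(2) singletonD)
  then have qV: "?q \<notin> V"
    by (auto simp: skeleton_def)
  have "closed_segment v (v + h *\<^sub>R w) \<inter> (skeleton V E \<union> closed_segment v ?q) = {v}"
    if w: "norm w = 1" "w \<notin> insert u U" for w
  proof -
    have "y = v" if y: "y \<in> closed_segment v (v + h *\<^sub>R w)" "y \<in> closed_segment v ?q" for y
    proof (rule ccontr)
      assume "y \<noteq> v"
      obtain s where s: "0 \<le> s" "y = v + s *\<^sub>R w"
        using closed_segment_ray[OF y(1) h w(1)] by metis
      obtain t where t: "0 \<le> t" "y = v + t *\<^sub>R u"
        using closed_segment_ray[OF y(2) h u(1)] by metis
      have "0 < t"
        using t \<open>y \<noteq> v\<close> by (cases "t = 0") auto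
      then have "w = u"
        using s t w(1) u(1) by (intro unit_scaleR_eq[of s w t u]) auto
      then show False
        using w(2) by simp
    qed
    moreover have "closed_segment v (v + h *\<^sub>R w) \<inter> skeleton V E = {v}"
      using room w by (simp add: hair_room_def)
    ultimately show ?thesis
      by auto
  qed
  then have room': "hair_room (skeleton V E \<union> closed_segment v ?q) v h (insert u U)"
    using room by (simp add: hair_room_def)
  have "total_length (insert (v, ?q) E) = total_length E + dist v ?q"
    by (rule total_length_attach[OF straight_tree_graph[OF T] qV])
  then have len: "total_length (insert (v, ?q) E) = total_length E + h"
    using u(1) h by (simp add: dist_norm)
  show ?thesis
    by (rule that[OF u(1) straight_tree.attach[OF T v q seg] qV skeleton_attach[OF v] len room'])
qed

lemma straight_tree_many_hairs:
  assumes "straight_tree V E" "v \<in> V" "h > 0" "hair_room (skeleton V E) v h U"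
  shows "\<exists>V' E'. straight_tree V' E' \<and> skeleton V E \<subseteq> skeleton V' E' \<and>
    skeleton V' E' \<subseteq> skeleton V E \<union> cball v h \<and> total_length E' = total_length E + real n * h"
  using assms
proof (induction n arbitrary: V E U)
  case 0
  then show ?case
    by (intro exI[of _ V] exI[of _ E]) auto
next
  case (Suc n V E U)
  obtain u where u: "norm u = 1" "straight_tree (insert (v + h *\<^sub>R u) V) (insert (v, v + h *\<^sub>R u) E)"
    "skeleton (insert (v + h *\<^sub>R u) V) (insert (v, v + h *\<^sub>R u) E) = skeleton V E \<union> closed_segment v (v + h *\<^sub>R u)"
    "total_length (insert (v, v + h *\<^sub>R u) E) = total_length E + h"
    "hair_room (skeleton V E \<union> closed_segment v (v + h *\<^sub>R u)) v h (insert u U)"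
    by (rule straight_tree_hair[OF Suc.prems])
  have "v \<in> insert (v + h *\<^sub>R u) V"
    using Suc.prems(2) by simp
  from Suc.IH[OF u(2) this Suc.prems(3), unfolded u(3), OF u(5)] obtain V' E' where IH:
    "straight_tree V' E'" "skeleton V E \<union> closed_segment v (v + h *\<^sub>R u) \<subseteq> skeleton V' E'"
    "skeleton V' E' \<subseteq> (skeleton V E \<union> closed_segment v (v + h *\<^sub>R u)) \<union> cball v h"
    "total_length E' = total_length (insert (v, v + h *\<^sub>R u) E) + real n * h"
    by (elim exE conjE)
  show ?case
  proof (intro exI conjI)
    show "skeleton V' E' \<subseteq> skeleton V E \<union> cball v h"
      using IH(3) closed_segment_subset_cball[OF Suc.prems(3) u(1), of v] by blast
    show "total_length E' = total_length E + real (Suc n) * h"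
      unfolding IH(4) u(4) by (simp add: algebra_simps)
    show "skeleton V E \<subseteq> skeleton V' E'"
      using IH(2) by simp
  qed (rule IH(1))
qed

text \<open>The missing length need not be small, so it is divided among \<open>n\<close> hairs of
  length \<open>l / n\<close> at the origin, with \<open>n\<close> large enough for them to fit into
  the available room and into the ball of radius \<open>\<epsilon>\<close>.\<close>

lemma straight_tree_lengthen:
  fixes V :: "(real^2) set"
  assumes T: "straight_tree V E" and "\<epsilon> > 0" "l \<ge> 0"
  obtains V' E' where "straight_tree V' E'" "skeleton V E \<subseteq> skeleton V' E'"
    "skeleton V' E' \<subseteq> skeleton V E \<union> cball 0 \<epsilon>" "total_length E' = total_length E + l"
proof (cases "l = 0")
  case True
  then show ?thesis
    using that[OF T] by auto
next
  case False
  then have "l > 0"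
    using assms by simp
  obtain r U where r: "r > 0" "\<And>h. 0 < h \<Longrightarrow> h < r \<Longrightarrow> hair_room (skeleton V E) 0 h U"
    by (rule ex_hair_room[OF straight_tree_graph[OF T] straight_tree_root[OF T]], rule that) auto
  define m where "m = min r \<epsilon>"
  have "m > 0"
    using r(1) \<open>\<epsilon> > 0\<close> by (simp add: m_def)
  obtain n :: nat where "l / m < real n"
    using reals_Archimedean2 by blast
  moreover have "0 < l / m"
    using \<open>l > 0\<close> \<open>m > 0\<close> by simp
  ultimately have n: "0 < real n" "l < real n * m"
    using \<open>m > 0\<close> by (linarith, simp add: pos_divide_less_eq)
  then have "l / real n < m"
    by (simp add: pos_divide_less_eq mult.commute)
  define h where "h = l / real n"
  have h: "0 < h" "h < r" "h < \<epsilon>" "real n * h = l"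
    using n \<open>l / real n < m\<close> \<open>l > 0\<close> by (auto simp: h_def m_def)
  from straight_tree_many_hairs[OF T straight_tree_root[OF T] h(1) r(2)[OF h(1,2)], of n] obtain V' E' where
    "straight_tree V' E'" "skeleton V E \<subseteq> skeleton V' E'"
    "skeleton V' E' \<subseteq> skeleton V E \<union> cball 0 h" "total_length E' = total_length E + real n * h"
    by (elim exE conjE)
  moreover have "cball 0 h \<subseteq> cball (0::real^2) \<epsilon>"
    using h(3) by auto
  ultimately show ?thesis
    using that[of V' E'] h(4) by auto
qed

section \<open>Removing vertices of degree two\<close>

definition degree_two_vertices :: "'a set \<Rightarrow> ('a \<times> 'a) set \<Rightarrow> 'a set" where
  "degree_two_vertices V E = {v \<in> V. card (incident E v) = 2}"

text \<open>The hair raises the degree of \<open>v\<close> to three, its tip has degree one, and all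
  other degrees are unchanged; so exactly one bad vertex disappears and none is created.\<close>

lemma degree_two_vertices_hair:
  assumes G: "straight_graph V E" and v: "v \<in> degree_two_vertices V E" and q: "q \<notin> V"
  shows "degree_two_vertices (insert q V) (insert (v, q) E) = degree_two_vertices V E - {v}"
proof -
  note D = straight_graphD[OF G]
  have v': "v \<in> V" "card (incident E v) = 2"
    using v by (auto simp: degree_two_vertices_def)
  then have "v \<noteq> q"
    using q by auto
  have qE: "q \<noteq> fst e" "q \<noteq> snd e" if "e \<in> E" for e
    using D(3,4)[OF that] q by auto
  have "incident (insert (v, q) E) q = {(v, q)}"
    using qE by (auto simp: incident_def)
  moreover have "incident (insert (v, q) E) v = insert (v, q) (incident E v)"
    by (auto simp: incident_def)
  moreover have "(v, q) \<notin> incident E v" "finite (incident E v)"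
    using qE(2)[of "(v, q)"] D(2) by (auto simp: incident_def)
  moreover have "incident (insert (v, q) E) w = incident E w" if "w \<noteq> v" "w \<noteq> q" for w
    using that by (auto simp: incident_def)
  ultimately have "card (incident (insert (v, q) E) w) = 2 \<longleftrightarrow> w \<noteq> v \<and> w \<noteq> q \<and> card (incident E w) = 2"
    for w
    using v'(2) by (cases "w = q"; cases "w = v") auto
  then show ?thesis
    using q by (auto simp: degree_two_vertices_def)
qed

text \<open>Induction on the number of bad vertices. The room available changes from vertex to
  vertex and from tree to tree, so only the upper bound \<open>\<delta>\<close> on the hair lengths
  is common.\<close>

lemma straight_tree_remove_degree_two:
  fixes V :: "(real^2) set"
  assumes "straight_tree V E" "\<delta> > 0"
  shows "\<exists>V' E'. straight_tree V' E' \<and> skeleton V E \<subseteq> skeleton V' E' \<and>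
    skeleton V' E' \<subseteq> skeleton V E \<union> (\<Union>v\<in>degree_two_vertices V E. cball v \<delta>) \<and>
    total_length E \<le> total_length E' \<and>
    total_length E' \<le> total_length E + real (card (degree_two_vertices V E)) * \<delta> \<and>
    degree_two_vertices V' E' = {}"
  using assms(1)
proof (induction "card (degree_two_vertices V E)" arbitrary: V E)
  case 0
  have "finite (degree_two_vertices V E)"
    using straight_graphD(1)[OF straight_tree_graph[OF 0(2)]] by (simp add: degree_two_vertices_def)
  then have "degree_two_vertices V E = {}"
    using 0(1) by simp
  then show ?case
    using 0(2) by (intro exI[of _ V] exI[of _ E]) simp
next
  case (Suc n V E)
  note G = straight_tree_graph[OF Suc.prems]
  obtain v where v: "v \<in> degree_two_vertices V E"
    using Suc.hyps(2) by (metis card.empty equals0I nat.distinct(1))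
  then have vV: "v \<in> V"
    by (simp add: degree_two_vertices_def)
  obtain r U where r: "r > 0" "\<And>h. 0 < h \<Longrightarrow> h < r \<Longrightarrow> hair_room (skeleton V E) v h U"
    by (rule ex_hair_room[OF G vV], rule that) auto
  define h where "h = min (r / 2) \<delta>"
  have h: "0 < h" "h < r" "h \<le> \<delta>"
    using r(1) \<open>\<delta> > 0\<close> by (auto simp: h_def)
  obtain u where u: "norm u = 1" "straight_tree (insert (v + h *\<^sub>R u) V) (insert (v, v + h *\<^sub>R u) E)"
    "v + h *\<^sub>R u \<notin> V"
    "skeleton (insert (v + h *\<^sub>R u) V) (insert (v, v + h *\<^sub>R u) E) = skeleton V E \<union> closed_segment v (v + h *\<^sub>R u)"
    "total_length (insert (v, v + h *\<^sub>R u) E) = total_length E + h"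
    by (rule straight_tree_hair[OF Suc.prems vV h(1) r(2)[OF h(1,2)]])
  note bad = degree_two_vertices_hair[OF G v u(3)]
  have "n = card (degree_two_vertices V E - {v})"
    using Suc.hyps(2) v by (simp add: card_Diff_singleton)
  from Suc.hyps(1)[OF _ u(2), unfolded bad u(4,5), OF this] obtain V' E' where IH:
    "straight_tree V' E'" "skeleton V E \<union> closed_segment v (v + h *\<^sub>R u) \<subseteq> skeleton V' E'"
    "skeleton V' E' \<subseteq> skeleton V E \<union> closed_segment v (v + h *\<^sub>R u) \<union> (\<Union>v\<in>degree_two_vertices V E - {v}. cball v \<delta>)"
    "total_length E + h \<le> total_length E'"
    "total_length E' \<le> total_length E + h + real (card (degree_two_vertices V E - {v})) * \<delta>"
    "degree_two_vertices V' E' = {}"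
    by (elim exE conjE)
  have "closed_segment v (v + h *\<^sub>R u) \<subseteq> cball v \<delta>"
    using closed_segment_subset_cball[OF h(1) u(1), of v] h(3) by (meson subset_cball order_trans)
  then have sub: "skeleton V' E' \<subseteq> skeleton V E \<union> (\<Union>v\<in>degree_two_vertices V E. cball v \<delta>)"
    using IH(3) v by blast
  have "total_length E' \<le> total_length E + \<delta> + real n * \<delta>"
    using IH(5) h(3) \<open>n = card (degree_two_vertices V E - {v})\<close> by simp
  then have len: "total_length E' \<le> total_length E + real (card (degree_two_vertices V E)) * \<delta>"
    unfolding Suc.hyps(2)[symmetric] by (simp add: algebra_simps)
  show ?case
    using IH(1,2,4,6) sub len h(1) by (intro exI[of _ V'] exI[of _ E'] conjI) auto
qed

text \<open>Degrees are repaired last, because the lengthening hairs alter the degree of the origin.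
  The repair hairs add at most \<open>\<epsilon>\<close> to a length that may already exceed
  \<open>H\<close> by \<open>\<epsilon>\<close>.\<close>

lemma straight_tree_adjust:
  fixes V :: "(real^2) set"
  assumes T: "straight_tree V E" and "\<epsilon> > 0" and H: "total_length E \<le> H + \<epsilon>"
  obtains V' E' where "straight_tree V' E'" "skeleton V E \<subseteq> skeleton V' E'"
    "\<And>y. y \<in> skeleton V' E' \<Longrightarrow> \<exists>x\<in>skeleton V E. dist x y \<le> 2 * \<epsilon>"
    "\<bar>total_length E' - H\<bar> \<le> 2 * \<epsilon>" "\<And>v. v \<in> V' \<Longrightarrow> card (incident E' v) \<noteq> 2"
proof -
  \<comment> \<open>A tree that is too long already is left as it is: its excess is at most
    \<open>\<epsilon>\<close>.\<close>
  obtain V1 E1 where 1: "straight_tree V1 E1" "skeleton V E \<subseteq> skeleton V1 E1"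
    "skeleton V1 E1 \<subseteq> skeleton V E \<union> cball 0 \<epsilon>" "total_length E1 = total_length E + max 0 (H - total_length E)"
    by (rule straight_tree_lengthen[OF T \<open>\<epsilon> > 0\<close>, of "max 0 (H - total_length E)"]) (simp, rule that)
  define n where "n = card (degree_two_vertices V1 E1)"
  \<comment> \<open>All repair hairs together are to cost at most \<open>\<epsilon>\<close>; the
    added 1 covers \<open>n = 0\<close>.\<close>
  define \<delta> where "\<delta> = \<epsilon> / (real n + 1)"
  have \<delta>: "0 < \<delta>" "real n * \<delta> \<le> \<epsilon>" "\<delta> \<le> \<epsilon>"
    using \<open>\<epsilon> > 0\<close> by (auto simp: \<delta>_def field_simps)
  from straight_tree_remove_degree_two[OF 1(1) \<delta>(1)] obtain V' E' where 2: "straight_tree V' E'"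
    "skeleton V1 E1 \<subseteq> skeleton V' E'"
    "skeleton V' E' \<subseteq> skeleton V1 E1 \<union> (\<Union>v\<in>degree_two_vertices V1 E1. cball v \<delta>)"
    "total_length E1 \<le> total_length E'" "total_length E' \<le> total_length E1 + real n * \<delta>"
    "degree_two_vertices V' E' = {}"
    unfolding n_def by (elim exE conjE)
  have near1: "\<exists>x\<in>skeleton V E. dist x y \<le> \<epsilon>" if "y \<in> skeleton V1 E1" for y
  proof (cases "y \<in> skeleton V E")
    case True
    then show ?thesis
      using \<open>\<epsilon> > 0\<close> by (intro bexI[of _ y]) auto
  next
    case False
    then have "dist 0 y \<le> \<epsilon>"
      using 1(3) that by auto
    moreover have "0 \<in> skeleton V E"
      using straight_tree_root[OF T] by (simp add: skeleton_def)
    ultimately show ?thesis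
      by blast
  qed
  have near: "\<exists>x\<in>skeleton V E. dist x y \<le> 2 * \<epsilon>" if y: "y \<in> skeleton V' E'" for y
  proof -
    obtain z where z: "z \<in> skeleton V1 E1" "dist z y \<le> \<epsilon>"
    proof (cases "y \<in> skeleton V1 E1")
      case True
      then show ?thesis
        using that[of y] \<open>\<epsilon> > 0\<close> by simp
    next
      case False
      then obtain v where "v \<in> degree_two_vertices V1 E1" "dist v y \<le> \<delta>"
        using 2(3) y by auto
      then show ?thesis
        using that[of v] \<delta>(3) by (auto simp: degree_two_vertices_def skeleton_def)
    qed
    obtain x where "x \<in> skeleton V E" "dist x z \<le> \<epsilon>"
      using near1[OF z(1)] by blast
    then show ?thesis
      using z(2) dist_triangle[of x y z] by (intro bexI[of _ x]) auto
  qed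
  have deg: "card (incident E' v) \<noteq> 2" if "v \<in> V'" for v
    using 2(6) that by (auto simp: degree_two_vertices_def)
  have "\<bar>total_length E' - H\<bar> \<le> 2 * \<epsilon>"
    using 1(4) 2(4,5) \<delta>(2) H \<open>\<epsilon> > 0\<close> by (auto simp: max_def split: if_splits)
  then show ?thesis
    using that[OF 2(1) _ near _ deg] 1(2) 2(2) by blast
qed

section \<open>Approximation of triangulable curves by trees\<close>

text \<open>A connected set with more than one point has no isolated points, so removing finitely
  many points loses nothing after closure. This turns a triangulable curve into the union of the
  closures of its arcs.\<close>

lemma connected_subset_closure_Diff_finite:
  fixes \<Gamma> :: "'a::metric_space set"
  assumes "connected \<Gamma>" "\<And>x. \<Gamma> \<noteq> {x}" "finite S"
  shows "\<Gamma> \<subseteq> closure (\<Gamma> - S)"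
proof
  fix x assume x: "x \<in> \<Gamma>"
  then have "x islimpt \<Gamma>"
    using assms by (intro connected_imp_perfect) auto
  then have "x islimpt ((\<Gamma> - S) \<union> (\<Gamma> \<inter> S))"
    by (simp add: Un_Diff_Int)
  then have "x islimpt (\<Gamma> - S)"
    using assms(3) islimpt_finite[of "\<Gamma> \<inter> S" x] by (auto simp: islimpt_Un)
  then show "x \<in> closure (\<Gamma> - S)"
    by (simp add: closure_def)
qed

lemma sum_Un_le:
  fixes f :: "'a \<Rightarrow> real"
  assumes "finite A" "finite B" "\<And>x. 0 \<le> f x"
  shows "sum f (A \<union> B) \<le> sum f A + sum f B"
  using sum.union_inter[OF assms(1,2), of f] sum_nonneg[of "A \<inter> B" f] assms(3) by simp

text \<open>A subarc has measure at least its chord, but neighbouring subarcs share an end.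
  Shrinking each parameter interval by \<open>\<eta>\<close> at both ends makes the subarcs disjoint
  and compact, by injectivity and disjointness of the arcs; the Lipschitz bound charges
  \<open>2 * L * \<eta>\<close> per chord, which vanishes as \<open>\<eta>\<close> tends to
  0.\<close>

lemma chord_sum_le_hausdorff1:
  fixes h :: "nat \<Rightarrow> real \<Rightarrow> 'a::euclidean_space"
  assumes inj: "\<And>i. i < k \<Longrightarrow> inj_on (h i) {0<..<1}"
    and lip: "\<And>i. i < k \<Longrightarrow> L-lipschitz_on {0<..<1} (h i)"
    and disj: "disjoint_family_on (\<lambda>i. h i ` {0<..<1}) {..<k}"
    and sub: "\<And>i. i < k \<Longrightarrow> h i ` {0<..<1} \<subseteq> \<Gamma>"
    and H: "hausdorff1 \<Gamma> = ennreal H" "0 \<le> H" and m: "0 < m"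
  shows "(\<Sum>(i, j)\<in>{..<k} \<times> {1..<m - 1}. dist (h i (real j / m)) (h i (real (Suc j) / m))) \<le> H"
proof -
  \<comment> \<open>Both \<open>j\<close> and \<open>Suc j\<close> stay between \<open>1\<close> and
    \<open>m - 1\<close>: the arcs live on the open interval, so the two outermost cells have no
    chord.\<close>
  let ?I = "{..<k} \<times> {1..<m - 1}"
  define C where "C = 2 * L * real (card ?I)"
  have shrink: "(\<Sum>(i, j)\<in>?I. dist (h i (real j / m)) (h i (real (Suc j) / m))) \<le> H + C * \<eta>"
    if \<eta>: "0 < \<eta>" "\<eta> < 1 / (2 * m)" for \<eta>
  proof -
    define l where "l j = real j / m + \<eta>" for j
    define u where "u j = real (Suc j) / m - \<eta>" for j
    have mid: "1 / m - 2 * \<eta> > 0"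
      using \<eta> m by (simp add: field_simps)
    have lu: "l j \<le> u j" for j
      using mid by (simp add: l_def u_def add_divide_distrib)
    have ul: "u j < l j'" if "j < j'" for j j'
    proof -
      have "real (Suc j) / m \<le> real j' / m"
        using that by (intro divide_right_mono) auto
      then show ?thesis
        using \<eta>(1) by (simp add: l_def u_def)
    qed
    have end01: "real j / m \<in> {0<..<1}" "real (Suc j) / m \<in> {0<..<1}" if "j \<in> {1..<m - 1}" for j
      using that m by (auto simp: field_simps)
    have lu01: "{l j..u j} \<subseteq> {0<..<1}" if "j \<in> {1..<m - 1}" for j
      using end01[OF that] \<eta>(1) by (auto simp: l_def u_def)
    define K where "K = (\<lambda>(i, j). h i ` {l j..u j})"
    have Ksub: "K (i, j) \<subseteq> h i ` {0<..<1}" if "(i, j) \<in> ?I" for i j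
      using lu01[of j] that by (auto simp: K_def)
    have cont: "continuous_on {l j..u j} (h i)" if "(i, j) \<in> ?I" for i j
      using lipschitz_on_continuous_on[OF lip, of i] lu01[of j] that by (auto intro: continuous_on_subset)
    have Kdisj: "K (i, j) \<inter> K (i', j') = {}" if I: "(i, j) \<in> ?I" "(i', j') \<in> ?I" and ne: "(i, j) \<noteq> (i', j')" for i j i' j'
    proof (cases "i = i'")
      case False
      then have "h i ` {0<..<1} \<inter> h i' ` {0<..<1} = {}"
        using disj I by (auto simp: disjoint_family_on_def)
      then show ?thesis
        using Ksub[OF I(1)] Ksub[OF I(2)] by blast
    next
      case True
      have "{l j..u j} \<inter> {l j'..u j'} = {}"
        using ul[of j j'] ul[of j' j] ne True by (cases "j < j'") auto
      then have "h i ` {l j..u j} \<inter> h i ` {l j'..u j'} = {}"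
        using inj_on_image_Int[OF inj, of i "{l j..u j}" "{l j'..u j'}"] lu01 I by simp
      then show ?thesis
        using True by (simp add: K_def)
    qed
    have "(\<Sum>p\<in>?I. ennreal (case p of (i, j) \<Rightarrow> dist (h i (l j)) (h i (u j)))) \<le> (\<Sum>p\<in>?I. hausdorff1 (K p))"
    proof (rule sum_mono)
      fix p assume "p \<in> ?I"
      then obtain i j where ij: "p = (i, j)" "i \<in> {..<k}" "j \<in> {1..<m - 1}"
        by blast
      then have "connected (h i ` {l j..u j})"
        using cont by (intro connected_continuous_image) auto
      then have "ennreal (dist (h i (l j)) (h i (u j))) \<le> hausdorff1 (h i ` {l j..u j})"
        using lu by (intro hausdorff1_connected_ge) auto
      then show "ennreal (case p of (i, j) \<Rightarrow> dist (h i (l j)) (h i (u j))) \<le> hausdorff1 (K p)"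
        by (simp add: K_def ij(1))
    qed
    also have "\<dots> \<le> hausdorff1 (\<Union>p\<in>?I. K p)"
    proof (rule hausdorff1_disjoint_compact_Union)
      show "compact (K p)" if "p \<in> ?I" for p
        using that cont by (cases p) (auto simp: K_def intro!: compact_continuous_image)
      show "disjoint_family_on K ?I"
        unfolding disjoint_family_on_def
      proof (intro ballI impI)
        fix p q assume "p \<in> ?I" "q \<in> ?I" "p \<noteq> q"
        then show "K p \<inter> K q = {}"
          using Kdisj[of "fst p" "snd p" "fst q" "snd q"] by simp
      qed
    qed auto
    also have "\<dots> \<le> hausdorff1 \<Gamma>"
      using Ksub sub by (intro hausdorff1_mono) fastforce
    finally have "ennreal (\<Sum>p\<in>?I. case p of (i, j) \<Rightarrow> dist (h i (l j)) (h i (u j))) \<le> ennreal H"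
      unfolding H(1) by (subst (asm) sum_ennreal) auto
    then have 1: "(\<Sum>(i, j)\<in>?I. dist (h i (l j)) (h i (u j))) \<le> H"
      using H(2) by (simp add: ennreal_le_iff)
    have "(\<Sum>(i, j)\<in>?I. dist (h i (real j / m)) (h i (real (Suc j) / m)))
        \<le> (\<Sum>(i, j)\<in>?I. dist (h i (l j)) (h i (u j)) + 2 * L * \<eta>)"
    proof (rule sum_mono)
      fix p assume "p \<in> ?I"
      then obtain i j where p: "p = (i, j)" and ij: "i \<in> {..<k}" "j \<in> {1..<m - 1}"
        by blast
      have in01: "l j \<in> {0<..<1}" "u j \<in> {0<..<1}"
        using lu01[OF ij(2)] lu[of j] by auto
      have "dist (h i (real j / m)) (h i (l j)) \<le> L * dist (real j / m) (l j)"
        using lip[of i] ij in01 end01[OF ij(2)] by (intro lipschitz_onD) auto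
      moreover have "dist (h i (u j)) (h i (real (Suc j) / m)) \<le> L * dist (u j) (real (Suc j) / m)"
        using lip[of i] ij in01 end01[OF ij(2)] by (intro lipschitz_onD) auto
      moreover have "dist (real j / m) (l j) = \<eta>" "dist (u j) (real (Suc j) / m) = \<eta>"
        using \<eta>(1) by (auto simp: l_def u_def dist_real_def)
      ultimately show "(case p of (i, j) \<Rightarrow> dist (h i (real j / m)) (h i (real (Suc j) / m)))
          \<le> (case p of (i, j) \<Rightarrow> dist (h i (l j)) (h i (u j)) + 2 * L * \<eta>)"
        unfolding p prod.case using dist_triangle[of "h i (real j / m)" "h i (real (Suc j) / m)" "h i (l j)"]
          dist_triangle[of "h i (l j)" "h i (real (Suc j) / m)" "h i (u j)"] by simp
    qed
    also have "\<dots> = (\<Sum>(i, j)\<in>?I. dist (h i (l j)) (h i (u j))) + C * \<eta>"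
      by (simp add: split_def sum.distrib C_def)
    finally show ?thesis
      using 1 by linarith
  qed
  have "((\<lambda>\<eta>. H + C * \<eta>) \<longlongrightarrow> H + C * 0) (at_right 0)"
    by (intro tendsto_intros)
  moreover have "\<forall>\<^sub>F \<eta> in at_right 0. (\<Sum>(i, j)\<in>?I. dist (h i (real j / m)) (h i (real (Suc j) / m))) \<le> H + C * \<eta>"
    unfolding eventually_at_right_field using shrink m by (intro exI[of _ "1 / (2 * real m)"]) auto
  ultimately have "(\<Sum>(i, j)\<in>?I. dist (h i (real j / m)) (h i (real (Suc j) / m))) \<le> H + C * 0"
    by (intro tendsto_lowerbound[where F = "at_right (0::real)"]) auto
  then show ?thesis
    by simp
qed

text \<open>Finitely many closed balls around the nodes cover the arc; their union is closed and
  hence covers the limit points at the ends too.\<close>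

lemma closure_lipschitz_arc_net:
  fixes h :: "real \<Rightarrow> 'a::heine_borel"
  assumes lip: "L-lipschitz_on {0<..<1} h" and m: "2 \<le> m" and z: "z \<in> closure (h ` {0<..<1})"
  obtains j where "j \<in> {1..<m}" "dist z (h (real j / m)) \<le> L / m"
proof -
  have L: "0 \<le> L"
    using lip lipschitz_on_nonneg by blast
  let ?N = "\<Union>j\<in>{1..<m}. cball (h (real j / m)) (L / m)"
  have "h ` {0<..<1} \<subseteq> ?N"
  proof clarify
    fix t :: real assume t: "t \<in> {0<..<1}"
    define n where "n = nat \<lfloor>t * m\<rfloor>"
    \<comment> \<open>Parameters below \<open>1 / m\<close> are assigned to the first node, still
      within distance \<open>1 / m\<close>.\<close>
    define j where "j = max 1 n"
    have n: "real n \<le> t * m" "t * m < real n + 1"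
      using t by (auto simp: n_def)
    have "t * m < 1 * real m"
      using t m by (intro mult_strict_right_mono) auto
    with n have "real n < real m"
      by linarith
    then have j: "j \<in> {1..<m}"
      using m by (auto simp: j_def)
    have "\<bar>t * m - j\<bar> \<le> 1"
      using n t m by (auto simp: j_def max_def abs_le_iff)
    then have "\<bar>(t * m - j) / m\<bar> \<le> 1 / m"
      by (simp add: abs_divide divide_right_mono)
    moreover have "(t * m - j) / m = t - j / m"
      using m by (simp add: field_simps)
    ultimately have "dist (real j / m) t \<le> 1 / m"
      by (simp add: dist_real_def abs_minus_commute)
    moreover have "dist (h (real j / m)) (h t) \<le> L * dist (real j / m) t"
      using lip t j m by (intro lipschitz_onD) (auto simp: field_simps)
    ultimately have "dist (h (real j / m)) (h t) \<le> L * (1 / m)"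
      using L by (meson mult_left_mono order_trans)
    then show "h t \<in> ?N"
      using j by auto
  qed
  moreover have "closed ?N"
    by (intro closed_UN) auto
  ultimately have "closure (h ` {0<..<1}) \<subseteq> ?N"
    by (rule closure_minimal)
  then show ?thesis
    using z that by (auto simp: dist_commute)
qed

lemma closed_segment_near_end:
  fixes a b :: "'a::euclidean_space"
  assumes "y \<in> closed_segment a b"
  shows "dist a y \<le> dist a b"
  using dist_in_closed_segment[OF assms] by (simp add: dist_commute)

text \<open>The tree follows three kinds of links: chords along each arc, a bridge for every pair of
  arcs with intersecting closures, and a link from \<open>0\<close> to each arc with
  \<open>0\<close> in its closure. The last two kinds contribute at most
  \<open>2 * k^2 * (L / m)\<close> and \<open>k * (L / m)\<close>. Every link has length at most
  \<open>2 * (L / m)\<close>, which keeps the tree close to \<open>\<Gamma>\<close>; connectedness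
  of \<open>\<Gamma>\<close> guarantees that all nodes are reached.\<close>

lemma connected_arcs_tree_approximation:
  fixes h :: "nat \<Rightarrow> real \<Rightarrow> 'a::euclidean_space" and m :: nat
  assumes inj: "\<And>i. i < k \<Longrightarrow> inj_on (h i) {0<..<1}"
    and lip: "\<And>i. i < k \<Longrightarrow> L-lipschitz_on {0<..<1} (h i)"
    and disj: "disjoint_family_on (\<lambda>i. h i ` {0<..<1}) {..<k}"
    and \<Gamma>: "\<Gamma> = (\<Union>i<k. closure (h i ` {0<..<1}))" "connected \<Gamma>" "0 \<in> \<Gamma>"
    and H: "hausdorff1 \<Gamma> = ennreal H" "0 \<le> H" and m: "2 \<le> m"
  obtains V E where "straight_tree V E"
    "total_length E \<le> H + (2 * real k ^ 2 + real k) * (L / m)"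
    "\<And>y. y \<in> skeleton V E \<Longrightarrow> \<exists>x\<in>\<Gamma>. dist x y \<le> 2 * (L / m)"
    "\<And>x. x \<in> \<Gamma> \<Longrightarrow> \<exists>y\<in>skeleton V E. dist x y \<le> L / m"
proof -
  define \<rho> where "\<rho> = L / m"
  define A where "A i = closure (h i ` {0<..<1})" for i
  define P where "P i j = h i (real j / m)" for i j
  have sub: "h i ` {0<..<1} \<subseteq> \<Gamma>" if "i < k" for i
    unfolding \<Gamma>(1) using that closure_subset by fast
  have k: "0 < k"
    using \<Gamma>(1,3) by (cases k) auto
  have \<rho>: "0 \<le> \<rho>"
    using lipschitz_on_nonneg[OF lip[OF k]] by (simp add: \<rho>_def)
  have P\<Gamma>: "P i j \<in> \<Gamma>" if "i < k" "j \<in> {1..<m}" for i j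
    using sub[OF that(1)] that(2) m by (force simp: P_def field_simps)
  have net: "\<exists>j\<in>{1..<m}. dist z (P i j) \<le> \<rho>" if "i < k" "z \<in> A i" for i z
    using closure_lipschitz_arc_net[OF lip[OF that(1)] m] that(2) unfolding A_def P_def \<rho>_def by metis
  define chord where "chord = (\<lambda>(i, j). (P i j, P i (Suc j)))"
  define I where "I = {..<k} \<times> {1..<m - 1}"
  define touch where "touch = {(i, i'). i < k \<and> i' < k \<and> A i \<inter> A i' \<noteq> {}}"
  have "\<exists>j\<in>{1..<m}. \<exists>j'\<in>{1..<m}. dist (P i j) (P i' j') \<le> 2 * \<rho>" if "(i, i') \<in> touch" for i i'
  proof -
    obtain z where z: "z \<in> A i" "z \<in> A i'" "i < k" "i' < k"
      using \<open>(i, i') \<in> touch\<close> by (auto simp: touch_def)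
    obtain j j' where "j \<in> {1..<m}" "dist z (P i j) \<le> \<rho>" "j' \<in> {1..<m}" "dist z (P i' j') \<le> \<rho>"
      using net z by metis
    then show ?thesis
      using dist_triangle3[of "P i j" "P i' j'" z] by (intro bexI[of _ j] bexI[of _ j']) auto
  qed
  then obtain b b' where b: "\<And>i i'. (i, i') \<in> touch \<Longrightarrow> b i i' \<in> {1..<m}"
    "\<And>i i'. (i, i') \<in> touch \<Longrightarrow> b' i i' \<in> {1..<m}"
    "\<And>i i'. (i, i') \<in> touch \<Longrightarrow> dist (P i (b i i')) (P i' (b' i i')) \<le> 2 * \<rho>"
    by metis
  define bridge where "bridge = (\<lambda>(i, i'). (P i (b i i'), P i' (b' i i')))"
  define base where "base = {i. i < k \<and> 0 \<in> A i}"
  have "\<exists>j\<in>{1..<m}. dist 0 (P i j) \<le> \<rho>" if "i \<in> base" for i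
    using net[of i 0] that by (auto simp: base_def)
  then obtain r where r: "\<And>i. i \<in> base \<Longrightarrow> r i \<in> {1..<m}" "\<And>i. i \<in> base \<Longrightarrow> dist 0 (P i (r i)) \<le> \<rho>"
    by metis
  define rt where "rt i = (0 :: 'a, P i (r i))" for i
  define F where "F = chord ` I \<union> (bridge ` touch \<union> rt ` base)"
  define len where "len = (\<lambda>(x :: 'a, y). dist x y)"
  have touch_sub: "touch \<subseteq> {..<k} \<times> {..<k}" and base_sub: "base \<subseteq> {..<k}"
    by (auto simp: touch_def base_def)
  have fin: "finite I" "finite touch" "finite base"
    using finite_subset[OF touch_sub] finite_subset[OF base_sub] by (auto simp: I_def)
  then have finF: "finite F"
    by (simp add: F_def)
  have len0: "0 \<le> len e" for e
    by (simp add: len_def split_def)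
  have chordD: "len (chord (i, j)) \<le> 2 * \<rho>" if "(i, j) \<in> I" for i j
  proof -
    have ij: "i < k" "1 \<le> j" "Suc j < m"
      using that by (auto simp: I_def)
    then have "dist (P i j) (P i (Suc j)) \<le> L * dist (real j / m) (real (Suc j) / m)"
      unfolding P_def using m by (intro lipschitz_onD[OF lip]) (auto simp: field_simps)
    also have "dist (real j / m) (real (Suc j) / m) = 1 / m"
      by (simp add: dist_real_def add_divide_distrib)
    finally show ?thesis
      using \<rho> by (simp add: len_def chord_def \<rho>_def)
  qed
  have short: "dist x y \<le> 2 * \<rho>" "x = 0 \<or> x \<in> \<Gamma>" if xy: "(x, y) \<in> F" for x y
  proof -
    consider p where "p \<in> I" "(x, y) = chord p" | p where "p \<in> touch" "(x, y) = bridge p"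
      | i where "i \<in> base" "(x, y) = rt i"
      using xy by (auto simp: F_def)
    then have "dist x y \<le> 2 * \<rho> \<and> (x = 0 \<or> x \<in> \<Gamma>)"
    proof cases
      case (1 p)
      obtain i j where p: "p = (i, j)"
        by fastforce
      have "x = P i j" "i < k" "j \<in> {1..<m}"
        using 1 p by (auto simp: chord_def I_def)
      then show ?thesis
        using chordD[of i j] 1 p P\<Gamma> by (auto simp: len_def chord_def)
    next
      case (2 p)
      obtain i i' where p: "p = (i, i')"
        by fastforce
      have "i < k"
        using 2 p by (auto simp: touch_def)
      then show ?thesis
        using b[of i i'] 2 p P\<Gamma> by (auto simp: bridge_def)
    next
      case (3 i)
      then show ?thesis
        using r(2)[of i] \<rho> by (auto simp: rt_def)
    qed
    then show "dist x y \<le> 2 * \<rho>" "x = 0 \<or> x \<in> \<Gamma>"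
      by auto
  qed
  have lenF: "sum len F \<le> H + (2 * real k ^ 2 + real k) * \<rho>"
  proof -
    \<comment> \<open>Links form a set of pairs, so coinciding ones are counted once; this gives
      only an inequality, in the required direction.\<close>
    have "sum len (chord ` I) \<le> (\<Sum>p\<in>I. len (chord p))"
      using sum_image_le[of I len chord] fin(1) len0 by (simp add: o_def)
    also have "\<dots> \<le> H"
      using chord_sum_le_hausdorff1[OF inj lip disj sub H] m
      by (simp add: I_def len_def chord_def P_def split_def)
    finally have 1: "sum len (chord ` I) \<le> H" .
    have "sum len (bridge ` touch) \<le> (\<Sum>p\<in>touch. len (bridge p))"
      using sum_image_le[of touch len bridge] fin(2) len0 by (simp add: o_def)
    also have "\<dots> \<le> (\<Sum>p\<in>touch. 2 * \<rho>)"
      using b(3) by (intro sum_mono) (auto simp: len_def bridge_def)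
    also have "\<dots> = real (card touch) * (2 * \<rho>)"
      by simp
    also have "\<dots> \<le> (real k * real k) * (2 * \<rho>)"
    proof (rule mult_right_mono)
      have "card touch \<le> k * k"
        using card_mono[OF _ touch_sub] by simp
      then show "real (card touch) \<le> real k * real k"
        by (metis of_nat_le_iff of_nat_mult)
    qed (use \<rho> in simp)
    finally have 2: "sum len (bridge ` touch) \<le> (real k * real k) * (2 * \<rho>)" .
    have "sum len (rt ` base) \<le> (\<Sum>i\<in>base. len (rt i))"
      using sum_image_le[of base len rt] fin(3) len0 by (simp add: o_def)
    also have "\<dots> \<le> (\<Sum>i\<in>base. \<rho>)"
      using r(2) by (intro sum_mono) (auto simp: len_def rt_def)
    also have "\<dots> = real (card base) * \<rho>"
      by simp
    also have "\<dots> \<le> real k * \<rho>"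
      using card_mono[OF _ base_sub] \<rho> by (intro mult_right_mono) auto
    finally have 3: "sum len (rt ` base) \<le> real k * \<rho>" .
    have "sum len F \<le> sum len (chord ` I) + (sum len (bridge ` touch) + sum len (rt ` base))"
      unfolding F_def
      using sum_Un_le[of "chord ` I" "bridge ` touch \<union> rt ` base" len] sum_Un_le[of "bridge ` touch" "rt ` base" len]
        fin len0 by simp
    then show ?thesis
      using 1 2 3 by (simp add: power2_eq_square algebra_simps)
  qed
  obtain V E where T: "straight_tree V E" "skeleton {0} {} \<subseteq> skeleton V E"
    "skeleton V E \<subseteq> skeleton {0} {} \<union> (\<Union>(x, y)\<in>F. closed_segment x y)"
    "total_length E \<le> total_length ({} :: ('a \<times> 'a) set) + (\<Sum>(x, y)\<in>F. dist x y)"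
    "\<And>x y. (x, y) \<in> F \<Longrightarrow> x \<in> skeleton V E \<longleftrightarrow> y \<in> skeleton V E"
    by (rule straight_tree_grow[OF finF straight_tree.root], rule that) (assumption | blast)+
  have zero: "0 \<in> skeleton V E"
    using straight_tree_root[OF T(1)] by (simp add: skeleton_def)
  \<comment> \<open>Consecutive nodes are joined by chords, so the nodes of one arc are on the tree
    all together or not at all.\<close>
  have chain: "P i j \<in> skeleton V E \<longleftrightarrow> P i 1 \<in> skeleton V E" if "i < k" "j \<in> {1..<m}" for i j
  proof -
    have "1 \<le> j" "j < m"
      using that by auto
    then show ?thesis
    proof (induction j rule: dec_induct)
      case (step j)
      then have "(P i j, P i (Suc j)) \<in> F"
        using that(1) by (force simp: F_def chord_def I_def)
      then show ?case
        using T(5) step by auto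
    qed simp
  qed
  define X where "X = {i. i < k \<and> P i 1 \<in> skeleton V E}"
  obtain i0 where i0: "i0 \<in> base"
    using \<Gamma>(1,3) by (auto simp: base_def A_def)
  then have "rt i0 \<in> F" "i0 < k"
    by (auto simp: F_def base_def)
  then have "P i0 (r i0) \<in> skeleton V E"
    using T(5) zero by (auto simp: rt_def)
  then have X0: "i0 \<in> X"
    using chain[OF \<open>i0 < k\<close> r(1)[OF i0]] \<open>i0 < k\<close> by (simp add: X_def)
  \<comment> \<open>If some arc were unreached, the closures of the reached and of the unreached
    arcs would be two closed sets covering the connected \<open>\<Gamma>\<close>, hence with a
    common point in it. The bridge belonging to that point would join a reached arc to an unreached
    one.\<close>
  have "X = {..<k}"
  proof (rule ccontr)
    assume "X \<noteq> {..<k}"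
    then obtain i1 where i1: "i1 < k" "i1 \<notin> X"
      by (auto simp: X_def)
    let ?C = "\<Union>i\<in>X. A i" and ?D = "\<Union>i\<in>{..<k} - X. A i"
    have closed: "closed ?C" "closed ?D"
      by (auto intro!: closed_UN simp: X_def A_def)
    have cov: "\<Gamma> \<subseteq> ?C \<union> ?D"
      by (auto simp: \<Gamma>(1) A_def)
    have ne: "A i \<noteq> {}" "A i \<subseteq> \<Gamma>" if "i < k" for i
      using that by (auto simp: A_def \<Gamma>(1))
    have "?C \<inter> \<Gamma> \<noteq> {}"
      using ne[of i0] X0 \<open>i0 < k\<close> by blast
    moreover have "?D \<inter> \<Gamma> \<noteq> {}"
      using ne[of i1] i1 by blast
    ultimately have "?C \<inter> ?D \<inter> \<Gamma> \<noteq> {}"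
      using connected_closedD[OF \<Gamma>(2) _ cov closed] by blast
    then obtain i i' z where i: "i \<in> X" "i' < k" "i' \<notin> X" "z \<in> A i" "z \<in> A i'"
      by blast
    then have t: "(i, i') \<in> touch"
      by (auto simp: touch_def X_def)
    then have "bridge (i, i') \<in> F"
      by (auto simp: F_def)
    moreover have "P i (b i i') \<in> skeleton V E"
      using chain[of i "b i i'"] b(1)[OF t] i(1) by (simp add: X_def)
    ultimately have "P i' (b' i i') \<in> skeleton V E"
      using T(5) by (auto simp: bridge_def)
    then show False
      using chain[OF i(2) b(2)[OF t]] i(2,3) by (simp add: X_def)
  qed
  then have all: "P i j \<in> skeleton V E" if "i < k" "j \<in> {1..<m}" for i j
    using chain[OF that] that(1) by (auto simp: X_def)
  show ?thesis
  proof (rule that[OF T(1)])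
    show "total_length E \<le> H + (2 * real k ^ 2 + real k) * (L / m)"
      using T(4) lenF by (simp add: total_length_def len_def \<rho>_def)
    show "\<exists>x\<in>\<Gamma>. dist x y \<le> 2 * (L / m)" if y: "y \<in> skeleton V E" for y
    proof (cases "y = 0")
      case True
      then show ?thesis
        using \<Gamma>(3) \<rho> by (intro bexI[of _ 0]) (auto simp: \<rho>_def)
    next
      case False
      then obtain x x' where x: "(x, x') \<in> F" "y \<in> closed_segment x x'"
        using T(3) y by (auto simp: skeleton_def)
      then have "dist x y \<le> 2 * \<rho>"
        using closed_segment_near_end[OF x(2)] short(1)[OF x(1)] by linarith
      then show ?thesis
        using short(2)[OF x(1)] \<Gamma>(3) by (auto simp: \<rho>_def)
    qed
    show "\<exists>y\<in>skeleton V E. dist x y \<le> L / m" if x: "x \<in> \<Gamma>" for x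
    proof -
      obtain i where "i < k" "x \<in> A i"
        using x by (auto simp: \<Gamma>(1) A_def)
      then show ?thesis
        using net all unfolding \<rho>_def by blast
    qed
  qed
qed

section \<open>From trees to the approximating sequence\<close>

lemma hausdorff_dist_bounds:
  assumes "A \<noteq> {}" "B \<noteq> {}"
    and A: "\<And>x. x \<in> A \<Longrightarrow> \<exists>y\<in>B. dist x y \<le> e" and B: "\<And>y. y \<in> B \<Longrightarrow> \<exists>x\<in>A. dist y x \<le> e"
  shows "0 \<le> hausdorff_dist A B" "hausdorff_dist A B \<le> e"
proof -
  have 1: "infdist x B \<le> e" if "x \<in> A" for x
    using A[OF that] infdist_le by (meson order_trans)
  have 2: "infdist y A \<le> e" if "y \<in> B" for y
    using B[OF that] infdist_le by (meson order_trans)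
  show "hausdorff_dist A B \<le> e"
    unfolding hausdorff_dist_def using assms(1,2) 1 2 by (intro max.boundedI cSUP_least) auto
  obtain x where "x \<in> A"
    using assms(1) by blast
  then have "0 \<le> (SUP x\<in>A. infdist x B)"
    using 1 by (intro cSUP_upper2[of _ _ x] infdist_nonneg bdd_aboveI[of _ e]) auto
  then show "0 \<le> hausdorff_dist A B"
    unfolding hausdorff_dist_def by simp
qed

lemma lipschitz_triangulableE:
  assumes "lipschitz_triangulable \<Gamma>"
  obtains S k h where "compact \<Gamma>" "finite S" "S \<subseteq> \<Gamma>" "\<forall>i<k. lipschitz_arc (h i)"
    "disjoint_family_on (\<lambda>i. h i ` {0<..<1}) {..<k::nat}" "\<Gamma> - S = (\<Union>i<k. h i ` {0<..<1})"
  using assms unfolding lipschitz_triangulable_def by (elim conjE exE) (rule that; assumption)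

lemma lipschitz_triangulable_hausdorff1:
  assumes "lipschitz_triangulable \<Gamma>"
  obtains H where "0 \<le> H" "hausdorff1 \<Gamma> = ennreal H"
proof -
  obtain S and k :: nat and h where S: "finite S" and arc: "\<forall>i<k. lipschitz_arc (h i)"
    and eq: "\<Gamma> - S = (\<Union>i<k. h i ` {0<..<1})"
    by (rule lipschitz_triangulableE[OF assms]) (rule that; assumption)
  have "hausdorff1 \<Gamma> \<le> hausdorff1 (S \<union> (\<Union>i<k. h i ` {0<..<1}))"
    using eq by (intro hausdorff1_mono) blast
  also have "\<dots> \<le> hausdorff1 S + hausdorff1 (\<Union>i<k. h i ` {0<..<1})"
    by (rule hausdorff1_Un)
  also have "\<dots> \<le> (\<Sum>i<k. hausdorff1 (h i ` {0<..<1}))"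
    using hausdorff1_finite[OF S] hausdorff1_Union_le[of "{..<k}" "\<lambda>i. h i ` {0<..<1}"] by simp
  also have "\<dots> < \<infinity>"
  proof -
    have "hausdorff1 (h i ` {0<..<1}) < \<infinity>" if "i < k" for i
    proof -
      obtain L where "L-lipschitz_on {0<..<1} (h i)"
        using arc \<open>i < k\<close> unfolding lipschitz_arc_def by blast
      from hausdorff1_lipschitz_image[OF this] show ?thesis
        by (rule le_less_trans) simp
    qed
    then show ?thesis
      by simp
  qed
  finally show ?thesis
    using that[of "enn2real (hausdorff1 \<Gamma>)"] by simp
qed

lemma closure_finite_UN:
  "finite I \<Longrightarrow> closure (\<Union>i\<in>I. A i) = (\<Union>i\<in>I. closure (A i))"
  by (induction I rule: finite_induct) simp_all

text \<open>The single point is treated apart, being the case in which removing \<open>S\<close>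
  could lose points of \<open>\<Gamma>\<close>. Otherwise the mesh is refined until all errors of
  the construction are below \<open>\<epsilon>\<close>.\<close>

lemma triangulable_curve_tree_approximation:
  assumes conn: "connected \<Gamma>" and tri: "lipschitz_triangulable \<Gamma>" and "0 \<in> \<Gamma>"
    and H: "hausdorff1 \<Gamma> = ennreal H" "0 \<le> H" and "\<epsilon> > 0"
  obtains V E where "straight_tree V E" "total_length E \<le> H + \<epsilon>"
    "\<And>y. y \<in> skeleton V E \<Longrightarrow> \<exists>x\<in>\<Gamma>. dist x y \<le> \<epsilon>"
    "\<And>x. x \<in> \<Gamma> \<Longrightarrow> \<exists>y\<in>skeleton V E. dist x y \<le> \<epsilon>"
proof (cases "\<Gamma> = {0}")
  case True
  then show ?thesis
    using that[OF straight_tree.root] H(2) \<open>\<epsilon> > 0\<close> by (simp add: skeleton_def total_length_def)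
next
  case False
  obtain S and k :: nat and h where compact: "compact \<Gamma>" and S: "finite S" "S \<subseteq> \<Gamma>"
    and arc: "\<forall>i<k. lipschitz_arc (h i)"
    and disj: "disjoint_family_on (\<lambda>i. h i ` {0<..<1}) {..<k}"
    and eq: "\<Gamma> - S = (\<Union>i<k. h i ` {0<..<1})"
    by (rule lipschitz_triangulableE[OF tri]) (rule that; assumption)
  have inj: "inj_on (h i) {0<..<1}" if "i < k" for i
    using arc that by (simp add: lipschitz_arc_def)
  have "\<exists>L. L-lipschitz_on {0<..<1} (h i)" if "i < k" for i
    using arc that by (simp add: lipschitz_arc_def)
  then obtain C :: "nat \<Rightarrow> real" where C: "\<And>i. i < k \<Longrightarrow> (C i)-lipschitz_on {0<..<1} (h i)"
    by metis
  \<comment> \<open>The sum of the nonnegative constants serves as one Lipschitz constant for all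
    arcs.\<close>
  define L where "L = (\<Sum>i<k. C i)"
  have C0: "0 \<le> C i" if "i < k" for i
    using C[OF that] lipschitz_on_nonneg by blast
  have lip: "L-lipschitz_on {0<..<1} (h i)" if "i < k" for i
  proof (rule lipschitz_on_mono[OF C[OF that]])
    show "C i \<le> L"
      unfolding L_def using that C0 by (intro member_le_sum) auto
  qed simp
  have L: "0 \<le> L"
    unfolding L_def using C0 by (intro sum_nonneg) auto
  have "\<Gamma> \<noteq> {x}" for x
    using False \<open>0 \<in> \<Gamma>\<close> by auto
  then have "\<Gamma> \<subseteq> closure (\<Gamma> - S)"
    using conn S(1) by (intro connected_subset_closure_Diff_finite)
  moreover have "closure (\<Gamma> - S) \<subseteq> \<Gamma>"
    using compact by (intro closure_minimal compact_imp_closed) auto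
  moreover have "closure (\<Gamma> - S) = (\<Union>i<k. closure (h i ` {0<..<1}))"
    unfolding eq by (rule closure_finite_UN) simp
  ultimately have \<Gamma>: "\<Gamma> = (\<Union>i<k. closure (h i ` {0<..<1}))"
    by auto
  \<comment> \<open>One factor dominating both errors in units of \<open>L / m\<close>: the excess
    length, and the distance \<open>2 * (L / m)\<close>.\<close>
  define c where "c = 2 * real k ^ 2 + real k + 2"
  have c: "c > 0"
    by (simp add: c_def add_nonneg_pos)
  obtain n :: nat where n: "L * c / \<epsilon> < real n"
    using reals_Archimedean2 by blast
  define m where "m = max 2 n"
  have m: "2 \<le> m" "L * c / \<epsilon> < real m"
    using n by (auto simp: m_def)
  have "L * c < real m * \<epsilon>"
    using m(2) \<open>\<epsilon> > 0\<close> by (simp add: pos_divide_less_eq)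
  then have small: "c * (L / m) \<le> \<epsilon>"
    using m(1) by (simp add: field_simps)
  have \<rho>: "0 \<le> L / m"
    using L by simp
  have "c * (L / m) = (2 * real k ^ 2 + real k) * (L / m) + 2 * (L / m)"
    by (simp add: c_def algebra_simps)
  moreover have "0 \<le> (2 * real k ^ 2 + real k) * (L / m)"
    using \<rho> by (intro mult_nonneg_nonneg) auto
  ultimately have le: "(2 * real k ^ 2 + real k) * (L / m) \<le> \<epsilon>" "2 * (L / m) \<le> \<epsilon>" "L / m \<le> \<epsilon>"
    using small \<rho> by linarith+
  obtain V E where T: "straight_tree V E" "total_length E \<le> H + (2 * real k ^ 2 + real k) * (L / m)"
    "\<And>y. y \<in> skeleton V E \<Longrightarrow> \<exists>x\<in>\<Gamma>. dist x y \<le> 2 * (L / m)"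
    "\<And>x. x \<in> \<Gamma> \<Longrightarrow> \<exists>y\<in>skeleton V E. dist x y \<le> L / m"
    by (rule connected_arcs_tree_approximation[OF inj lip disj \<Gamma> conn \<open>0 \<in> \<Gamma>\<close> H m(1)], assumption, assumption, rule that)
  show ?thesis
  proof (rule that[OF T(1)])
    show "total_length E \<le> H + \<epsilon>"
      using T(2) le(1) by linarith
    show "\<exists>x\<in>\<Gamma>. dist x y \<le> \<epsilon>" if "y \<in> skeleton V E" for y
      using T(3)[OF that] le(2) by (meson order_trans)
    show "\<exists>y\<in>skeleton V E. dist x y \<le> \<epsilon>" if "x \<in> \<Gamma>" for x
      using T(4)[OF that] le(3) by (meson order_trans)
  qed
qed

text \<open>The approximating tree contributes \<open>\<epsilon>\<close> to the distance and the
  hairs \<open>2 * \<epsilon>\<close>. In the other direction nothing is lost, because hairs only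
  enlarge the tree.\<close>

lemma universal_tree_approximation:
  assumes "connected \<Gamma>" "lipschitz_triangulable \<Gamma>" "0 \<in> \<Gamma>"
    and H: "hausdorff1 \<Gamma> = ennreal H" "0 \<le> H" and "\<epsilon> > 0"
  obtains V E where "straight_tree V E" "\<bar>total_length E - H\<bar> \<le> 2 * \<epsilon>"
    "0 \<le> hausdorff_dist (skeleton V E) \<Gamma>" "hausdorff_dist (skeleton V E) \<Gamma> \<le> 3 * \<epsilon>"
    "\<And>v. v \<in> V \<Longrightarrow> card (incident E v) \<noteq> 2"
proof -
  obtain V0 E0 where 0: "straight_tree V0 E0" "total_length E0 \<le> H + \<epsilon>"
    "\<And>y. y \<in> skeleton V0 E0 \<Longrightarrow> \<exists>x\<in>\<Gamma>. dist x y \<le> \<epsilon>"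
    "\<And>x. x \<in> \<Gamma> \<Longrightarrow> \<exists>y\<in>skeleton V0 E0. dist x y \<le> \<epsilon>"
    by (rule triangulable_curve_tree_approximation[OF assms], rule that)
  obtain V E where 1: "straight_tree V E" "skeleton V0 E0 \<subseteq> skeleton V E"
    "\<And>y. y \<in> skeleton V E \<Longrightarrow> \<exists>x\<in>skeleton V0 E0. dist x y \<le> 2 * \<epsilon>"
    "\<bar>total_length E - H\<bar> \<le> 2 * \<epsilon>" "\<And>v. v \<in> V \<Longrightarrow> card (incident E v) \<noteq> 2"
    by (rule straight_tree_adjust[OF 0(1) \<open>\<epsilon> > 0\<close> 0(2)], rule that)
  have ne: "skeleton V E \<noteq> {}" "\<Gamma> \<noteq> {}"
    using straight_tree_root[OF 1(1)] assms(3) by (auto simp: skeleton_def)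
  have A: "\<exists>y\<in>\<Gamma>. dist x y \<le> 3 * \<epsilon>" if x: "x \<in> skeleton V E" for x
  proof -
    obtain y where y: "y \<in> skeleton V0 E0" "dist y x \<le> 2 * \<epsilon>"
      using 1(3)[OF x] by blast
    obtain z where z: "z \<in> \<Gamma>" "dist z y \<le> \<epsilon>"
      using 0(3)[OF y(1)] by blast
    then show ?thesis
      using y(2) dist_triangle[of z x y] by (intro bexI[of _ z]) (auto simp: dist_commute)
  qed
  have B: "\<exists>x\<in>skeleton V E. dist y x \<le> 3 * \<epsilon>" if "y \<in> \<Gamma>" for y
  proof -
    obtain x where "x \<in> skeleton V0 E0" "dist y x \<le> \<epsilon>"
      using 0(4)[OF \<open>y \<in> \<Gamma>\<close>] by blast
    then show ?thesis
      using 1(2) \<open>\<epsilon> > 0\<close> by (intro bexI[of _ x]) auto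
  qed
  show ?thesis
    by (rule that[OF 1(1,4) hausdorff_dist_bounds[OF ne A B] 1(5)])
qed

theorem corollary2p8:
  fixes T :: real and \<Gamma> :: "(real^2) set"
  assumes "T > 0"
    and "connected \<Gamma>"
    and "lipschitz_triangulable \<Gamma>"
    and "0 \<in> \<Gamma>"
  shows "\<exists>G :: nat \<Rightarrow> (real^2) set.
           (\<forall>i. universal_curve T (G i)) \<and>
           (\<lambda>i. hausdorff1 (G i)) \<longlonglongrightarrow> hausdorff1 \<Gamma> \<and>
           (\<lambda>i. hausdorff_dist (G i) \<Gamma>) \<longlonglongrightarrow> 0 \<and>
           (\<forall>i. finite (singular_points (G i)) \<and>
                closed_smooth_1submanifold_of (UNIV - singular_points (G i))
                  (G i - singular_points (G i)))"
proof -
  obtain H where H: "0 \<le> H" "hausdorff1 \<Gamma> = ennreal H"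
    using lipschitz_triangulable_hausdorff1[OF assms(3)] .
  have "\<exists>V E. straight_tree V E \<and> \<bar>total_length E - H\<bar> \<le> 2 * inverse (Suc i) \<and>
      0 \<le> hausdorff_dist (skeleton V E) \<Gamma> \<and> hausdorff_dist (skeleton V E) \<Gamma> \<le> 3 * inverse (Suc i) \<and>
      (\<forall>v\<in>V. card (incident E v) \<noteq> 2)" for i
    by (rule universal_tree_approximation[OF assms(2-4) H(2,1), of "inverse (Suc i)"]) (simp, blast)
  then obtain V E where T: "\<And>i. straight_tree (V i) (E i)"
    and len: "\<And>i. \<bar>total_length (E i) - H\<bar> \<le> 2 * inverse (Suc i)"
    and dist: "\<And>i. 0 \<le> hausdorff_dist (skeleton (V i) (E i)) \<Gamma>"
      "\<And>i. hausdorff_dist (skeleton (V i) (E i)) \<Gamma> \<le> 3 * inverse (Suc i)"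
    and deg: "\<And>i v. v \<in> V i \<Longrightarrow> card (incident (E i) v) \<noteq> 2"
    by metis
  define G where "G i = skeleton (V i) (E i)" for i
  note graph = straight_tree_graph[OF T]
  have small: "(\<lambda>i. C * inverse (real (Suc i))) \<longlonglongrightarrow> 0" for C
    using tendsto_mult_right_zero[OF LIMSEQ_inverse_real_of_nat] .
  have "universal_curve T (G i)" for i
    unfolding universal_curve_def G_def
    using straight_tree_connected[OF T] lipschitz_triangulable_skeleton[OF graph]
      straight_tree_root[OF T] straight_tree_universal[OF assms(1) T]
    by (auto simp: skeleton_def)
  moreover have "(\<lambda>i. hausdorff1 (G i)) \<longlonglongrightarrow> hausdorff1 \<Gamma>"
  proof -
    have "(\<lambda>i. total_length (E i) - H) \<longlonglongrightarrow> 0"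
      using len by (intro Lim_null_comparison[OF _ small[of 2]]) auto
    then have "(\<lambda>i. total_length (E i)) \<longlonglongrightarrow> H"
      by (simp add: LIM_zero_iff)
    then show ?thesis
      unfolding G_def hausdorff1_skeleton[OF graph] H(2) by (rule tendsto_ennrealI)
  qed
  moreover have "(\<lambda>i. hausdorff_dist (G i) \<Gamma>) \<longlonglongrightarrow> 0"
    unfolding G_def using dist by (intro tendsto_sandwich[OF _ _ tendsto_const small[of 3]]) auto
  moreover have "finite (singular_points (G i)) \<and>
      closed_smooth_1submanifold_of (UNIV - singular_points (G i)) (G i - singular_points (G i))" for i
  proof -
    \<comment> \<open>The degree condition was arranged for this: all corners are vertices, so they
      all belong to the removed set.\<close>
    have "singular_points (G i) = V i"
      unfolding G_def using deg by (intro singular_points_skeleton[OF graph])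
    then show ?thesis
      using straight_graphD(1)[OF graph] smooth_submanifold_skeleton[OF graph] by (simp add: G_def)
  qed
  ultimately show ?thesis
    by blast
qed

end
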